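(* Let $G$ be a finite group. Let $\mathbf A$ be the category of separable C*-algebras and *-homomorphisms, let $\mathbf B$ be a full subcategory of $\mathbf A$, let $\mathbf C$ be a category, and let $\mathrm F\colon \mathbf B\to\mathbf C$ be a functor that classifies homomorphisms. Let $\mathbf B_G$, $\mathbf{RB}_G$, $\mathbf C_G$ be the associated equivariant categories and $\mathrm F_G\colon\mathbf B_G\to\mathbf C_G$ the induced functor (see context). (i) Let $(A,\alpha)$ be an object in $\mathbf B_G$ and let $(B,\beta)$ be an object in $\mathbf{RB}_G$. (a) For every morphism $\gamma\colon(\mathrm F(A),\mathrm F(\alpha))\to(\mathrm F(B),\mathrm F(\beta))$ in $\mathbf C_G$ there exists a morphism $\phi\colon(A,\alpha)\to(B,\beta)$ in $\mathbf B_G$ such that $\mathrm F_G(\phi)=\gamma$. (b) If $\phi,\psi\colon(A,\alpha)\to(B,\beta)$ are morphisms in $\mathbf B_G$ such that $\mathrm F_G(\phi)=\mathrm F_G(\psi)$, then $\phi\sim_{G\text{-}\mathrm{au}}\psi$. (ii) The restriction of the functor $\mathrm F_G$ to $\mathbf{RB}_G$ classifies homomorphisms.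
   Context: For a C*-algebra $A$, $\widetilde A$ is the C*-algebra obtained by adjoining a unit to $A$ (even if $A$ is unital). If $\alpha$ is an action of $G$ on $A$, $A^\alpha$ is the fixed point algebra. Rokhlin property: an action $\alpha\colon G\to\mathrm{Aut}(A)$ of a finite group $G$ on a (not necessarily unital) C*-algebra $A$ has the Rokhlin property if for every $\varepsilon>0$ and every finite $F\subseteq A$ there exist mutually orthogonal positive contractions $r_g\in A$, $g\in G$, with $\|\alpha_g(r_h)-r_{gh}\|<\varepsilon$ for all $g,h\in G$; $\|r_ga-ar_g\|<\varepsilon$ for all $a\in F$, $g\in G$; and $\|(\sum_{g\in G}r_g)a-a\|<\varepsilon$ for all $a\in F$. Equivariant approximate unitary equivalence: equivariant *-homomorphisms $\phi,\psi\colon(A,\alpha)\to(B,\beta)$ satisfy $\phi\sim_{G\text{-}\mathrm{au}}\psi$ if for every finite $F\subseteq A$ and $\varepsilon>0$ there is a unitary $u\in\widetilde{B^\beta}$ with $\|\phi(a)-u^*\psi(a)u\|<\varepsilon$ for all $a\in F$. For trivial $G$ this is ordinary approximate unitary equivalence, with unitaries in $\widetilde B$, written $\sim_{\mathrm{au}}$. Categories: $\mathbf B_G$ has as objects the pairs $(A,\alpha)$ with $A$ in $\mathbf B$ and $\alpha\colon G\to\mathrm{Aut}(A)$ an action; its morphisms are all equivariant *-homomorphisms. $\mathbf{RB}_G$ is the full subcategory of $\mathbf B_G$ of those $(A,\alpha)$ for which $\alpha$ has the Rokhlin property. $\mathbf C_G$ has as objects pairs $(C,\gamma)$ with $C$ an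 object of $\mathbf C$ and $\gamma\colon G\to\mathrm{Aut}(C)$ a group homomorphism; morphisms are the equivariant morphisms of $\mathbf C$. $\mathrm F_G(A,\alpha)=(\mathrm F(A),\mathrm F(\alpha))$ where $\mathrm F(\alpha)_g=\mathrm F(\alpha_g)$, and $\mathrm F_G(\phi)=\mathrm F(\phi)$. Classifying homomorphisms: a functor $\mathrm E$ from $\mathbf B_G$ (or a full subcategory of it) to a category $\mathbf D$ classifies homomorphisms if (a) for all objects $(A,\alpha),(B,\beta)$ and every morphism $\lambda\colon\mathrm E(A,\alpha)\to\mathrm E(B,\beta)$ in $\mathbf D$ there is a morphism $\phi\colon(A,\alpha)\to(B,\beta)$ with $\mathrm E(\phi)=\lambda$; and (b) for all morphisms $\phi,\psi\colon(A,\alpha)\to(B,\beta)$, $\mathrm E(\phi)=\mathrm E(\psi)$ if and only if $\phi\sim_{G\text{-}\mathrm{au}}\psi$. For a functor on $\mathbf B$ this is understood with $G$ trivial. *)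

theory Defs
  imports
    "HOL-Library.FuncSet"
    "HOL-Algebra.Algebraic_Closure_Type"
    "HOL-Algebra.Module"
    "HOL-Analysis.Abstract_Metric_Spaces"
begin

section \<open>C*-algebras\<close>

abbreviation complex_ring :: "complex ring" where
  "complex_ring \<equiv> ring_of_type_algebra"

text \<open>C*-algebras live on a carrier set, so that one type can host many of them. The record
  inherits a field \<open>one\<close> from the ring records; it is unconstrained for a general (not
  necessarily unital) C*-algebra and is used only for unitizations.\<close>

record 'a cstar = "(complex, 'a) module" +
  adj :: "'a \<Rightarrow> 'a"
  cnorm :: "'a \<Rightarrow> real"

text \<open>The value outside the carrier is a dummy: \<^locale>\<open>Metric_space\<close> asks for
  nonnegativity and symmetry on the whole type.\<close>

definition cdist :: "('a, 'z) cstar_scheme \<Rightarrow> 'a \<Rightarrow> 'a \<Rightarrow> real" where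
  "cdist A x y =
     (if x \<in> carrier A \<and> y \<in> carrier A then cnorm A (x \<ominus>\<^bsub>A\<^esub> y) else 0)"

locale cstar_algebra = module complex_ring A for A :: "('a, 'z) cstar_scheme" (structure) +
  assumes mult_closed: "\<lbrakk>x \<in> carrier A; y \<in> carrier A\<rbrakk> \<Longrightarrow> x \<otimes> y \<in> carrier A"
    and mult_assoc: "\<lbrakk>x \<in> carrier A; y \<in> carrier A; z \<in> carrier A\<rbrakk>
          \<Longrightarrow> (x \<otimes> y) \<otimes> z = x \<otimes> (y \<otimes> z)"
    and mult_l_distr: "\<lbrakk>x \<in> carrier A; y \<in> carrier A; z \<in> carrier A\<rbrakk>
          \<Longrightarrow> (x \<oplus> y) \<otimes> z = x \<otimes> z \<oplus> y \<otimes> z"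
    and mult_r_distr: "\<lbrakk>x \<in> carrier A; y \<in> carrier A; z \<in> carrier A\<rbrakk>
          \<Longrightarrow> z \<otimes> (x \<oplus> y) = z \<otimes> x \<oplus> z \<otimes> y"
    and smult_mult_left: "\<lbrakk>x \<in> carrier A; y \<in> carrier A\<rbrakk>
          \<Longrightarrow> (c \<odot> x) \<otimes> y = c \<odot> (x \<otimes> y)"
    and smult_mult_right: "\<lbrakk>x \<in> carrier A; y \<in> carrier A\<rbrakk>
          \<Longrightarrow> x \<otimes> (c \<odot> y) = c \<odot> (x \<otimes> y)"
    and adj_closed: "x \<in> carrier A \<Longrightarrow> adj A x \<in> carrier A"
    and adj_adj: "x \<in> carrier A \<Longrightarrow> adj A (adj A x) = x"
    and adj_add: "\<lbrakk>x \<in> carrier A; y \<in> carrier A\<rbrakk>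
          \<Longrightarrow> adj A (x \<oplus> y) = adj A x \<oplus> adj A y"
    and adj_smult: "x \<in> carrier A \<Longrightarrow> adj A (c \<odot> x) = cnj c \<odot> adj A x"
    and adj_mult: "\<lbrakk>x \<in> carrier A; y \<in> carrier A\<rbrakk>
          \<Longrightarrow> adj A (x \<otimes> y) = adj A y \<otimes> adj A x"
    and cnorm_eq_zero: "x \<in> carrier A \<Longrightarrow> cnorm A x = 0 \<longleftrightarrow> x = \<zero>"
    and cnorm_triangle: "\<lbrakk>x \<in> carrier A; y \<in> carrier A\<rbrakk>
          \<Longrightarrow> cnorm A (x \<oplus> y) \<le> cnorm A x + cnorm A y"
    and cnorm_smult: "x \<in> carrier A \<Longrightarrow> cnorm A (c \<odot> x) = cmod c * cnorm A x"
    and cnorm_mult: "\<lbrakk>x \<in> carrier A; y \<in> carrier A\<rbrakk>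
          \<Longrightarrow> cnorm A (x \<otimes> y) \<le> cnorm A x * cnorm A y"
    and cstar_identity: "x \<in> carrier A \<Longrightarrow> cnorm A (adj A x \<otimes> x) = (cnorm A x)\<^sup>2"
    and complete: "Metric_space.mcomplete (carrier A) (cdist A)"

definition separable_cstar :: "('a, 'z) cstar_scheme \<Rightarrow> bool" where
  "separable_cstar A \<longleftrightarrow>
     cstar_algebra A \<and> separable_space (Metric_space.mtopology (carrier A) (cdist A))"

text \<open>Homomorphisms are extensional functions, so that equality of functions is equality of maps
  on the carrier.\<close>

definition star_hom :: "('a, 'y) cstar_scheme \<Rightarrow> ('b, 'z) cstar_scheme \<Rightarrow> ('a \<Rightarrow> 'b) set" where
  "star_hom A B = {\<phi> \<in> carrier A \<rightarrow>\<^sub>E carrier B.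
     (\<forall>x\<in>carrier A. \<forall>y\<in>carrier A. \<phi> (x \<oplus>\<^bsub>A\<^esub> y) = \<phi> x \<oplus>\<^bsub>B\<^esub> \<phi> y) \<and>
     (\<forall>c. \<forall>x\<in>carrier A. \<phi> (c \<odot>\<^bsub>A\<^esub> x) = c \<odot>\<^bsub>B\<^esub> \<phi> x) \<and>
     (\<forall>x\<in>carrier A. \<forall>y\<in>carrier A. \<phi> (x \<otimes>\<^bsub>A\<^esub> y) = \<phi> x \<otimes>\<^bsub>B\<^esub> \<phi> y) \<and>
     (\<forall>x\<in>carrier A. \<phi> (adj A x) = adj B (\<phi> x))}"

definition positive :: "('a, 'z) cstar_scheme \<Rightarrow> 'a \<Rightarrow> bool" where
  "positive A x \<longleftrightarrow> (\<exists>y\<in>carrier A. x = adj A y \<otimes>\<^bsub>A\<^esub> y)"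

text \<open>The pair \<open>(c, x)\<close> stands for \<open>c1 + x\<close>. The norm is the C*-norm: the supremum is the norm of
  \<open>c1 + x\<close> as a left multiplication operator on \<open>A\<close>. For nonunital \<open>A\<close> it dominates
  \<open>cmod c\<close>, so the maximum is the operator norm. For unital \<open>A\<close> with unit \<open>e\<close> it is the norm of
  \<open>c e + x\<close>, and the maximum is the norm transported along the isomorphism
  \<open>(c, x) \<mapsto> (c, c e + x)\<close> onto the direct sum of the complex numbers and \<open>A\<close>.\<close>

definition unitization :: "('a, 'z) cstar_scheme \<Rightarrow> (complex \<times> 'a) cstar" where
  "unitization A =
    \<lparr>carrier = UNIV \<times> carrier A,
     monoid.mult = (\<lambda>(c, x) (d, y). (c * d, c \<odot>\<^bsub>A\<^esub> y \<oplus>\<^bsub>A\<^esub> d \<odot>\<^bsub>A\<^esub> x \<oplus>\<^bsub>A\<^esub> x \<otimes>\<^bsub>A\<^esub> y)),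
     one = (1, \<zero>\<^bsub>A\<^esub>),
     zero = (0, \<zero>\<^bsub>A\<^esub>),
     add = (\<lambda>(c, x) (d, y). (c + d, x \<oplus>\<^bsub>A\<^esub> y)),
     module.smult = (\<lambda>c (d, y). (c * d, c \<odot>\<^bsub>A\<^esub> y)),
     adj = (\<lambda>(c, x). (cnj c, adj A x)),
     cnorm = (\<lambda>(c, x). max (cmod c)
       (SUP b\<in>{b \<in> carrier A. cnorm A b \<le> 1}. cnorm A (c \<odot>\<^bsub>A\<^esub> b \<oplus>\<^bsub>A\<^esub> x \<otimes>\<^bsub>A\<^esub> b)))\<rparr>"

definition unitization_emb :: "'a \<Rightarrow> complex \<times> 'a" where
  "unitization_emb x = (0, x)"

definition unitaries :: "('a, 'z) cstar_scheme \<Rightarrow> 'a set" where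
  "unitaries U = {u \<in> carrier U. adj U u \<otimes>\<^bsub>U\<^esub> u = \<one>\<^bsub>U\<^esub> \<and> u \<otimes>\<^bsub>U\<^esub> adj U u = \<one>\<^bsub>U\<^esub>}"

section \<open>Categories\<close>

text \<open>Hom-sets need not be disjoint; \<open>Comp C x y z g f\<close> is \<open>f : x \<rightarrow> y\<close> followed by
  \<open>g : y \<rightarrow> z\<close>.\<close>

record ('o, 'm) cat =
  Obj :: "'o set"
  Hom :: "'o \<Rightarrow> 'o \<Rightarrow> 'm set"
  Comp :: "'o \<Rightarrow> 'o \<Rightarrow> 'o \<Rightarrow> 'm \<Rightarrow> 'm \<Rightarrow> 'm"
  Id :: "'o \<Rightarrow> 'm"

locale category =
  fixes C :: "('o, 'm) cat"
  assumes Id_in_Hom: "x \<in> Obj C \<Longrightarrow> Id C x \<in> Hom C x x"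
    and Comp_in_Hom: "\<lbrakk>x \<in> Obj C; y \<in> Obj C; z \<in> Obj C; f \<in> Hom C x y; g \<in> Hom C y z\<rbrakk>
          \<Longrightarrow> Comp C x y z g f \<in> Hom C x z"
    and Id_left: "\<lbrakk>x \<in> Obj C; y \<in> Obj C; f \<in> Hom C x y\<rbrakk> \<Longrightarrow> Comp C x y y (Id C y) f = f"
    and Id_right: "\<lbrakk>x \<in> Obj C; y \<in> Obj C; f \<in> Hom C x y\<rbrakk> \<Longrightarrow> Comp C x x y f (Id C x) = f"
    and Comp_assoc: "\<lbrakk>w \<in> Obj C; x \<in> Obj C; y \<in> Obj C; z \<in> Obj C;
            f \<in> Hom C w x; g \<in> Hom C x y; h \<in> Hom C y z\<rbrakk>
          \<Longrightarrow> Comp C w y z h (Comp C w x y g f) = Comp C w x z (Comp C x y z h g) f"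

definition full_subcategory :: "('o, 'm) cat \<Rightarrow> 'o set \<Rightarrow> ('o, 'm) cat" where
  "full_subcategory C S = C\<lparr>Obj := S\<rparr>"

record ('o, 'm, 'p, 'n) funct =
  fobj :: "'o \<Rightarrow> 'p"
  fmor :: "'o \<Rightarrow> 'o \<Rightarrow> 'm \<Rightarrow> 'n"

locale is_functor = S: category C + T: category D
  for C :: "('o, 'm) cat" and D :: "('p, 'n) cat" +
  fixes F :: "('o, 'm, 'p, 'n) funct"
  assumes fobj_in_Obj: "x \<in> Obj C \<Longrightarrow> fobj F x \<in> Obj D"
    and fmor_in_Hom: "\<lbrakk>x \<in> Obj C; y \<in> Obj C; f \<in> Hom C x y\<rbrakk>
          \<Longrightarrow> fmor F x y f \<in> Hom D (fobj F x) (fobj F y)"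
    and fmor_Id: "x \<in> Obj C \<Longrightarrow> fmor F x x (Id C x) = Id D (fobj F x)"
    and fmor_Comp: "\<lbrakk>x \<in> Obj C; y \<in> Obj C; z \<in> Obj C; f \<in> Hom C x y; g \<in> Hom C y z\<rbrakk>
          \<Longrightarrow> fmor F x z (Comp C x y z g f) =
              Comp D (fobj F x) (fobj F y) (fobj F z) (fmor F y z g) (fmor F x y f)"

definition Aut_group :: "('o, 'm) cat \<Rightarrow> 'o \<Rightarrow> 'm monoid" where
  "Aut_group C x =
    \<lparr>carrier = {f \<in> Hom C x x. \<exists>k\<in>Hom C x x. Comp C x x x k f = Id C x \<and> Comp C x x x f k = Id C x},
     monoid.mult = Comp C x x x,
     one = Id C x\<rparr>"

text \<open>The category written \<open>C\<^sub>G\<close>. Applied to a category of C*-algebras and *-homomorphisms its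
  objects are the \<open>G\<close>-algebras, since the invertible *-homomorphisms from an algebra to itself are
  its *-automorphisms. As for morphisms, actions are taken to be extensional on \<open>carrier G\<close>.\<close>

definition equivariant_category ::
    "('g, 'z) monoid_scheme \<Rightarrow> ('o, 'm) cat \<Rightarrow> ('o \<times> ('g \<Rightarrow> 'm), 'm) cat" where
  "equivariant_category G C =
    \<lparr>Obj = {(x, \<alpha>). x \<in> Obj C \<and> \<alpha> \<in> hom G (Aut_group C x) \<inter> extensional (carrier G)},
     Hom = (\<lambda>(x, \<alpha>) (y, \<beta>). {f \<in> Hom C x y.
        \<forall>g\<in>carrier G. Comp C x x y f (\<alpha> g) = Comp C x y y (\<beta> g) f}),
     Comp = (\<lambda>(x, \<alpha>) (y, \<beta>) (z, \<gamma>). Comp C x y z),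
     Id = (\<lambda>(x, \<alpha>). Id C x)\<rparr>"

definition equivariant_functor ::
    "('g, 'z) monoid_scheme \<Rightarrow> ('o, 'm, 'p, 'n) funct
      \<Rightarrow> ('o \<times> ('g \<Rightarrow> 'm), 'm, 'p \<times> ('g \<Rightarrow> 'n), 'n) funct" where
  "equivariant_functor G F =
    \<lparr>fobj = (\<lambda>(x, \<alpha>). (fobj F x, \<lambda>g\<in>carrier G. fmor F x x (\<alpha> g))),
     fmor = (\<lambda>(x, \<alpha>) (y, \<beta>). fmor F x y)\<rparr>"

definition separable_cstar_category :: "('a cstar, 'a \<Rightarrow> 'a) cat" where
  "separable_cstar_category =
    \<lparr>Obj = {A. separable_cstar A},
     Hom = star_hom,
     Comp = (\<lambda>A B C g f. compose (carrier A) g f),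
     Id = (\<lambda>A. \<lambda>x\<in>carrier A. x)\<rparr>"

section \<open>Actions of finite groups\<close>

definition fixed_point_algebra ::
    "('g, 'y) monoid_scheme \<Rightarrow> ('a, 'z) cstar_scheme \<Rightarrow> ('g \<Rightarrow> 'a \<Rightarrow> 'a) \<Rightarrow> ('a, 'z) cstar_scheme" where
  "fixed_point_algebra G A \<alpha> =
     A\<lparr>carrier := {a \<in> carrier A. \<forall>g\<in>carrier G. \<alpha> g a = a}\<rparr>"

definition rokhlin_property ::
    "('g, 'y) monoid_scheme \<Rightarrow> ('a, 'z) cstar_scheme \<Rightarrow> ('g \<Rightarrow> 'a \<Rightarrow> 'a) \<Rightarrow> bool" where
  "rokhlin_property G A \<alpha> \<longleftrightarrow>
    (\<forall>\<epsilon>>0. \<forall>F. finite F \<and> F \<subseteq> carrier A \<longrightarrow>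
      (\<exists>r. (\<forall>g\<in>carrier G. r g \<in> carrier A \<and> positive A (r g) \<and> cnorm A (r g) \<le> 1) \<and>
           (\<forall>g\<in>carrier G. \<forall>h\<in>carrier G. g \<noteq> h \<longrightarrow> r g \<otimes>\<^bsub>A\<^esub> r h = \<zero>\<^bsub>A\<^esub>) \<and>
           (\<forall>g\<in>carrier G. \<forall>h\<in>carrier G. cnorm A (\<alpha> g (r h) \<ominus>\<^bsub>A\<^esub> r (g \<otimes>\<^bsub>G\<^esub> h)) < \<epsilon>) \<and>
           (\<forall>a\<in>F. \<forall>g\<in>carrier G. cnorm A (r g \<otimes>\<^bsub>A\<^esub> a \<ominus>\<^bsub>A\<^esub> a \<otimes>\<^bsub>A\<^esub> r g) < \<epsilon>) \<and>
           (\<forall>a\<in>F. cnorm A ((\<Oplus>\<^bsub>A\<^esub>g\<in>carrier G. r g) \<otimes>\<^bsub>A\<^esub> a \<ominus>\<^bsub>A\<^esub> a) < \<epsilon>)))"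

text \<open>Approximate unitary equivalence of maps \<open>A \<rightarrow> B\<close> by unitaries from the unitization of a
  subalgebra \<open>D\<close> of \<open>B\<close>. The unitization of \<open>D\<close> is a subset of that of \<open>B\<close>, in which the
  conjugation and the norm are computed.\<close>

definition approx_equiv_by ::
    "'b cstar \<Rightarrow> 'a cstar \<Rightarrow> 'b cstar \<Rightarrow> ('a \<Rightarrow> 'b) \<Rightarrow> ('a \<Rightarrow> 'b) \<Rightarrow> bool" where
  "approx_equiv_by D A B \<phi> \<psi> \<longleftrightarrow>
    (\<forall>F. \<forall>\<epsilon>>0. finite F \<and> F \<subseteq> carrier A \<longrightarrow>
      (\<exists>u\<in>unitaries (unitization D). \<forall>a\<in>F.
        cnorm (unitization B)
          (unitization_emb (\<phi> a) \<ominus>\<^bsub>unitization B\<^esub>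
            adj (unitization B) u \<otimes>\<^bsub>unitization B\<^esub> unitization_emb (\<psi> a) \<otimes>\<^bsub>unitization B\<^esub> u) < \<epsilon>))"

definition approx_unitary_equiv ::
    "'a cstar \<Rightarrow> 'a cstar \<Rightarrow> ('a \<Rightarrow> 'a) \<Rightarrow> ('a \<Rightarrow> 'a) \<Rightarrow> bool" where
  "approx_unitary_equiv A B = approx_equiv_by B A B"

definition G_approx_unitary_equiv ::
    "('g, 'z) monoid_scheme \<Rightarrow> 'a cstar \<times> ('g \<Rightarrow> 'a \<Rightarrow> 'a) \<Rightarrow> 'a cstar \<times> ('g \<Rightarrow> 'a \<Rightarrow> 'a)
      \<Rightarrow> ('a \<Rightarrow> 'a) \<Rightarrow> ('a \<Rightarrow> 'a) \<Rightarrow> bool" where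
  "G_approx_unitary_equiv G = (\<lambda>(A, \<alpha>) (B, \<beta>). approx_equiv_by (fixed_point_algebra G B \<beta>) A B)"

definition rokhlin_category ::
    "('g, 'z) monoid_scheme \<Rightarrow> ('a cstar, 'a \<Rightarrow> 'a) cat
      \<Rightarrow> ('a cstar \<times> ('g \<Rightarrow> 'a \<Rightarrow> 'a), 'a \<Rightarrow> 'a) cat" where
  "rokhlin_category G \<B> = full_subcategory (equivariant_category G \<B>)
     {(A, \<alpha>) \<in> Obj (equivariant_category G \<B>). rokhlin_property G A \<alpha>}"

text \<open>The relation \<open>R\<close> is the version of approximate unitary equivalence that belongs to the
  category \<open>C\<close> of (equivariant) algebras.\<close>

definition classifies_homs ::
    "('o, 'm) cat \<Rightarrow> ('p, 'n) cat \<Rightarrow> ('o, 'm, 'p, 'n) funct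
      \<Rightarrow> ('o \<Rightarrow> 'o \<Rightarrow> 'm \<Rightarrow> 'm \<Rightarrow> bool) \<Rightarrow> bool" where
  "classifies_homs C D E R \<longleftrightarrow> is_functor C D E \<and>
    (\<forall>x\<in>Obj C. \<forall>y\<in>Obj C. \<forall>l\<in>Hom D (fobj E x) (fobj E y). \<exists>\<phi>\<in>Hom C x y. fmor E x y \<phi> = l) \<and>
    (\<forall>x\<in>Obj C. \<forall>y\<in>Obj C. \<forall>\<phi>\<in>Hom C x y. \<forall>\<psi>\<in>Hom C x y.
       fmor E x y \<phi> = fmor E x y \<psi> \<longleftrightarrow> R x y \<phi> \<psi>)"

end

theory Submission
  imports Defs
begin

text \<open>The Rokhlin property says that the action on \<open>B\<close> looks, in the limit, like translation on the functions
  from \<open>G\<close> to \<open>B\<close>. Precisely, if the \<open>r\<^sub>g\<close> are Rokhlin elements of increasing quality, the averaging map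
  \<open>P(x) = \<Sum>\<^sub>g r\<^sub>g x\<^sub>g\<close>, which takes a family \<open>x : G \<rightarrow> B\<close> to an element of \<open>B\<close>, is asymptotically an equivariant
  *-homomorphism and is asymptotically the identity on constant families (the locale
  \<open>rokhlin_averaging\<close>, established in \<open>averaging\<close>). A construction in \<open>B\<close> that is possible separately for
  each group element is therefore asymptotically possible equivariantly: apply it entrywise, then
  apply \<open>P\<close>. Two consequences carry the theorem.

  Uniqueness (\<open>equivariant_uniqueness\<close>): let \<open>\<phi>\<close> and \<open>\<psi>\<close> be equivariant and let a unitary \<open>u\<close> conjugate \<open>\<psi>\<close>
  close to \<open>\<phi>\<close>. All translates \<open>\<beta>\<^sub>g(u)\<close> do so as well, and the family of translates is invariant. Its image
  under \<open>P\<close> is asymptotically unitary and asymptotically fixed; an average over the group and a polar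
  decomposition inside the fixed point algebra make it exact.

  Existence (\<open>equivariant_lift\<close>): lift an equivariant \<open>\<gamma>\<close> to a homomorphism \<open>\<phi>\<close>, which need not be equivariant.
  Its twists \<open>\<beta>\<^sub>g \<circ> \<phi> \<circ> \<alpha>\<^sub>g\<^sup>-\<^sup>1\<close> have the same invariant \<open>\<gamma>\<close> and so are approximate unitary conjugates of \<open>\<phi>\<close>. Patching
  the conjugating unitaries by \<open>P\<close> gives one unitary that conjugates \<open>\<phi>\<close> close to \<open>P\<close> applied to the
  family of twists, which depends equivariantly on its argument. The conjugate of \<open>\<phi>\<close> is almost equivariant and is displaced
  only as far as \<open>\<phi>\<close> fails to be equivariant (\<open>almost_equivariant_conjugate\<close>). Iteration along a dense sequence of
  the separable domain converges to an equivariant homomorphism (\<open>equivariant_limit\<close>) that is approximately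
  unitarily equivalent to \<open>\<phi>\<close> and hence still lifts \<open>\<gamma>\<close>.

  The classification statement needs in addition that equivariant approximate unitary equivalence implies
  the ordinary one, which holds because invariant unitaries are in particular unitaries.

  Two devices keep the analysis elementary. Unitaries of the unitization are written \<open>1 + b\<close> with \<open>b\<close> in the
  algebra itself, and products of such elements are computed by the circle operation \<open>x + y + xy\<close>. And square
  roots and inverses are fixed points of contractions; the square root of \<open>1 - h\<^sup>2\<close> also shows that
  *-homomorphisms are bounded (\<open>hom_bounded\<close>), without spectral theory.\<close>

section \<open>Algebra and norm\<close>

context cstar_algebra begin

lemma complex_ring_simps [simp]:
  "carrier complex_ring = UNIV" "\<one>\<^bsub>complex_ring\<^esub> = 1" "\<zero>\<^bsub>complex_ring\<^esub> = 0"
  "c \<oplus>\<^bsub>complex_ring\<^esub> d = c + d" "c \<otimes>\<^bsub>complex_ring\<^esub> d = c * d"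
  by (simp_all add: ring_of_type_algebra_def)

declare mult_closed [simp, intro] adj_closed [simp, intro] adj_adj [simp]

lemma scale_closed [simp, intro]: "x \<in> carrier A \<Longrightarrow> c \<odot> x \<in> carrier A"
  by (simp add: smult_closed)

lemma scale_one [simp]: "x \<in> carrier A \<Longrightarrow> 1 \<odot> x = x"
  using smult_one by simp

lemma scale_scale: "x \<in> carrier A \<Longrightarrow> c \<odot> (d \<odot> x) = (c * d) \<odot> x"
  using smult_assoc1[of c d x] by simp

lemma scale_add_left: "x \<in> carrier A \<Longrightarrow> (c + d) \<odot> x = c \<odot> x \<oplus> d \<odot> x"
  using smult_l_distr[of c d x] by simp

lemma scale_add_right: "x \<in> carrier A \<Longrightarrow> y \<in> carrier A \<Longrightarrow> c \<odot> (x \<oplus> y) = c \<odot> x \<oplus> c \<odot> y"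
  using smult_r_distr[of c x y] by simp

lemma scale_zero_left [simp]: "x \<in> carrier A \<Longrightarrow> 0 \<odot> x = \<zero>"
  using smult_l_null[of x] by simp

lemma scale_zero_right [simp]: "c \<odot> \<zero> = \<zero>"
  using smult_r_null[of c] by simp

lemma scale_minus_right: "x \<in> carrier A \<Longrightarrow> c \<odot> (\<ominus> x) = \<ominus> (c \<odot> x)"
  using smult_r_minus[of c x] by simp

lemma minus_eq_scale: "x \<in> carrier A \<Longrightarrow> \<ominus> x = (-1) \<odot> x"
proof -
  assume x: "x \<in> carrier A"
  have "(-1) \<odot> x \<oplus> x = (-1 + 1) \<odot> x"
    using x scale_add_left[of x "-1" 1] by simp
  then have "(-1) \<odot> x \<oplus> x = \<zero>" using x by simp
  then show ?thesis using x M.minus_equality by simp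
qed

lemma mult_zero_left [simp]: "x \<in> carrier A \<Longrightarrow> \<zero> \<otimes> x = \<zero>"
  using smult_mult_left[of \<zero> x 0] by simp

lemma mult_zero_right [simp]: "x \<in> carrier A \<Longrightarrow> x \<otimes> \<zero> = \<zero>"
  using smult_mult_right[of x \<zero> 0] by simp

lemma mult_minus_left: "x \<in> carrier A \<Longrightarrow> y \<in> carrier A \<Longrightarrow> (\<ominus> x) \<otimes> y = \<ominus> (x \<otimes> y)"
  by (simp add: minus_eq_scale smult_mult_left)

lemma mult_minus_right: "x \<in> carrier A \<Longrightarrow> y \<in> carrier A \<Longrightarrow> x \<otimes> (\<ominus> y) = \<ominus> (x \<otimes> y)"
  by (simp add: minus_eq_scale smult_mult_right)

lemma adj_zero [simp]: "adj A \<zero> = \<zero>"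
  using adj_smult[of \<zero> 0] by simp

lemma adj_minus: "x \<in> carrier A \<Longrightarrow> adj A (\<ominus> x) = \<ominus> (adj A x)"
  by (simp add: minus_eq_scale adj_smult)

lemma minus_zero_eq: "\<ominus> \<zero> = \<zero>"
  by (simp add: minus_eq_scale)

text \<open>Registering these rules makes the proof method \<open>algebra\<close> prove identities between noncommutative
  *-polynomials in an algebra without unit.\<close>

lemmas star_simprules
  [algebra ring "zero A" "add A" "a_inv A" "a_minus A" "monoid.mult A"] =
  M.a_closed M.zero_closed M.a_inv_closed M.minus_closed mult_closed scale_closed adj_closed
  M.a_assoc M.l_zero M.l_neg M.a_comm mult_assoc mult_l_distr M.minus_eq
  M.r_zero M.r_neg M.r_neg2 M.r_neg1 M.minus_add M.minus_minus minus_zero_eq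
  M.a_lcomm mult_r_distr mult_zero_left mult_zero_right mult_minus_left mult_minus_right
  adj_add adj_mult adj_minus adj_adj adj_zero


lemma cnorm_zero [simp]: "cnorm A \<zero> = 0"
  using cnorm_eq_zero by simp

lemma cnorm_minus [simp]: "x \<in> carrier A \<Longrightarrow> cnorm A (\<ominus> x) = cnorm A x"
  by (simp add: minus_eq_scale cnorm_smult)

lemma cnorm_nonneg [simp]: "x \<in> carrier A \<Longrightarrow> 0 \<le> cnorm A x"
  using cnorm_triangle[of x "\<ominus> x"] by (simp add: M.r_neg)

lemma cnorm_diff_triangle:
  "x \<in> carrier A \<Longrightarrow> y \<in> carrier A \<Longrightarrow> cnorm A (x \<ominus> y) \<le> cnorm A x + cnorm A y"
  using cnorm_triangle[of x "\<ominus> y"] by (simp add: M.minus_eq)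

lemma cnorm_diff_commute:
  assumes "x \<in> carrier A" "y \<in> carrier A" shows "cnorm A (x \<ominus> y) = cnorm A (y \<ominus> x)"
proof -
  have "x \<ominus> y = \<ominus> (y \<ominus> x)" using assms by algebra
  then show ?thesis using assms by simp
qed

lemma cnorm_diff_trans:
  assumes "x \<in> carrier A" "y \<in> carrier A" "z \<in> carrier A"
  shows "cnorm A (x \<ominus> z) \<le> cnorm A (x \<ominus> y) + cnorm A (y \<ominus> z)"
proof -
  have "x \<ominus> z = (x \<ominus> y) \<oplus> (y \<ominus> z)" using assms by algebra
  then show ?thesis using assms cnorm_triangle[of "x \<ominus> y" "y \<ominus> z"] by simp
qed

lemma cnorm_le_diff:
  assumes "x \<in> carrier A" "y \<in> carrier A"
  shows "cnorm A x \<le> cnorm A y + cnorm A (x \<ominus> y)"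
proof -
  have "x = y \<oplus> (x \<ominus> y)" using assms by algebra
  then show ?thesis using assms cnorm_triangle[of y "x \<ominus> y"] by simp
qed

lemma diff_eq_zero_iff:
  assumes "x \<in> carrier A" "y \<in> carrier A" shows "x \<ominus> y = \<zero> \<longleftrightarrow> x = y"
proof
  assume "x \<ominus> y = \<zero>"
  moreover have "x = (x \<ominus> y) \<oplus> y" using assms by algebra
  ultimately show "x = y" using assms by simp
qed (use assms in algebra)

lemma diff_self [simp]: "x \<in> carrier A \<Longrightarrow> x \<ominus> x = \<zero>"
  by algebra

lemma add_diff_cancel:
  "x \<in> carrier A \<Longrightarrow> y \<in> carrier A \<Longrightarrow> (x \<oplus> y) \<ominus> y = x"
  by algebra

lemma cnorm_diff_eq_zero:
  assumes "x \<in> carrier A" "y \<in> carrier A" shows "cnorm A (x \<ominus> y) = 0 \<longleftrightarrow> x = y"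
  using assms by (simp add: cnorm_eq_zero diff_eq_zero_iff)

text \<open>The C*-identity and submultiplicativity give \<open>\<parallel>y\<parallel>\<^sup>2 \<le> \<parallel>y\<^sup>*\<parallel> \<parallel>y\<parallel>\<close>; applied to \<open>x\<close> and to \<open>x\<^sup>*\<close>.\<close>

lemma cnorm_adj [simp]:
  assumes "x \<in> carrier A" shows "cnorm A (adj A x) = cnorm A x"
proof -
  have le: "cnorm A y \<le> cnorm A (adj A y)" if y: "y \<in> carrier A" for y
  proof (cases "cnorm A y = 0")
    case False
    have "(cnorm A y)\<^sup>2 \<le> cnorm A (adj A y) * cnorm A y"
      using cstar_identity[OF y] cnorm_mult[of "adj A y" y] y by simp
    then show ?thesis
      using False cnorm_nonneg[OF y] by (simp add: power2_eq_square)
  qed (use y in simp)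
  show ?thesis using le[of x] le[of "adj A x"] assms by simp
qed

lemma cnorm_mult_le:
  assumes "x \<in> carrier A" "y \<in> carrier A" "cnorm A x \<le> a" "cnorm A y \<le> b"
  shows "cnorm A (x \<otimes> y) \<le> a * b"
proof -
  have "0 \<le> a" using cnorm_nonneg[OF assms(1)] assms(3) by linarith
  then have "cnorm A x * cnorm A y \<le> a * b"
    using assms by (intro mult_mono) auto
  then show ?thesis using cnorm_mult[OF assms(1,2)] by linarith
qed

lemma metric: "Metric_space (carrier A) (cdist A)"
proof
  fix x y z
  show "0 \<le> cdist A x y" "cdist A x y = cdist A y x"
    by (auto simp: cdist_def cnorm_diff_commute)
  show "(cdist A x y = 0) = (x = y)" if "x \<in> carrier A" "y \<in> carrier A"
    using that by (simp add: cdist_def cnorm_diff_eq_zero)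
  show "cdist A x z \<le> cdist A x y + cdist A y z"
    if "x \<in> carrier A" "y \<in> carrier A" "z \<in> carrier A"
    using that by (simp add: cdist_def cnorm_diff_trans)
qed

end

section \<open>Asymptotic equality\<close>

text \<open>Equality in the algebra of bounded families modulo null families. No quotient is formed: the
  relation is a congruence, and that is all the calculations need. A limit is asymptotic equality
  with a constant family.\<close>

definition asymp_eq :: "('a, 'z) cstar_scheme \<Rightarrow> 'i filter \<Rightarrow> ('i \<Rightarrow> 'a) \<Rightarrow> ('i \<Rightarrow> 'a) \<Rightarrow> bool" where
  "asymp_eq A \<F> S T \<longleftrightarrow> (\<forall>i. S i \<in> carrier A) \<and> (\<forall>i. T i \<in> carrier A) \<and>
     ((\<lambda>i. cnorm A (S i \<ominus>\<^bsub>A\<^esub> T i)) \<longlongrightarrow> 0) \<F>"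

context cstar_algebra begin

lemma asymp_eqD:
  assumes "asymp_eq A \<F> S T"
  shows "S i \<in> carrier A" "T i \<in> carrier A" "((\<lambda>i. cnorm A (S i \<ominus> T i)) \<longlongrightarrow> 0) \<F>"
  using assms by (auto simp: asymp_eq_def)

lemma asymp_eq_by_bound:
  assumes "\<And>i. S i \<in> carrier A" "\<And>i. T i \<in> carrier A"
    and "\<And>i. cnorm A (S i \<ominus> T i) \<le> f i" and "(f \<longlongrightarrow> 0) \<F>"
  shows "asymp_eq A \<F> S T"
  unfolding asymp_eq_def using assms
  by (auto intro!: Lim_null_comparison[OF _ assms(4)] always_eventually)

lemma asymp_eq_refl: "(\<And>i. S i \<in> carrier A) \<Longrightarrow> asymp_eq A \<F> S S"
  by (rule asymp_eq_by_bound[where f = "\<lambda>_. 0"]) simp_all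

lemma asymp_eq_sym: "asymp_eq A \<F> S T \<Longrightarrow> asymp_eq A \<F> T S"
  by (simp add: asymp_eq_def cnorm_diff_commute)

lemma asymp_eq_trans [trans]:
  assumes "asymp_eq A \<F> S T" "asymp_eq A \<F> T U" shows "asymp_eq A \<F> S U"
  using tendsto_add[OF asymp_eqD(3)[OF assms(1)] asymp_eqD(3)[OF assms(2)]]
  by (intro asymp_eq_by_bound[OF _ _ cnorm_diff_trans[where y = "T _"]])
    (auto simp: asymp_eqD[OF assms(1)] asymp_eqD[OF assms(2)])

lemma asymp_eq_add:
  assumes "asymp_eq A \<F> S S'" "asymp_eq A \<F> T T'"
  shows "asymp_eq A \<F> (\<lambda>i. S i \<oplus> T i) (\<lambda>i. S' i \<oplus> T' i)"
proof (rule asymp_eq_by_bound)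
  note [simp] = asymp_eqD(1,2)[OF assms(1)] asymp_eqD(1,2)[OF assms(2)]
  fix i
  have "(S i \<oplus> T i) \<ominus> (S' i \<oplus> T' i) = (S i \<ominus> S' i) \<oplus> (T i \<ominus> T' i)"
    using asymp_eqD(1,2)[OF assms(1), of i] asymp_eqD(1,2)[OF assms(2), of i] by algebra
  then show "cnorm A ((S i \<oplus> T i) \<ominus> (S' i \<oplus> T' i)) \<le> cnorm A (S i \<ominus> S' i) + cnorm A (T i \<ominus> T' i)"
    by (simp add: cnorm_triangle)
  show "((\<lambda>i. cnorm A (S i \<ominus> S' i) + cnorm A (T i \<ominus> T' i)) \<longlongrightarrow> 0) \<F>"
    using tendsto_add[OF asymp_eqD(3)[OF assms(1)] asymp_eqD(3)[OF assms(2)]] by simp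
qed (simp_all add: asymp_eqD(1,2)[OF assms(1)] asymp_eqD(1,2)[OF assms(2)])

lemma asymp_eq_mult:
  assumes "asymp_eq A \<F> S S'" "asymp_eq A \<F> T T'"
    and "\<And>i. cnorm A (S i) \<le> K" "\<And>i. cnorm A (T' i) \<le> L"
  shows "asymp_eq A \<F> (\<lambda>i. S i \<otimes> T i) (\<lambda>i. S' i \<otimes> T' i)"
proof (rule asymp_eq_by_bound)
  note [simp] = asymp_eqD(1,2)[OF assms(1)] asymp_eqD(1,2)[OF assms(2)]
  fix i
  have "S i \<otimes> T i \<ominus> S' i \<otimes> T' i = S i \<otimes> (T i \<ominus> T' i) \<oplus> (S i \<ominus> S' i) \<otimes> T' i"
    using asymp_eqD(1,2)[OF assms(1), of i] asymp_eqD(1,2)[OF assms(2), of i] by algebra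
  then have "cnorm A (S i \<otimes> T i \<ominus> S' i \<otimes> T' i)
      \<le> cnorm A (S i \<otimes> (T i \<ominus> T' i)) + cnorm A ((S i \<ominus> S' i) \<otimes> T' i)"
    by (simp add: cnorm_triangle)
  also have "\<dots> \<le> K * cnorm A (T i \<ominus> T' i) + cnorm A (S i \<ominus> S' i) * L"
    by (intro add_mono cnorm_mult_le) (simp_all add: assms(3,4))
  finally show "cnorm A (S i \<otimes> T i \<ominus> S' i \<otimes> T' i)
      \<le> K * cnorm A (T i \<ominus> T' i) + cnorm A (S i \<ominus> S' i) * L" .
  show "((\<lambda>i. K * cnorm A (T i \<ominus> T' i) + cnorm A (S i \<ominus> S' i) * L) \<longlongrightarrow> 0) \<F>"
    using tendsto_add[OF tendsto_mult_left[OF asymp_eqD(3)[OF assms(2)], of K]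
        tendsto_mult_right[OF asymp_eqD(3)[OF assms(1)], of L]] by simp
qed (simp_all add: asymp_eqD(1,2)[OF assms(1)] asymp_eqD(1,2)[OF assms(2)])

lemma asymp_eq_mult_left:
  assumes "asymp_eq A \<F> T T'" "\<And>i. S i \<in> carrier A" "\<And>i. cnorm A (S i) \<le> K"
  shows "asymp_eq A \<F> (\<lambda>i. S i \<otimes> T i) (\<lambda>i. S i \<otimes> T' i)"
proof (rule asymp_eq_by_bound)
  note [simp] = asymp_eqD(1,2)[OF assms(1)] assms(2)
  fix i
  have "S i \<otimes> T i \<ominus> S i \<otimes> T' i = S i \<otimes> (T i \<ominus> T' i)"
    using asymp_eqD(1,2)[OF assms(1), of i] assms(2)[of i] by algebra
  then show "cnorm A (S i \<otimes> T i \<ominus> S i \<otimes> T' i) \<le> K * cnorm A (T i \<ominus> T' i)"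
    by (simp add: cnorm_mult_le assms)
  show "((\<lambda>i. K * cnorm A (T i \<ominus> T' i)) \<longlongrightarrow> 0) \<F>"
    using tendsto_mult_left[OF asymp_eqD(3)[OF assms(1)], of K] by simp
qed (simp_all add: asymp_eqD(1,2)[OF assms(1)] assms(2))

lemma asymp_eq_mult_right:
  assumes "asymp_eq A \<F> T T'" "\<And>i. S i \<in> carrier A" "\<And>i. cnorm A (S i) \<le> K"
  shows "asymp_eq A \<F> (\<lambda>i. T i \<otimes> S i) (\<lambda>i. T' i \<otimes> S i)"
proof (rule asymp_eq_by_bound)
  note [simp] = asymp_eqD(1,2)[OF assms(1)] assms(2)
  fix i
  have "T i \<otimes> S i \<ominus> T' i \<otimes> S i = (T i \<ominus> T' i) \<otimes> S i"
    using asymp_eqD(1,2)[OF assms(1), of i] assms(2)[of i] by algebra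
  then show "cnorm A (T i \<otimes> S i \<ominus> T' i \<otimes> S i) \<le> cnorm A (T i \<ominus> T' i) * K"
    by (simp add: cnorm_mult_le assms)
  show "((\<lambda>i. cnorm A (T i \<ominus> T' i) * K) \<longlongrightarrow> 0) \<F>"
    using tendsto_mult_right[OF asymp_eqD(3)[OF assms(1)], of K] by simp
qed (simp_all add: asymp_eqD(1,2)[OF assms(1)] assms(2))

lemma asymp_eq_scale:
  assumes "asymp_eq A \<F> S T" shows "asymp_eq A \<F> (\<lambda>i. c \<odot> S i) (\<lambda>i. c \<odot> T i)"
proof (rule asymp_eq_by_bound)
  fix i
  have "c \<odot> S i \<ominus> c \<odot> T i = c \<odot> (S i \<ominus> T i)"
    by (simp add: M.minus_eq asymp_eqD[OF assms] scale_add_right scale_minus_right)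
  then show "cnorm A (c \<odot> S i \<ominus> c \<odot> T i) \<le> cmod c * cnorm A (S i \<ominus> T i)"
    by (simp add: cnorm_smult asymp_eqD[OF assms])
  show "((\<lambda>i. cmod c * cnorm A (S i \<ominus> T i)) \<longlongrightarrow> 0) \<F>"
    using tendsto_mult_left[OF asymp_eqD(3)[OF assms], of "cmod c"] by simp
qed (simp_all add: asymp_eqD[OF assms])

lemma asymp_eq_diff:
  assumes "asymp_eq A \<F> S S'" "asymp_eq A \<F> T T'"
  shows "asymp_eq A \<F> (\<lambda>i. S i \<ominus> T i) (\<lambda>i. S' i \<ominus> T' i)"
  using asymp_eq_add[OF assms(1) asymp_eq_scale[OF assms(2), of "-1"]]
  by (simp add: M.minus_eq minus_eq_scale asymp_eqD[OF assms(2)])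

lemma asymp_eq_adj:
  assumes "asymp_eq A \<F> S T" shows "asymp_eq A \<F> (\<lambda>i. adj A (S i)) (\<lambda>i. adj A (T i))"
proof -
  have "adj A (S i) \<ominus> adj A (T i) = adj A (S i \<ominus> T i)" for i
    using asymp_eqD(1,2)[OF assms, of i] by algebra
  then show ?thesis using assms by (auto simp: asymp_eq_def)
qed

lemma asymp_eq_finsum:
  assumes "finite J" "\<And>j. j \<in> J \<Longrightarrow> asymp_eq A \<F> (\<lambda>i. S i j) (\<lambda>i. T i j)"
  shows "asymp_eq A \<F> (\<lambda>i. \<Oplus>j\<in>J. S i j) (\<lambda>i. \<Oplus>j\<in>J. T i j)"
  using assms
proof (induction J rule: finite_induct)
  case (insert k J)
  have "asymp_eq A \<F> (\<lambda>i. S i k \<oplus> (\<Oplus>j\<in>J. S i j)) (\<lambda>i. T i k \<oplus> (\<Oplus>j\<in>J. T i j))"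
    using insert by (intro asymp_eq_add) auto
  moreover have "(\<lambda>j. S i j) \<in> insert k J \<rightarrow> carrier A" "(\<lambda>j. T i j) \<in> insert k J \<rightarrow> carrier A" for i
    using asymp_eqD(1,2)[OF insert.prems] by auto
  ultimately show ?case
    using insert.hyps by (simp add: M.finsum_insert Pi_iff)
qed (simp add: asymp_eq_refl)

lemma asymp_eq_const:
  assumes "asymp_eq A \<F> (\<lambda>_. x) (\<lambda>_. y)" "\<F> \<noteq> bot" shows "x = y"
  using asymp_eqD[OF assms(1)] assms(2) by (simp add: tendsto_const_iff cnorm_diff_eq_zero)

lemma limit_unique:
  assumes "asymp_eq A \<F> S (\<lambda>_. x)" "asymp_eq A \<F> S (\<lambda>_. y)" "\<F> \<noteq> bot" shows "x = y"
  using asymp_eq_const[OF asymp_eq_trans[OF asymp_eq_sym[OF assms(1)] assms(2)] assms(3)] .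

lemma asymp_eq_norm:
  assumes "asymp_eq A \<F> S T" shows "((\<lambda>i. cnorm A (S i) - cnorm A (T i)) \<longlongrightarrow> 0) \<F>"
proof (rule Lim_null_comparison[OF _ asymp_eqD(3)[OF assms]], rule always_eventually, rule allI)
  fix i show "norm (cnorm A (S i) - cnorm A (T i)) \<le> cnorm A (S i \<ominus> T i)"
    using cnorm_le_diff[of "S i" "T i"] cnorm_le_diff[of "T i" "S i"]
    by (simp add: asymp_eqD[OF assms] cnorm_diff_commute)
qed

lemma asymp_eq_norm_less:
  assumes "asymp_eq A \<F> S T" "\<And>i. cnorm A (T i) \<le> K" "K < L"
  shows "\<forall>\<^sub>F i in \<F>. cnorm A (S i) < L"
proof -
  have "\<forall>\<^sub>F i in \<F>. cnorm A (S i) - cnorm A (T i) < L - K"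
    using order_tendstoD(2)[OF asymp_eq_norm[OF assms(1)], of "L - K"] assms(3) by simp
  then show ?thesis
    by eventually_elim (use assms(2) in \<open>smt (verit)\<close>)
qed

lemma limit_norm_le:
  assumes "asymp_eq A \<F> S (\<lambda>_. x)" "\<And>i. cnorm A (S i) \<le> K" "\<F> \<noteq> bot"
  shows "cnorm A x \<le> K"
proof (rule ccontr)
  assume "\<not> cnorm A x \<le> K"
  then have "\<forall>\<^sub>F i in \<F>. cnorm A x < cnorm A x"
    using asymp_eq_norm_less[OF asymp_eq_sym[OF assms(1)], of K "cnorm A x"] assms(2) by simp
  then show False using assms(3) by (simp add: eventually_False)
qed

lemma Cauchy_limit:
  assumes "\<And>n. S n \<in> carrier A"
    and "\<And>e. e > 0 \<Longrightarrow> \<exists>N. \<forall>m\<ge>N. \<forall>n\<ge>N. cnorm A (S m \<ominus> S n) < e"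
  obtains x where "asymp_eq A sequentially S (\<lambda>_. x)"
proof -
  interpret Metric_space "carrier A" "cdist A" by (rule metric)
  have "MCauchy S"
    unfolding MCauchy_def using assms by (fastforce simp: cdist_def)
  then obtain x where x: "limitin mtopology S x sequentially"
    using complete mcomplete_def by blast
  then have "x \<in> carrier A" "((\<lambda>n. cdist A (S n) x) \<longlongrightarrow> 0) sequentially"
    by (simp_all add: limitin_metric_dist_null)
  then show thesis
    using that assms(1) by (simp add: asymp_eq_def cdist_def)
qed

end

section \<open>Fixed points and functional calculus by iteration\<close>

context cstar_algebra begin

lemma Cauchy_of_summable_steps:
  assumes S: "\<And>n. S n \<in> carrier A" and f: "summable f"
    and step: "\<And>n. n \<ge> N\<^sub>0 \<Longrightarrow> cnorm A (S (Suc n) \<ominus> S n) \<le> f n" and "e > 0"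
  shows "\<exists>N. \<forall>m\<ge>N. \<forall>n\<ge>N. cnorm A (S m \<ominus> S n) < e"
proof -
  obtain N where N: "\<And>m n. m \<ge> N \<Longrightarrow> \<bar>sum f {m..<n}\<bar> < e"
    using f \<open>e > 0\<close> unfolding summable_Cauchy real_norm_def by meson
  have tele: "cnorm A (S (n + k) \<ominus> S n) \<le> sum f {n..<n + k}" if "n \<ge> N\<^sub>0" for n k
  proof (induction k)
    case (Suc k)
    have "cnorm A (S (n + Suc k) \<ominus> S n)
        \<le> cnorm A (S (Suc (n + k)) \<ominus> S (n + k)) + cnorm A (S (n + k) \<ominus> S n)"
      using cnorm_diff_trans[of "S (Suc (n + k))" "S (n + k)" "S n"] S by simp
    also have "\<dots> \<le> f (n + k) + sum f {n..<n + k}"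
      using Suc.IH step[of "n + k"] that by simp
    finally show ?case by (simp add: add.commute)
  qed (simp add: S)
  have le: "cnorm A (S m \<ominus> S n) < e" if "n \<ge> max N N\<^sub>0" "m \<ge> n" for m n
    using tele[of n "m - n"] N[of n m] that by simp
  have "cnorm A (S m \<ominus> S n) < e" if "m \<ge> max N N\<^sub>0" "n \<ge> max N N\<^sub>0" for m n
    using le[of n m] le[of m n] that cnorm_diff_commute[OF S S, of m n] by (cases "m \<ge> n") auto
  then show ?thesis by blast
qed

text \<open>The invariant set \<open>S\<close> serves to pass properties that survive limits, such as selfadjointness and
  commutation relations, on to the fixed point.\<close>

lemma contraction_fixed_point:
  assumes "S \<subseteq> carrier A" "x\<^sub>0 \<in> S" "\<And>x. x \<in> S \<Longrightarrow> T x \<in> S"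
    and lip: "\<And>x y. x \<in> S \<Longrightarrow> y \<in> S \<Longrightarrow> cnorm A (T x \<ominus> T y) \<le> k * cnorm A (x \<ominus> y)"
    and k: "0 \<le> k" "k < 1"
    and closed: "\<And>V v. (\<And>n. V n \<in> S) \<Longrightarrow> asymp_eq A sequentially V (\<lambda>_. v) \<Longrightarrow> v \<in> S"
  obtains y where "y \<in> S" "T y = y"
proof -
  define V where "V n = (T ^^ n) x\<^sub>0" for n
  have VS: "V n \<in> S" for n
    unfolding V_def by (induction n) (use assms in auto)
  then have Vc: "V n \<in> carrier A" for n
    using assms(1) by blast
  have "cnorm A (V (Suc n) \<ominus> V n) \<le> cnorm A (V 1 \<ominus> V 0) * k ^ n" for n
  proof (induction n)
    case (Suc n)
    have "cnorm A (V (Suc (Suc n)) \<ominus> V (Suc n)) \<le> k * cnorm A (V (Suc n) \<ominus> V n)"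
      using lip[OF VS VS, of "Suc n" n] by (simp add: V_def)
    also have "\<dots> \<le> k * (cnorm A (V 1 \<ominus> V 0) * k ^ n)"
      using Suc.IH k by (intro mult_left_mono) auto
    finally show ?case by (simp add: mult_ac)
  qed simp
  moreover have "summable (\<lambda>n. cnorm A (V 1 \<ominus> V 0) * k ^ n)"
    using k by (intro summable_mult summable_geometric) auto
  ultimately obtain v where v: "asymp_eq A sequentially V (\<lambda>_. v)"
    using Cauchy_limit[of V] Cauchy_of_summable_steps[of V _ 0] Vc by blast
  have "v \<in> S" using closed[OF VS v] .
  have vc: "v \<in> carrier A" using \<open>v \<in> S\<close> assms(1) by blast
  have Tc: "T u \<in> carrier A" if "u \<in> S" for u using that assms by blast
  have lim: "asymp_eq A sequentially (\<lambda>n. V (Suc n)) (\<lambda>_. T v)"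
  proof (rule asymp_eq_by_bound)
    show "cnorm A (V (Suc n) \<ominus> T v) \<le> k * cnorm A (V n \<ominus> v)" for n
      using lip[OF VS \<open>v \<in> S\<close>, of n] by (simp add: V_def)
    show "((\<lambda>n. k * cnorm A (V n \<ominus> v)) \<longlongrightarrow> 0) sequentially"
      using tendsto_mult_left[OF asymp_eqD(3)[OF v], of k] by simp
  qed (use Vc Tc \<open>v \<in> S\<close> in auto)
  have "asymp_eq A sequentially (\<lambda>n. V (Suc n)) (\<lambda>_. v)"
    using asymp_eqD(3)[OF v] Vc vc
      filterlim_compose[OF _ filterlim_Suc, of "\<lambda>n. cnorm A (V n \<ominus> v)"]
    by (auto simp: asymp_eq_def)
  then have "T v = v" using limit_unique[OF lim] by simp
  then show thesis using that \<open>v \<in> S\<close> by blast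
qed

text \<open>Here \<open>1 - y\<close> is the square root of \<open>1 - x\<close>: the equation \<open>(1 - y)\<^sup>2 = 1 - x\<close> says that \<open>y\<close> is fixed by
  \<open>y \<mapsto> (x + y\<^sup>2)/2\<close>, which maps the ball of radius \<open>1/2\<close> to itself and halves distances in it. All
  iterates starting at \<open>\<zero>\<close> are selfadjoint and commute with whatever commutes with \<open>x\<close>.\<close>

lemma exists_root_one_minus:
  assumes x: "x \<in> carrier A" "adj A x = x" and "cnorm A x \<le> 1/2"
  obtains y where "y \<in> carrier A" "adj A y = y" "y \<oplus> y = x \<oplus> y \<otimes> y" "cnorm A y \<le> cnorm A x"
    "\<And>z. z \<in> carrier A \<Longrightarrow> z \<otimes> x = x \<otimes> z \<Longrightarrow> z \<otimes> y = y \<otimes> z"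
proof -
  define comm where "comm y \<longleftrightarrow> (\<forall>z\<in>carrier A. z \<otimes> x = x \<otimes> z \<longrightarrow> z \<otimes> y = y \<otimes> z)" for y
  define S where "S = {y \<in> carrier A. cnorm A y \<le> 1/2 \<and> adj A y = y \<and> comm y}"
  define T where "T y = (1/2) \<odot> (x \<oplus> y \<otimes> y)" for y
  obtain y where y: "y \<in> S" "T y = y"
  proof (rule contraction_fixed_point[of S \<zero> T "1/2"])
    show "S \<subseteq> carrier A" "\<zero> \<in> S" by (auto simp: S_def comm_def)
    show "T y \<in> S" if "y \<in> S" for y
    proof -
      have y: "y \<in> carrier A" "adj A y = y" "cnorm A y \<le> 1/2" "comm y"
        using that by (auto simp: S_def)
      have "cnorm A (x \<oplus> y \<otimes> y) \<le> 1/2 + 1/2 * (1/2)"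
        using cnorm_triangle[of x "y \<otimes> y"] cnorm_mult_le[of y y "1/2" "1/2"] y assms by simp
      then have "cnorm A (T y) \<le> 1/2"
        using x y by (simp add: T_def cnorm_smult)
      moreover have "z \<otimes> T y = T y \<otimes> z" if z: "z \<in> carrier A" "z \<otimes> x = x \<otimes> z" for z
      proof -
        have zy: "z \<otimes> y = y \<otimes> z" using z \<open>comm y\<close> unfolding comm_def by blast
        have "z \<otimes> (y \<otimes> y) = (y \<otimes> y) \<otimes> z"
          using mult_assoc[of z y y] mult_assoc[of y z y] mult_assoc[of y y z] zy z y by simp
        then show ?thesis
          using z x y
          by (simp add: T_def smult_mult_left smult_mult_right mult_l_distr mult_r_distr)
      qed
      moreover have "T y \<in> carrier A" "adj A (T y) = T y"
        using x y by (simp_all add: T_def adj_smult adj_add adj_mult)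
      ultimately show ?thesis
        unfolding S_def comm_def by blast
    qed
    show "cnorm A (T y \<ominus> T y') \<le> 1/2 * cnorm A (y \<ominus> y')" if "y \<in> S" "y' \<in> S" for y y'
    proof -
      have yc: "y \<in> carrier A" "y' \<in> carrier A" and yn: "cnorm A y \<le> 1/2" "cnorm A y' \<le> 1/2"
        using that by (auto simp: S_def)
      have "(x \<oplus> y \<otimes> y) \<ominus> (x \<oplus> y' \<otimes> y') = y \<otimes> (y \<ominus> y') \<oplus> (y \<ominus> y') \<otimes> y'"
        using yc x(1) by algebra
      then have "cnorm A ((x \<oplus> y \<otimes> y) \<ominus> (x \<oplus> y' \<otimes> y'))
          \<le> 1/2 * cnorm A (y \<ominus> y') + cnorm A (y \<ominus> y') * (1/2)"
        using yc yn cnorm_triangle[of "y \<otimes> (y \<ominus> y')" "(y \<ominus> y') \<otimes> y'"]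
          cnorm_mult_le[of y "y \<ominus> y'" "1/2" "cnorm A (y \<ominus> y')"]
          cnorm_mult_le[of "y \<ominus> y'" y' "cnorm A (y \<ominus> y')" "1/2"] by simp
      moreover have "T y \<ominus> T y' = (1/2) \<odot> ((x \<oplus> y \<otimes> y) \<ominus> (x \<oplus> y' \<otimes> y'))"
        using yc x(1) by (simp add: T_def M.minus_eq scale_add_right scale_minus_right del: M.minus_add)
      ultimately show ?thesis
        using yc x(1) by (simp add: cnorm_smult)
    qed
    show "v \<in> S" if V: "\<And>n. V n \<in> S" and lim: "asymp_eq A sequentially V (\<lambda>_. v)" for V v
    proof -
      note v = asymp_eqD(2)[OF lim]
      have Vc: "V n \<in> carrier A" "adj A (V n) = V n" "cnorm A (V n) \<le> 1/2" "comm (V n)" for n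
        using V[of n] by (simp_all add: S_def)
      have "cnorm A v \<le> 1/2"
        by (rule limit_norm_le[OF lim Vc(3)]) simp
      moreover have "adj A v = v"
        using limit_unique[OF asymp_eq_adj[OF lim], of v] lim Vc(2) by simp
      moreover have "z \<otimes> v = v \<otimes> z" if z: "z \<in> carrier A" "z \<otimes> x = x \<otimes> z" for z
      proof -
        have lims: "asymp_eq A sequentially (\<lambda>n. z \<otimes> V n) (\<lambda>_. z \<otimes> v)"
          "asymp_eq A sequentially (\<lambda>n. V n \<otimes> z) (\<lambda>_. v \<otimes> z)"
          using z(1) by (auto intro!: asymp_eq_mult_left[OF lim] asymp_eq_mult_right[OF lim])
        have "(\<lambda>n. z \<otimes> V n) = (\<lambda>n. V n \<otimes> z)"
          using z Vc(4) unfolding comm_def by blast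
        then show ?thesis
          using limit_unique[of sequentially "\<lambda>n. z \<otimes> V n"] lims by simp
      qed
      ultimately show ?thesis using v unfolding S_def comm_def by blast
    qed
  qed auto
  have yc: "y \<in> carrier A" "cnorm A y \<le> 1/2" "adj A y = y" "comm y"
    using y(1) by (simp_all add: S_def)
  have "y \<oplus> y = (1/2 + 1/2) \<odot> (x \<oplus> y \<otimes> y)"
    using y(2) yc(1) x(1) scale_add_left[of "x \<oplus> y \<otimes> y" "1/2" "1/2"] by (simp add: T_def)
  then have eq: "y \<oplus> y = x \<oplus> y \<otimes> y"
    using yc(1) x(1) by simp
  have "2 * cnorm A y = cnorm A (y \<oplus> y)"
    using scale_add_left[OF yc(1), of 1 1] cnorm_smult[OF yc(1), of 2] yc(1) by simp
  also have "\<dots> \<le> cnorm A x + 1/2 * cnorm A y"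
    unfolding eq using cnorm_triangle[of x "y \<otimes> y"] cnorm_mult_le[of y y "1/2" "cnorm A y"] yc(1,2) x(1)
    by simp
  finally have "cnorm A y \<le> cnorm A x"
    using cnorm_nonneg[OF yc(1)] by linarith
  then show thesis using that yc eq unfolding comm_def by blast
qed

end

text \<open>The operation \<open>(1 + x)(1 + y) - 1\<close>. It gives the multiplication of the unitization on
  elements \<open>1 + x\<close> without leaving the algebra, with neutral element \<open>\<zero>\<close>.\<close>

definition circ :: "('a, 'z) cstar_scheme \<Rightarrow> 'a \<Rightarrow> 'a \<Rightarrow> 'a" where
  "circ A x y = x \<oplus>\<^bsub>A\<^esub> y \<oplus>\<^bsub>A\<^esub> x \<otimes>\<^bsub>A\<^esub> y"

text \<open>The elements \<open>b\<close> for which \<open>1 + b\<close> is a unitary of the unitization.\<close>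

definition quasi_unitary :: "('a, 'z) cstar_scheme \<Rightarrow> 'a \<Rightarrow> bool" where
  "quasi_unitary A b \<longleftrightarrow>
    b \<in> carrier A \<and> circ A (adj A b) b = \<zero>\<^bsub>A\<^esub> \<and> circ A b (adj A b) = \<zero>\<^bsub>A\<^esub>"

context cstar_algebra begin

lemma circ_closed [simp, intro]: "x \<in> carrier A \<Longrightarrow> y \<in> carrier A \<Longrightarrow> circ A x y \<in> carrier A"
  by (simp add: circ_def)

lemma circ_assoc:
  "x \<in> carrier A \<Longrightarrow> y \<in> carrier A \<Longrightarrow> z \<in> carrier A \<Longrightarrow> circ A (circ A x y) z = circ A x (circ A y z)"
  unfolding circ_def by algebra

lemma circ_zero [simp]: "x \<in> carrier A \<Longrightarrow> circ A \<zero> x = x" "x \<in> carrier A \<Longrightarrow> circ A x \<zero> = x"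
  by (simp_all add: circ_def)

lemma adj_circ: "x \<in> carrier A \<Longrightarrow> y \<in> carrier A \<Longrightarrow> adj A (circ A x y) = circ A (adj A y) (adj A x)"
  unfolding circ_def by algebra

text \<open>The inverse \<open>1 + s\<close> of \<open>1 - y\<close>, as the fixed point of \<open>s \<mapsto> y + sy\<close>. By construction it is a left inverse;
  its adjoint is then a right inverse, and the two agree.\<close>

lemma exists_quasi_inverse:
  assumes y: "y \<in> carrier A" "adj A y = y" and small: "cnorm A y \<le> 1/2"
  obtains s where "s \<in> carrier A" "adj A s = s" "cnorm A s \<le> 2 * cnorm A y"
    "circ A s (\<ominus> y) = \<zero>" "circ A (\<ominus> y) s = \<zero>"
proof -
  obtain s where s: "s \<in> carrier A" "y \<oplus> s \<otimes> y = s"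
  proof (rule contraction_fixed_point[of "carrier A" \<zero> "\<lambda>s. y \<oplus> s \<otimes> y" "1/2"])
    fix s t assume st: "s \<in> carrier A" "t \<in> carrier A"
    have "(y \<oplus> s \<otimes> y) \<ominus> (y \<oplus> t \<otimes> y) = (s \<ominus> t) \<otimes> y"
      using st y by algebra
    then show "cnorm A ((y \<oplus> s \<otimes> y) \<ominus> (y \<oplus> t \<otimes> y)) \<le> 1/2 * cnorm A (s \<ominus> t)"
      using cnorm_mult_le[of "s \<ominus> t" y "cnorm A (s \<ominus> t)" "1/2"] st y small by simp
  qed (use y in \<open>auto dest: asymp_eqD\<close>)
  have "cnorm A s \<le> cnorm A y + cnorm A s * (1/2)"
    using cnorm_triangle[of y "s \<otimes> y"] cnorm_mult_le[of s y "cnorm A s" "1/2"] s y small by simp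
  then have norm: "cnorm A s \<le> 2 * cnorm A y" by simp
  have "circ A s (\<ominus> y) = s \<ominus> (y \<oplus> s \<otimes> y)"
    unfolding circ_def using s(1) y(1) by algebra
  then have left: "circ A s (\<ominus> y) = \<zero>" using s by simp
  have right: "circ A (\<ominus> y) (adj A s) = \<zero>"
    using adj_circ[of s "\<ominus> y"] left s y by (simp add: adj_minus)
  have "adj A s = circ A (circ A s (\<ominus> y)) (adj A s)"
    using left s by simp
  also have "\<dots> = s"
    using right s y by (simp add: circ_assoc)
  finally have "adj A s = s" .
  then show thesis using that s norm left right by simp
qed

text \<open>The polar decomposition of an invertible \<open>1 + c\<close>: with \<open>(1 + s)\<^sup>2\<close> the inverse of
  \<open>(1 + c)\<^sup>*(1 + c)\<close>, the element \<open>(1 + c)(1 + s)\<close> is unitary. The second smallness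
  hypothesis makes \<open>1 + c\<close> right invertible, which turns the isometry into a unitary.\<close>

lemma quasi_unitary_near:
  assumes c: "c \<in> carrier A"
    and e1: "cnorm A (circ A (adj A c) c) \<le> 1/2" and e2: "cnorm A (circ A c (adj A c)) < 1"
  obtains b where "quasi_unitary A b"
    "cnorm A (b \<ominus> c) \<le> 2 * cnorm A (circ A (adj A c) c) * (1 + cnorm A c)"
proof -
  let ?e = "circ A (adj A c) c" and ?f = "circ A c (adj A c)"
  have e: "?e \<in> carrier A" "adj A ?e = ?e" and f: "?f \<in> carrier A"
    using c by (simp_all add: adj_circ)
  have me: "\<ominus> ?e \<in> carrier A" "adj A (\<ominus> ?e) = \<ominus> ?e" "cnorm A (\<ominus> ?e) \<le> 1/2"
    using e e1 by (simp_all add: adj_minus)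
  obtain y where y: "y \<in> carrier A" "adj A y = y" "y \<oplus> y = \<ominus> ?e \<oplus> y \<otimes> y"
      "cnorm A y \<le> cnorm A (\<ominus> ?e)"
    using exists_root_one_minus[OF me] by blast
  have "cnorm A y \<le> 1/2" using y(4) e e1 by simp
  then obtain s where s: "s \<in> carrier A" "adj A s = s" "cnorm A s \<le> 2 * cnorm A y"
    "circ A s (\<ominus> y) = \<zero>" "circ A (\<ominus> y) s = \<zero>"
    using exists_quasi_inverse[of y] y by blast
  have "circ A (\<ominus> y) (\<ominus> y) = y \<otimes> y \<ominus> (y \<oplus> y)"
    unfolding circ_def using y(1) by algebra
  also have "\<dots> = y \<otimes> y \<ominus> (\<ominus> ?e \<oplus> y \<otimes> y)" unfolding y(3) ..
  also have "\<dots> = ?e" using y(1) e(1) by algebra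
  finally have root: "?e = circ A (\<ominus> y) (\<ominus> y)" by simp
  have sse: "circ A (circ A s s) ?e = \<zero>" and ses: "circ A s (circ A ?e s) = \<zero>"
  proof -
    have "circ A (circ A s s) ?e = circ A s (circ A (circ A s (\<ominus> y)) (\<ominus> y))"
      unfolding root using s(1) y(1) by (simp add: circ_assoc)
    then show "circ A (circ A s s) ?e = \<zero>" using s y by simp
    have "circ A s (circ A ?e s) = circ A (circ A s (\<ominus> y)) (circ A (\<ominus> y) s)"
      unfolding root using s(1) y(1) by (simp add: circ_assoc)
    then show "circ A s (circ A ?e s) = \<zero>" using s y by simp
  qed
  define b where "b = circ A c s"
  have bc: "b \<in> carrier A" using c s by (simp add: b_def)
  have "circ A (adj A b) b = circ A s (circ A ?e s)"
    using c s by (simp add: b_def adj_circ circ_assoc)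
  then have left: "circ A (adj A b) b = \<zero>" using ses by simp
  have right: "circ A b (adj A b) = \<zero>"
  proof -
    let ?p = "circ A b (adj A b)"
    have p: "?p \<in> carrier A" using bc by simp
    have "circ A ?p c = circ A c (circ A (circ A s s) ?e)"
      using c s by (simp add: b_def adj_circ circ_assoc)
    then have "circ A ?p c = c" using sse c by simp
    then have "circ A ?p ?f = ?f"
      using p c circ_assoc[of ?p c "adj A c"] by simp
    moreover have "circ A ?p ?f \<ominus> ?f = ?p \<oplus> ?p \<otimes> ?f"
      unfolding circ_def[of A ?p ?f] using p f by algebra
    ultimately have "?p \<oplus> ?p \<otimes> ?f = \<zero>" using f by simp
    then have "?p = \<ominus> (?p \<otimes> ?f)"
      using p f M.minus_equality[of ?p "?p \<otimes> ?f"] by simp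
    then have "cnorm A ?p \<le> cnorm A ?p * cnorm A ?f"
      using cnorm_mult[OF p f] p f by (metis cnorm_minus mult_closed)
    then have "cnorm A ?p * (1 - cnorm A ?f) \<le> 0" by (simp add: algebra_simps)
    then have "cnorm A ?p = 0"
      using e2 cnorm_nonneg[OF p] by (simp add: mult_le_0_iff)
    then show ?thesis using p cnorm_eq_zero by simp
  qed
  have "b \<ominus> c = s \<oplus> c \<otimes> s"
    unfolding b_def circ_def using c s(1) by algebra
  then have "cnorm A (b \<ominus> c) \<le> cnorm A s + cnorm A c * cnorm A s"
    using cnorm_triangle[of s "c \<otimes> s"] cnorm_mult[of c s] c s by simp
  also have "\<dots> = cnorm A s * (1 + cnorm A c)" by (simp add: algebra_simps)
  also have "\<dots> \<le> 2 * cnorm A ?e * (1 + cnorm A c)"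
    using s(3) y(4) e c by (intro mult_right_mono) auto
  finally show thesis using that left right bc by (simp add: quasi_unitary_def)
qed

text \<open>Since \<open>b\<^sup>*b = - (b + b\<^sup>*)\<close>, the C*-identity gives \<open>\<parallel>b\<parallel>\<^sup>2 \<le> 2 \<parallel>b\<parallel>\<close>.\<close>

lemma quasi_unitary_norm:
  assumes "quasi_unitary A b" shows "cnorm A b \<le> 2"
proof (cases "cnorm A b = 0")
  case False
  have b: "b \<in> carrier A" using assms by (simp add: quasi_unitary_def)
  have "adj A b \<otimes> b = circ A (adj A b) b \<ominus> (adj A b \<oplus> b)"
    unfolding circ_def using b by algebra
  then have "adj A b \<otimes> b = \<ominus> (adj A b \<oplus> b)"
    using assms b by (simp add: quasi_unitary_def M.minus_eq)
  then have "(cnorm A b)\<^sup>2 \<le> 2 * cnorm A b"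
    using cstar_identity[OF b] cnorm_triangle[of "adj A b" b] b by simp
  then show ?thesis
    using False cnorm_nonneg[OF b] by (simp add: power2_eq_square)
qed simp

lemma quasi_unitary_isometry:
  assumes "quasi_unitary A b" and x: "x \<in> carrier A"
  shows "cnorm A (x \<oplus> b \<otimes> x) = cnorm A x"
proof -
  have b: "b \<in> carrier A" using assms by (simp add: quasi_unitary_def)
  have "adj A (x \<oplus> b \<otimes> x) \<otimes> (x \<oplus> b \<otimes> x) = adj A x \<otimes> x \<oplus> adj A x \<otimes> (circ A (adj A b) b \<otimes> x)"
    unfolding circ_def using b x by algebra
  then have "adj A (x \<oplus> b \<otimes> x) \<otimes> (x \<oplus> b \<otimes> x) = adj A x \<otimes> x"
    using assms x by (simp add: quasi_unitary_def)
  then have "(cnorm A (x \<oplus> b \<otimes> x))\<^sup>2 = (cnorm A x)\<^sup>2"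
    using cstar_identity[of x] cstar_identity[of "x \<oplus> b \<otimes> x"] x b by simp
  then show ?thesis
    using x b by (simp add: power2_eq_iff_nonneg)
qed

end

section \<open>Automatic continuity of *-homomorphisms\<close>

lemma star_homD:
  assumes "\<phi> \<in> star_hom A B"
  shows "x \<in> carrier A \<Longrightarrow> \<phi> x \<in> carrier B"
    and "x \<in> carrier A \<Longrightarrow> y \<in> carrier A \<Longrightarrow> \<phi> (x \<oplus>\<^bsub>A\<^esub> y) = \<phi> x \<oplus>\<^bsub>B\<^esub> \<phi> y"
    and "x \<in> carrier A \<Longrightarrow> \<phi> (c \<odot>\<^bsub>A\<^esub> x) = c \<odot>\<^bsub>B\<^esub> \<phi> x"
    and "x \<in> carrier A \<Longrightarrow> y \<in> carrier A \<Longrightarrow> \<phi> (x \<otimes>\<^bsub>A\<^esub> y) = \<phi> x \<otimes>\<^bsub>B\<^esub> \<phi> y"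
    and "x \<in> carrier A \<Longrightarrow> \<phi> (adj A x) = adj B (\<phi> x)"
    and "\<phi> \<in> extensional (carrier A)"
  using assms by (auto simp: star_hom_def PiE_def)

locale cstar_hom = A: cstar_algebra A + B: cstar_algebra B
  for A :: "('a, 'y) cstar_scheme" and B :: "('b, 'z) cstar_scheme" +
  fixes \<phi>
  assumes hom: "\<phi> \<in> star_hom A B"
begin

lemmas hom_closed [simp, intro] = star_homD(1)[OF hom]
  and hom_add = star_homD(2)[OF hom]
  and hom_scale = star_homD(3)[OF hom]
  and hom_mult = star_homD(4)[OF hom]
  and hom_adj = star_homD(5)[OF hom]

lemma hom_zero [simp]: "\<phi> \<zero>\<^bsub>A\<^esub> = \<zero>\<^bsub>B\<^esub>"
  using hom_scale[of "\<zero>\<^bsub>A\<^esub>" 0] by simp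

lemma hom_minus: "x \<in> carrier A \<Longrightarrow> \<phi> (\<ominus>\<^bsub>A\<^esub> x) = \<ominus>\<^bsub>B\<^esub> \<phi> x"
  by (simp add: A.minus_eq_scale B.minus_eq_scale hom_scale)

lemma hom_diff:
  "x \<in> carrier A \<Longrightarrow> y \<in> carrier A \<Longrightarrow> \<phi> (x \<ominus>\<^bsub>A\<^esub> y) = \<phi> x \<ominus>\<^bsub>B\<^esub> \<phi> y"
  by (simp add: A.M.minus_eq B.M.minus_eq hom_add hom_minus)

lemma hom_circ:
  "x \<in> carrier A \<Longrightarrow> y \<in> carrier A \<Longrightarrow> \<phi> (circ A x y) = circ B (\<phi> x) (\<phi> y)"
  by (simp add: circ_def hom_add hom_mult)

lemma hom_quasi_unitary: "quasi_unitary A b \<Longrightarrow> quasi_unitary B (\<phi> b)"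
  by (auto simp: quasi_unitary_def simp flip: hom_circ hom_adj)

text \<open>A small selfadjoint \<open>h\<close> is, up to sign, the imaginary part of the unitary \<open>1 + b = (1 - y) - ih\<close> with
  \<open>1 - y\<close> the square root of \<open>1 - h\<^sup>2\<close>. Unitaries go to unitaries, and these are bounded by an
  absolute constant.\<close>

lemma hom_norm_selfadjoint:
  assumes h: "h \<in> carrier A" "adj A h = h" and small: "cnorm A h \<le> 1/2"
  shows "cnorm B (\<phi> h) \<le> 2"
proof -
  have "cnorm A (h \<otimes>\<^bsub>A\<^esub> h) \<le> 1/2 * (1/2)"
    using h small by (intro A.cnorm_mult_le)
  then have hh: "h \<otimes>\<^bsub>A\<^esub> h \<in> carrier A" "adj A (h \<otimes>\<^bsub>A\<^esub> h) = h \<otimes>\<^bsub>A\<^esub> h"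
      "cnorm A (h \<otimes>\<^bsub>A\<^esub> h) \<le> 1/2"
    using h by (simp_all add: A.adj_mult)
  have comm: "h \<otimes>\<^bsub>A\<^esub> (h \<otimes>\<^bsub>A\<^esub> h) = h \<otimes>\<^bsub>A\<^esub> h \<otimes>\<^bsub>A\<^esub> h"
    using h by (simp add: A.mult_assoc)
  obtain y where y: "y \<in> carrier A" "adj A y = y"
      "y \<oplus>\<^bsub>A\<^esub> y = h \<otimes>\<^bsub>A\<^esub> h \<oplus>\<^bsub>A\<^esub> y \<otimes>\<^bsub>A\<^esub> y" "h \<otimes>\<^bsub>A\<^esub> y = y \<otimes>\<^bsub>A\<^esub> h"
    using A.exists_root_one_minus[OF hh] comm h(1) by metis
  define k where "k = \<i> \<odot>\<^bsub>A\<^esub> h"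
  have k: "k \<in> carrier A" "adj A k = \<ominus>\<^bsub>A\<^esub> k" "k \<otimes>\<^bsub>A\<^esub> k = \<ominus>\<^bsub>A\<^esub> (h \<otimes>\<^bsub>A\<^esub> h)"
      "k \<otimes>\<^bsub>A\<^esub> y = y \<otimes>\<^bsub>A\<^esub> k"
    using h y by (simp_all add: k_def A.adj_smult A.minus_eq_scale A.scale_scale
        A.smult_mult_left A.smult_mult_right)
  define b where "b = \<ominus>\<^bsub>A\<^esub> (y \<oplus>\<^bsub>A\<^esub> k)"
  have b: "b \<in> carrier A" using y k by (simp add: b_def)
  have adjb: "adj A b = k \<ominus>\<^bsub>A\<^esub> y"
    using y k A.adj_minus[of "y \<oplus>\<^bsub>A\<^esub> k"] by (simp add: b_def A.adj_add A.M.minus_eq A.M.minus_add A.M.a_comm)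
  have "circ A (adj A b) b = y \<otimes>\<^bsub>A\<^esub> y \<ominus>\<^bsub>A\<^esub> k \<otimes>\<^bsub>A\<^esub> k \<ominus>\<^bsub>A\<^esub> (y \<oplus>\<^bsub>A\<^esub> y)"
    unfolding adjb unfolding circ_def b_def A.mult_l_distr using y(1) k(1,4)
    by algebra
  moreover have "circ A b (adj A b) = y \<otimes>\<^bsub>A\<^esub> y \<ominus>\<^bsub>A\<^esub> k \<otimes>\<^bsub>A\<^esub> k \<ominus>\<^bsub>A\<^esub> (y \<oplus>\<^bsub>A\<^esub> y)"
    unfolding adjb unfolding circ_def b_def using y(1) k(1,4)
    by algebra
  moreover have "y \<otimes>\<^bsub>A\<^esub> y \<ominus>\<^bsub>A\<^esub> k \<otimes>\<^bsub>A\<^esub> k \<ominus>\<^bsub>A\<^esub> (y \<oplus>\<^bsub>A\<^esub> y) = \<zero>\<^bsub>A\<^esub>"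
    unfolding y(3) k(3) using h(1) y(1) by algebra
  ultimately have "quasi_unitary A b"
    using b by (simp add: quasi_unitary_def)
  then have "quasi_unitary B (\<phi> b)" by (rule hom_quasi_unitary)
  then have "cnorm B (\<phi> b) \<le> 2" by (rule B.quasi_unitary_norm)
  then have "cnorm B (\<phi> (adj A b) \<ominus>\<^bsub>B\<^esub> \<phi> b) \<le> 4"
    using B.cnorm_diff_triangle[of "\<phi> (adj A b)" "\<phi> b"] b by (simp add: hom_adj)
  moreover have "adj A b \<ominus>\<^bsub>A\<^esub> b = k \<oplus>\<^bsub>A\<^esub> k"
    unfolding adjb unfolding b_def using y(1) k(1) by algebra
  then have "\<phi> (adj A b) \<ominus>\<^bsub>B\<^esub> \<phi> b = (2 * \<i>) \<odot>\<^bsub>B\<^esub> \<phi> h"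
    using b h A.scale_add_left[of h \<i> \<i>]
    by (simp add: k_def flip: hom_diff hom_scale)
  ultimately show ?thesis
    using h by (simp add: B.cnorm_smult norm_mult)
qed

text \<open>Rescaling \<open>x\<^sup>*x\<close> to norm \<open>1/2\<close> reduces to the selfadjoint case. A constant that depends neither on \<open>\<phi>\<close>
  nor on the algebras is what the passage to limits of homomorphisms requires.\<close>

lemma hom_bounded:
  assumes x: "x \<in> carrier A" shows "cnorm B (\<phi> x) \<le> 2 * cnorm A x"
proof (cases "x = \<zero>\<^bsub>A\<^esub>")
  case False
  then have n: "cnorm A x > 0"
    using x A.cnorm_nonneg[OF x] A.cnorm_eq_zero[OF x] by linarith
  define h where "h = of_real (1 / (2 * (cnorm A x)\<^sup>2)) \<odot>\<^bsub>A\<^esub> (adj A x \<otimes>\<^bsub>A\<^esub> x)"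
  have h: "h \<in> carrier A" "adj A h = h" "cnorm A h \<le> 1/2"
    using x n by (simp_all add: h_def A.adj_smult A.adj_mult A.cnorm_smult A.cstar_identity
        norm_divide norm_mult norm_power)
  have "cnorm B (\<phi> h) = (cnorm B (\<phi> x))\<^sup>2 / (2 * (cnorm A x)\<^sup>2)"
    using x n by (simp add: h_def hom_scale hom_mult hom_adj B.cnorm_smult B.cstar_identity
        norm_divide norm_mult norm_power)
  then have "(cnorm B (\<phi> x))\<^sup>2 / (2 * (cnorm A x)\<^sup>2) \<le> 2"
    using hom_norm_selfadjoint[OF h] by simp
  then have "(cnorm B (\<phi> x))\<^sup>2 \<le> 4 * (cnorm A x)\<^sup>2"
    using n by (simp add: pos_divide_le_eq)
  then have "(cnorm B (\<phi> x))\<^sup>2 \<le> (2 * cnorm A x)\<^sup>2"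
    by (simp add: power_mult_distrib)
  then show ?thesis
    by (rule power2_le_imp_le) (use n in simp)
qed simp

lemma hom_asymp_eq:
  assumes "asymp_eq A \<F> S T" shows "asymp_eq B \<F> (\<lambda>i. \<phi> (S i)) (\<lambda>i. \<phi> (T i))"
proof (rule B.asymp_eq_by_bound)
  note [simp] = A.asymp_eqD(1,2)[OF assms]
  show "cnorm B (\<phi> (S i) \<ominus>\<^bsub>B\<^esub> \<phi> (T i)) \<le> 2 * cnorm A (S i \<ominus>\<^bsub>A\<^esub> T i)" for i
    using hom_bounded[of "S i \<ominus>\<^bsub>A\<^esub> T i"] by (simp add: hom_diff)
  show "((\<lambda>i. 2 * cnorm A (S i \<ominus>\<^bsub>A\<^esub> T i)) \<longlongrightarrow> 0) \<F>"
    using tendsto_mult_left[OF A.asymp_eqD(3)[OF assms], of 2] by simp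
qed (auto simp: A.asymp_eqD[OF assms])

end

section \<open>Sums, and lifting asymptotic unitaries\<close>

context cstar_algebra begin

lemma finsum_additive_map:
  assumes "finite J" "x \<in> J \<rightarrow> carrier A"
    and f: "\<And>a. a \<in> carrier A \<Longrightarrow> f a \<in> carrier A"
      "\<And>a b. a \<in> carrier A \<Longrightarrow> b \<in> carrier A \<Longrightarrow> f (a \<oplus> b) = f a \<oplus> f b"
  shows "f (\<Oplus>j\<in>J. x j) = (\<Oplus>j\<in>J. f (x j))"
  using assms(1,2)
proof (induction J rule: finite_induct)
  case empty
  have "f \<zero> = (f \<zero> \<oplus> f \<zero>) \<ominus> f \<zero>" using f(1)[OF M.zero_closed] by algebra
  also have "\<dots> = \<zero>" using f(1)[OF M.zero_closed] f(2)[of \<zero> \<zero>] by simp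
  finally show ?case by simp
next
  case (insert k J)
  then show ?case by (simp add: M.finsum_insert Pi_iff f M.finsum_closed)
qed

lemma cnorm_finsum:
  assumes "finite J" "x \<in> J \<rightarrow> carrier A"
  shows "cnorm A (\<Oplus>j\<in>J. x j) \<le> (\<Sum>j\<in>J. cnorm A (x j))"
  using assms
proof (induction J rule: finite_induct)
  case (insert k J)
  then show ?case
    using cnorm_triangle[of "x k" "\<Oplus>j\<in>J. x j"] by (simp add: M.finsum_insert Pi_iff M.finsum_closed)
qed simp

lemma finsum_const_scale:
  assumes "finite J" "x \<in> carrier A" shows "(\<Oplus>j\<in>J. x) = of_nat (card J) \<odot> x"
  using assms(1)
proof (induction J rule: finite_induct)
  case (insert k J)
  then show ?case using assms(2) scale_add_left[of x 1 "of_nat (card J)"]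
    by (simp add: M.finsum_insert)
qed (simp add: assms)

lemma asymp_eq_circ:
  assumes "asymp_eq A \<F> S S'" "asymp_eq A \<F> T T'"
    and "\<And>i. cnorm A (S i) \<le> K" "\<And>i. cnorm A (T' i) \<le> L"
  shows "asymp_eq A \<F> (\<lambda>i. circ A (S i) (T i)) (\<lambda>i. circ A (S' i) (T' i))"
  unfolding circ_def by (intro asymp_eq_add asymp_eq_mult[OF assms] assms(1,2))

lemma quasi_unitary_zero: "quasi_unitary A \<zero>"
  by (simp add: quasi_unitary_def)

text \<open>Along the filter the polar decomposition eventually applies, with an error that tends to zero.
  Where it does not apply, \<open>\<zero>\<close>, standing for the unitary \<open>1\<close>, is a harmless value.\<close>

lemma lift_asymptotic_unitary:
  assumes c: "\<And>i. c i \<in> carrier A" and bounded: "\<And>i. cnorm A (c i) \<le> K"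
    and left: "asymp_eq A \<F> (\<lambda>i. circ A (adj A (c i)) (c i)) (\<lambda>_. \<zero>)"
    and right: "asymp_eq A \<F> (\<lambda>i. circ A (c i) (adj A (c i))) (\<lambda>_. \<zero>)"
  obtains u where "\<And>i. quasi_unitary A (u i)" "asymp_eq A \<F> u c"
proof -
  define good where "good i \<longleftrightarrow> cnorm A (circ A (adj A (c i)) (c i)) \<le> 1/2
    \<and> cnorm A (circ A (c i) (adj A (c i))) < 1" for i
  have "\<exists>b. quasi_unitary A b \<and> cnorm A (b \<ominus> c i)
      \<le> 2 * cnorm A (circ A (adj A (c i)) (c i)) * (1 + cnorm A (c i))" if "good i" for i
    by (rule quasi_unitary_near[OF c[of i]]) (use that in \<open>auto simp: good_def\<close>)
  then obtain b where b: "\<And>i. good i \<Longrightarrow> quasi_unitary A (b i)"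
    "\<And>i. good i \<Longrightarrow> cnorm A (b i \<ominus> c i)
      \<le> 2 * cnorm A (circ A (adj A (c i)) (c i)) * (1 + cnorm A (c i))"
    by metis
  define u where "u i = (if good i then b i else \<zero>)" for i
  have u: "quasi_unitary A (u i)" for i
    using b(1) by (simp add: u_def quasi_unitary_zero)
  have "\<forall>\<^sub>F i in \<F>. cnorm A (circ A (adj A (c i)) (c i)) < 1/2"
    "\<forall>\<^sub>F i in \<F>. cnorm A (circ A (c i) (adj A (c i))) < 1"
    by (rule asymp_eq_norm_less[OF left, of 0] asymp_eq_norm_less[OF right, of 0]; simp)+
  then have ev: "\<forall>\<^sub>F i in \<F>. good i"
    unfolding good_def by eventually_elim simp
  have null: "((\<lambda>i. cnorm A (circ A (adj A (c i)) (c i))) \<longlongrightarrow> 0) \<F>"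
    using asymp_eqD(3)[OF left] c by (simp add: M.minus_eq minus_zero_eq)
  have "((\<lambda>i. cnorm A (u i \<ominus> c i)) \<longlongrightarrow> 0) \<F>"
  proof (rule Lim_null_comparison)
    show "((\<lambda>i. 2 * cnorm A (circ A (adj A (c i)) (c i)) * (1 + K)) \<longlongrightarrow> 0) \<F>"
      using tendsto_mult_right[OF tendsto_mult_left[OF null, of 2], of "1 + K"] by simp
    show "\<forall>\<^sub>F i in \<F>. norm (cnorm A (u i \<ominus> c i)) \<le> 2 * cnorm A (circ A (adj A (c i)) (c i)) * (1 + K)"
      using ev
    proof eventually_elim
      case (elim i)
      have "cnorm A (u i \<ominus> c i) \<le> 2 * cnorm A (circ A (adj A (c i)) (c i)) * (1 + cnorm A (c i))"
        using b(2)[OF elim] elim by (simp add: u_def)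
      also have "\<dots> \<le> 2 * cnorm A (circ A (adj A (c i)) (c i)) * (1 + K)"
        using c bounded by (intro mult_left_mono) auto
      finally show ?case using u c by (simp add: quasi_unitary_def)
    qed
  qed
  then show thesis
    using that u c unfolding asymp_eq_def quasi_unitary_def by blast
qed

end

section \<open>Actions of finite groups and their fixed point algebras\<close>

lemma (in cstar_algebra) closed_subalgebra:
  assumes sub: "S \<subseteq> carrier A" and zero: "\<zero> \<in> S"
    and ops: "\<And>x y. x \<in> S \<Longrightarrow> y \<in> S \<Longrightarrow> x \<oplus> y \<in> S" "\<And>x y. x \<in> S \<Longrightarrow> y \<in> S \<Longrightarrow> x \<otimes> y \<in> S"
      "\<And>c x. x \<in> S \<Longrightarrow> c \<odot> x \<in> S" "\<And>x. x \<in> S \<Longrightarrow> adj A x \<in> S"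
    and closed: "\<And>V v. (\<And>n. V n \<in> S) \<Longrightarrow> asymp_eq A sequentially V (\<lambda>_. v) \<Longrightarrow> v \<in> S"
  shows "cstar_algebra (A\<lparr>carrier := S\<rparr>)"
    and "\<And>x y. x \<in> S \<Longrightarrow> y \<in> S \<Longrightarrow> x \<ominus>\<^bsub>A\<lparr>carrier := S\<rparr>\<^esub> y = x \<ominus> y"
proof -
  let ?D = "A\<lparr>carrier := S\<rparr>"
  have in_A: "x \<in> carrier A" if "x \<in> S" for x using that sub by blast
  have neg: "\<ominus> x \<in> S" if "x \<in> S" for x
    using ops(3)[OF that, of "-1"] in_A[OF that] by (simp add: minus_eq_scale)
  have ab: "abelian_group ?D"
  proof (rule abelian_groupI)
    show "\<exists>y\<in>carrier ?D. y \<oplus>\<^bsub>?D\<^esub> x = \<zero>\<^bsub>?D\<^esub>" if "x \<in> carrier ?D" for x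
      using that neg[of x] in_A[of x] by (auto intro!: bexI[of _ "\<ominus> x"] M.l_neg)
  qed (auto simp: ops zero in_A M.a_assoc intro: M.a_comm)
  have inv_D: "\<ominus>\<^bsub>?D\<^esub> x = \<ominus> x" if "x \<in> S" for x
    using abelian_group.minus_equality[OF ab, of "\<ominus> x" x] neg[OF that] that in_A[OF that]
    by (simp add: M.l_neg)
  show minus_D: "x \<ominus>\<^bsub>?D\<^esub> y = x \<ominus> y" if "x \<in> S" "y \<in> S" for x y
    using that by (simp add: a_minus_def inv_D)
  have dist: "cdist ?D x y = cnorm A (x \<ominus> y)" if "x \<in> S" "y \<in> S" for x y
    using that by (simp add: cdist_def minus_D)
  interpret D: Metric_space S "cdist ?D"
  proof
    fix x y z
    show "0 \<le> cdist ?D x y" "cdist ?D x y = cdist ?D y x"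
      using cnorm_diff_commute[of x y] by (auto simp: cdist_def minus_D in_A)
    show "(cdist ?D x y = 0) = (x = y)" if "x \<in> S" "y \<in> S"
      using that by (simp add: dist in_A cnorm_diff_eq_zero)
    show "cdist ?D x z \<le> cdist ?D x y + cdist ?D y z" if "x \<in> S" "y \<in> S" "z \<in> S"
      using that by (simp add: dist in_A cnorm_diff_trans)
  qed
  have mcomplete: "D.mcomplete"
    unfolding D.mcomplete_def
  proof (intro allI impI)
    fix V assume V: "D.MCauchy V"
    then have VS: "V n \<in> S" for n unfolding D.MCauchy_def by blast
    have "\<exists>N. \<forall>m\<ge>N. \<forall>n\<ge>N. cnorm A (V m \<ominus> V n) < e" if "e > 0" for e
      using V that unfolding D.MCauchy_def by (simp add: dist VS)
    then obtain v where v: "asymp_eq A sequentially V (\<lambda>_. v)"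
      using Cauchy_limit[of V] VS in_A by blast
    then have "v \<in> S" using closed VS by blast
    moreover have "((\<lambda>n. cdist ?D (V n) v) \<longlongrightarrow> 0) sequentially"
      using asymp_eqD(3)[OF v] by (simp add: dist VS \<open>v \<in> S\<close>)
    ultimately show "\<exists>x. limitin D.mtopology V x sequentially"
      using VS by (auto simp: D.limitin_metric_dist_null)
  qed
  show "cstar_algebra ?D"
  proof (intro cstar_algebra.intro cstar_algebra_axioms.intro moduleI)
    show "cring complex_ring" by (rule R.is_cring)
    show "abelian_group ?D" by (rule ab)
    show "Metric_space.mcomplete (carrier ?D) (cdist ?D)"
      using mcomplete by simp
  qed (auto simp: ops in_A scale_add_left scale_add_right scale_scale mult_assoc mult_l_distr
      mult_r_distr smult_mult_left smult_mult_right adj_add adj_smult adj_mult cnorm_eq_zero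
      cnorm_triangle cnorm_smult cnorm_mult cstar_identity)
qed

locale cstar_action = G: group G + B: cstar_algebra B
  for G :: "('g, 'z) monoid_scheme" and B :: "('b, 'y) cstar_scheme" +
  fixes \<beta> :: "'g \<Rightarrow> 'b \<Rightarrow> 'b"
  assumes finite_group: "finite (carrier G)"
    and act_hom: "g \<in> carrier G \<Longrightarrow> \<beta> g \<in> star_hom B B"
    and act_mult: "\<lbrakk>g \<in> carrier G; h \<in> carrier G; x \<in> carrier B\<rbrakk>
          \<Longrightarrow> \<beta> (g \<otimes>\<^bsub>G\<^esub> h) x = \<beta> g (\<beta> h x)"
    and act_one: "x \<in> carrier B \<Longrightarrow> \<beta> \<one>\<^bsub>G\<^esub> x = x"
begin

lemma act_cstar_hom: "g \<in> carrier G \<Longrightarrow> cstar_hom B B (\<beta> g)"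
  by (intro cstar_hom.intro cstar_hom_axioms.intro act_hom B.cstar_algebra_axioms)

lemma act_closed [simp, intro]: "g \<in> carrier G \<Longrightarrow> x \<in> carrier B \<Longrightarrow> \<beta> g x \<in> carrier B"
  using act_cstar_hom by (rule cstar_hom.hom_closed)

lemma act_inv [simp]: "g \<in> carrier G \<Longrightarrow> x \<in> carrier B \<Longrightarrow> \<beta> g (\<beta> (inv\<^bsub>G\<^esub> g) x) = x"
  "g \<in> carrier G \<Longrightarrow> x \<in> carrier B \<Longrightarrow> \<beta> (inv\<^bsub>G\<^esub> g) (\<beta> g x) = x"
  by (simp_all add: act_one flip: act_mult)

lemma card_pos: "card (carrier G) > 0"
  using finite_group G.one_closed by (auto simp: card_gt_0_iff)

lemma finsum_translate:
  assumes "h \<in> carrier G" "f \<in> carrier G \<rightarrow> carrier B"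
  shows "(\<Oplus>\<^bsub>B\<^esub>g\<in>carrier G. f (h \<otimes>\<^bsub>G\<^esub> g)) = (\<Oplus>\<^bsub>B\<^esub>g\<in>carrier G. f g)"
proof -
  have "(\<lambda>g. h \<otimes>\<^bsub>G\<^esub> g) ` carrier G = carrier G"
    using assms(1) by (rule G.surj_const_mult)
  moreover have "inj_on (\<lambda>g. h \<otimes>\<^bsub>G\<^esub> g) (carrier G)"
    using assms(1) by (rule G.inj_on_cmult)
  ultimately show ?thesis
    using B.M.finsum_reindex[of f "\<lambda>g. h \<otimes>\<^bsub>G\<^esub> g" "carrier G"] assms by simp
qed

lemma act_finsum:
  assumes "h \<in> carrier G" "x \<in> carrier G \<rightarrow> carrier B"
  shows "\<beta> h (\<Oplus>\<^bsub>B\<^esub>g\<in>carrier G. x g) = (\<Oplus>\<^bsub>B\<^esub>g\<in>carrier G. \<beta> h (x g))"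
  using B.finsum_additive_map[OF finite_group assms(2), of "\<beta> h"]
    cstar_hom.hom_add[OF act_cstar_hom] assms(1) by simp

abbreviation Fix :: "('b, 'y) cstar_scheme" where
  "Fix \<equiv> fixed_point_algebra G B \<beta>"

lemma carrier_Fix: "carrier Fix = {a \<in> carrier B. \<forall>g\<in>carrier G. \<beta> g a = a}"
  by (simp add: fixed_point_algebra_def)

lemma Fix_cstar_algebra: "cstar_algebra Fix"
  and Fix_minus: "x \<in> carrier Fix \<Longrightarrow> y \<in> carrier Fix \<Longrightarrow> x \<ominus>\<^bsub>Fix\<^esub> y = x \<ominus>\<^bsub>B\<^esub> y"
proof -
  let ?S = "{a \<in> carrier B. \<forall>g\<in>carrier G. \<beta> g a = a}"
  have lim: "v \<in> ?S" if V: "\<And>n. V n \<in> ?S" and lim: "asymp_eq B sequentially V (\<lambda>_. v)" for V v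
  proof -
    have "\<beta> g v = v" if "g \<in> carrier G" for g
    proof -
      have "(\<lambda>n. \<beta> g (V n)) = V" using V that by auto
      then show ?thesis
        using B.limit_unique[OF cstar_hom.hom_asymp_eq[OF act_cstar_hom[OF that] lim], of v] lim
        by simp
    qed
    then show ?thesis using B.asymp_eqD(2)[OF lim] by simp
  qed
  have zero: "\<zero>\<^bsub>B\<^esub> \<in> ?S" by (simp add: cstar_hom.hom_zero[OF act_cstar_hom])
  note sub = B.closed_subalgebra[of ?S, OF _ zero _ _ _ _ lim]
  show "cstar_algebra Fix"
    unfolding fixed_point_algebra_def
    by (rule sub(1)) (auto simp: star_homD[OF act_hom])
  show "x \<ominus>\<^bsub>Fix\<^esub> y = x \<ominus>\<^bsub>B\<^esub> y" if "x \<in> carrier Fix" "y \<in> carrier Fix"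
    using that unfolding fixed_point_algebra_def
    by (intro sub(2)) (auto simp: star_homD[OF act_hom])
qed

lemma Fix_circ: "circ Fix x y = circ B x y"
  by (simp add: circ_def fixed_point_algebra_def)

lemma Fix_quasi_unitary: "quasi_unitary Fix b \<longleftrightarrow> b \<in> carrier Fix \<and> quasi_unitary B b"
  unfolding quasi_unitary_def Fix_circ by (auto simp: fixed_point_algebra_def)

lemma Fix_asymp_eq:
  "asymp_eq Fix \<F> S T \<longleftrightarrow>
    (\<forall>i. S i \<in> carrier Fix) \<and> (\<forall>i. T i \<in> carrier Fix) \<and> asymp_eq B \<F> S T"
proof -
  have "cnorm Fix = cnorm B" by (simp add: fixed_point_algebra_def)
  then show ?thesis
    unfolding asymp_eq_def by (auto simp: Fix_minus) (auto simp: carrier_Fix)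
qed

text \<open>Averaging an asymptotically invariant family over the group moves it into the fixed point
  algebra, where the lifting takes place.\<close>

lemma lift_invariant_asymptotic_unitary:
  assumes c: "\<And>i. c i \<in> carrier B" and bounded: "\<And>i. cnorm B (c i) \<le> K"
    and left: "asymp_eq B \<F> (\<lambda>i. circ B (adj B (c i)) (c i)) (\<lambda>_. \<zero>\<^bsub>B\<^esub>)"
    and right: "asymp_eq B \<F> (\<lambda>i. circ B (c i) (adj B (c i))) (\<lambda>_. \<zero>\<^bsub>B\<^esub>)"
    and inv: "\<And>h. h \<in> carrier G \<Longrightarrow> asymp_eq B \<F> (\<lambda>i. \<beta> h (c i)) c"
  obtains u where "\<And>i. quasi_unitary Fix (u i)" "asymp_eq B \<F> u c"
proof -
  interpret D: cstar_algebra Fix by (rule Fix_cstar_algebra)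
  define n where "n = card (carrier G)"
  have n: "n > 0" using card_pos by (simp add: n_def)
  define d where "d i = (1 / of_nat n) \<odot>\<^bsub>B\<^esub> (\<Oplus>\<^bsub>B\<^esub>h\<in>carrier G. \<beta> h (c i))" for i
  have dB: "d i \<in> carrier B" for i
    using c by (auto simp: d_def intro!: B.M.finsum_closed)
  have d: "d i \<in> carrier Fix" for i
  proof -
    have "\<beta> g (d i) = d i" if g: "g \<in> carrier G" for g
    proof -
      have "\<beta> g (\<Oplus>\<^bsub>B\<^esub>h\<in>carrier G. \<beta> h (c i)) = (\<Oplus>\<^bsub>B\<^esub>h\<in>carrier G. \<beta> g (\<beta> h (c i)))"
        using c g by (intro act_finsum) auto
      also have "\<dots> = (\<Oplus>\<^bsub>B\<^esub>h\<in>carrier G. \<beta> (g \<otimes>\<^bsub>G\<^esub> h) (c i))"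
        using c g by (intro B.M.finsum_cong') (auto simp: act_mult)
      also have "\<dots> = (\<Oplus>\<^bsub>B\<^esub>h\<in>carrier G. \<beta> h (c i))"
        using c g finsum_translate[of g "\<lambda>h. \<beta> h (c i)"] by auto
      finally show ?thesis
        using c g by (simp add: d_def star_homD(3)[OF act_hom] B.M.finsum_closed Pi_iff)
    qed
    then show ?thesis using dB by (simp add: carrier_Fix)
  qed
  have dbound: "cnorm B (d i) \<le> 2 * K" for i
  proof -
    have "cnorm B (\<Oplus>\<^bsub>B\<^esub>h\<in>carrier G. \<beta> h (c i)) \<le> (\<Sum>h\<in>carrier G. cnorm B (\<beta> h (c i)))"
      using c by (intro B.cnorm_finsum[OF finite_group]) auto
    also have "\<dots> \<le> (\<Sum>h\<in>carrier G. 2 * K)"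
    proof (rule sum_mono)
      fix h assume "h \<in> carrier G"
      then show "cnorm B (\<beta> h (c i)) \<le> 2 * K"
        using cstar_hom.hom_bounded[OF act_cstar_hom c, of h i] bounded[of i] by simp
    qed
    also have "\<dots> = real n * (2 * K)" by (simp add: n_def)
    finally show ?thesis
      using n c by (simp add: d_def B.cnorm_smult B.M.finsum_closed Pi_iff norm_divide field_simps)
  qed
  have dc: "asymp_eq B \<F> d c"
  proof -
    have "asymp_eq B \<F> (\<lambda>i. \<Oplus>\<^bsub>B\<^esub>h\<in>carrier G. \<beta> h (c i)) (\<lambda>i. \<Oplus>\<^bsub>B\<^esub>h\<in>carrier G. c i)"
      using inv by (intro B.asymp_eq_finsum finite_group)
    then have "asymp_eq B \<F> d (\<lambda>i. (1 / of_nat n) \<odot>\<^bsub>B\<^esub> (\<Oplus>\<^bsub>B\<^esub>h\<in>carrier G. c i))"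
      unfolding d_def by (rule B.asymp_eq_scale)
    then show ?thesis
      using n c by (simp add: B.finsum_const_scale finite_group B.scale_scale flip: n_def)
  qed
  have adj: "asymp_eq B \<F> (\<lambda>i. adj B (d i)) (\<lambda>i. adj B (c i))"
    using dc by (rule B.asymp_eq_adj)
  have bounds: "cnorm B (adj B (d i)) \<le> 2 * K" "cnorm B (adj B (c i)) \<le> K" for i
    using dbound bounded dB c by auto
  have "\<exists>u. (\<forall>i. quasi_unitary Fix (u i)) \<and> asymp_eq Fix \<F> u d"
  proof (rule D.lift_asymptotic_unitary[of d "2 * K" \<F>])
    show "d i \<in> carrier Fix" "cnorm Fix (d i) \<le> 2 * K" for i
      using d dbound by (simp_all add: fixed_point_algebra_def)
    have Fix_simps: "adj Fix = adj B" "\<zero>\<^bsub>Fix\<^esub> = \<zero>\<^bsub>B\<^esub>" by (simp_all add: fixed_point_algebra_def)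
    have closed: "circ B (adj B (d i)) (d i) \<in> carrier Fix" "circ B (d i) (adj B (d i)) \<in> carrier Fix"
      "\<zero>\<^bsub>B\<^esub> \<in> carrier Fix" for i
      using D.circ_closed[OF D.adj_closed[OF d] d, of i] D.circ_closed[OF d D.adj_closed[OF d], of i]
        D.M.zero_closed unfolding Fix_circ Fix_simps by auto
    show "asymp_eq Fix \<F> (\<lambda>i. circ Fix (adj Fix (d i)) (d i)) (\<lambda>_. \<zero>\<^bsub>Fix\<^esub>)"
      unfolding Fix_asymp_eq Fix_circ Fix_simps
      using closed B.asymp_eq_trans[OF B.asymp_eq_circ[OF adj dc bounds(1) bounded] left] by blast
    show "asymp_eq Fix \<F> (\<lambda>i. circ Fix (d i) (adj Fix (d i))) (\<lambda>_. \<zero>\<^bsub>Fix\<^esub>)"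
      unfolding Fix_asymp_eq Fix_circ Fix_simps
      using closed B.asymp_eq_trans[OF B.asymp_eq_circ[OF dc adj dbound bounds(2)] right] by blast
  qed blast
  then obtain u where u: "\<And>i. quasi_unitary Fix (u i)" "asymp_eq Fix \<F> u d"
    by blast
  have "asymp_eq B \<F> u c"
    using u(2) B.asymp_eq_trans[OF _ dc] unfolding Fix_asymp_eq by blast
  then show thesis using that u(1) by blast
qed

end

section \<open>The Rokhlin property as an asymptotic averaging\<close>

text \<open>The families \<open>x : G \<rightarrow> B\<close> form a C*-algebra on which \<open>h\<close> acts by \<open>(h x)\<^sub>g = \<beta>\<^sub>h(x\<^bsub>h\<inverse>g\<^esub>)\<close>. The locale describes an
  asymptotic equivariant *-homomorphism \<open>P\<close> from this algebra to \<open>B\<close> that restricts to the identity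
  on constant families. This is the form in which the Rokhlin property is used.\<close>

locale rokhlin_averaging = cstar_action G B \<beta>
  for G :: "('g, 'z) monoid_scheme" and B :: "('b, 'y) cstar_scheme" and \<beta> +
  fixes \<F> :: "'i filter" and P :: "'i \<Rightarrow> ('g \<Rightarrow> 'b) \<Rightarrow> 'b"
  assumes proper: "\<F> \<noteq> bot"
    and P_cong: "\<lbrakk>\<And>g. g \<in> carrier G \<Longrightarrow> x g = y g; y \<in> carrier G \<rightarrow> carrier B\<rbrakk> \<Longrightarrow> P i x = P i y"
    and P_closed: "x \<in> carrier G \<rightarrow> carrier B \<Longrightarrow> P i x \<in> carrier B"
    and P_norm: "x \<in> carrier G \<rightarrow> carrier B \<Longrightarrow> cnorm B (P i x) \<le> (\<Sum>g\<in>carrier G. cnorm B (x g))"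
    and P_add: "\<lbrakk>x \<in> carrier G \<rightarrow> carrier B; y \<in> carrier G \<rightarrow> carrier B\<rbrakk>
          \<Longrightarrow> P i (\<lambda>g. x g \<oplus>\<^bsub>B\<^esub> y g) = P i x \<oplus>\<^bsub>B\<^esub> P i y"
    and P_mult: "\<lbrakk>x \<in> carrier G \<rightarrow> carrier B; y \<in> carrier G \<rightarrow> carrier B\<rbrakk>
          \<Longrightarrow> asymp_eq B \<F> (\<lambda>i. P i x \<otimes>\<^bsub>B\<^esub> P i y) (\<lambda>i. P i (\<lambda>g. x g \<otimes>\<^bsub>B\<^esub> y g))"
    and P_adj: "x \<in> carrier G \<rightarrow> carrier B
          \<Longrightarrow> asymp_eq B \<F> (\<lambda>i. adj B (P i x)) (\<lambda>i. P i (\<lambda>g. adj B (x g)))"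
    and P_const: "a \<in> carrier B \<Longrightarrow> asymp_eq B \<F> (\<lambda>i. P i (\<lambda>_. a)) (\<lambda>_. a)"
    and P_act: "\<lbrakk>h \<in> carrier G; x \<in> carrier G \<rightarrow> carrier B\<rbrakk>
          \<Longrightarrow> asymp_eq B \<F> (\<lambda>i. \<beta> h (P i x)) (\<lambda>i. P i (\<lambda>g. \<beta> h (x (inv\<^bsub>G\<^esub> h \<otimes>\<^bsub>G\<^esub> g))))"

text \<open>Indices are pairs of a finite set, on which the Rokhlin elements are to act well, and a precision.
  Along this filter a single family of Rokhlin elements treats every element of the algebra at
  once, without an enumeration of a dense subset.\<close>

definition rokhlin_filter :: "'b set \<Rightarrow> ('b set \<times> nat) filter" where
  "rokhlin_filter S = finite_subsets_at_top S \<times>\<^sub>F sequentially"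

lemma rokhlin_filter_proper: "rokhlin_filter S \<noteq> bot"
  by (simp add: rokhlin_filter_def prod_filter_eq_bot)

lemma rokhlin_filter_inverse_Suc:
  "((\<lambda>i. inverse (real (Suc (snd i)))) \<longlongrightarrow> 0) (rokhlin_filter S)"
  unfolding rokhlin_filter_def by (rule filterlim_compose[OF LIMSEQ_inverse_real_of_nat filterlim_snd])

lemma rokhlin_filter_mem:
  assumes "a \<in> S"
  shows "\<forall>\<^sub>F i in rokhlin_filter S. finite (fst i) \<and> fst i \<subseteq> S \<and> a \<in> fst i"
proof -
  have "\<forall>\<^sub>F M in finite_subsets_at_top S. finite M \<and> M \<subseteq> S \<and> a \<in> M"
    unfolding eventually_finite_subsets_at_top using assms
    by (intro exI[of _ "{a}"]) auto
  then show ?thesis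
    unfolding rokhlin_filter_def using filterlim_fst by (rule eventually_compose_filterlim)
qed

lemma (in cstar_algebra) positive_adj: "positive A x \<Longrightarrow> adj A x = x"
  by (auto simp: positive_def adj_mult)

text \<open>Rokhlin elements chosen for every index: all approximate relations become asymptotic ones.\<close>

locale rokhlin_family = cstar_action G B \<beta>
  for G :: "('g, 'z) monoid_scheme" and B :: "('b, 'y) cstar_scheme" and \<beta> +
  fixes \<F> :: "'i filter" and r :: "'i \<Rightarrow> 'g \<Rightarrow> 'b"
  assumes proper: "\<F> \<noteq> bot"
    and rc: "g \<in> carrier G \<Longrightarrow> r i g \<in> carrier B"
    and radj: "g \<in> carrier G \<Longrightarrow> adj B (r i g) = r i g"
    and rnorm: "g \<in> carrier G \<Longrightarrow> cnorm B (r i g) \<le> 1"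
    and orth: "\<lbrakk>g \<in> carrier G; h \<in> carrier G; g \<noteq> h\<rbrakk> \<Longrightarrow> r i g \<otimes>\<^bsub>B\<^esub> r i h = \<zero>\<^bsub>B\<^esub>"
    and ract: "\<lbrakk>g \<in> carrier G; h \<in> carrier G\<rbrakk>
          \<Longrightarrow> asymp_eq B \<F> (\<lambda>i. \<beta> g (r i h)) (\<lambda>i. r i (g \<otimes>\<^bsub>G\<^esub> h))"
    and comm: "\<lbrakk>g \<in> carrier G; a \<in> carrier B\<rbrakk>
          \<Longrightarrow> asymp_eq B \<F> (\<lambda>i. r i g \<otimes>\<^bsub>B\<^esub> a) (\<lambda>i. a \<otimes>\<^bsub>B\<^esub> r i g)"
    and unit: "a \<in> carrier B
          \<Longrightarrow> asymp_eq B \<F> (\<lambda>i. (\<Oplus>\<^bsub>B\<^esub>g\<in>carrier G. r i g) \<otimes>\<^bsub>B\<^esub> a) (\<lambda>_. a)"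

lemma (in cstar_action) rokhlin_family_exists:
  assumes "rokhlin_property G B \<beta>"
  obtains r where "rokhlin_family G B \<beta> (rokhlin_filter (carrier B)) r"
proof -
  define good where "good \<epsilon> M r \<longleftrightarrow>
           (\<forall>g\<in>carrier G. r g \<in> carrier B \<and> positive B (r g) \<and> cnorm B (r g) \<le> 1) \<and>
           (\<forall>g\<in>carrier G. \<forall>h\<in>carrier G. g \<noteq> h \<longrightarrow> r g \<otimes>\<^bsub>B\<^esub> r h = \<zero>\<^bsub>B\<^esub>) \<and>
           (\<forall>g\<in>carrier G. \<forall>h\<in>carrier G. cnorm B (\<beta> g (r h) \<ominus>\<^bsub>B\<^esub> r (g \<otimes>\<^bsub>G\<^esub> h)) < \<epsilon>) \<and>
           (\<forall>a\<in>M. \<forall>g\<in>carrier G. cnorm B (r g \<otimes>\<^bsub>B\<^esub> a \<ominus>\<^bsub>B\<^esub> a \<otimes>\<^bsub>B\<^esub> r g) < \<epsilon>) \<and>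
           (\<forall>a\<in>M. cnorm B ((\<Oplus>\<^bsub>B\<^esub>g\<in>carrier G. r g) \<otimes>\<^bsub>B\<^esub> a \<ominus>\<^bsub>B\<^esub> a) < \<epsilon>)"
    for \<epsilon> M and r :: "'g \<Rightarrow> 'b"
  have ex: "\<exists>r. good \<epsilon> M r" if "\<epsilon> > 0" "finite M" "M \<subseteq> carrier B" for \<epsilon> M
    using assms that unfolding rokhlin_property_def good_def by blast
  have "\<forall>i. \<exists>r. good (inverse (real (Suc (snd i))))
      (if finite (fst i) \<and> fst i \<subseteq> carrier B then fst i else {}) r"
    by (intro allI ex) auto
  then obtain r where r: "\<And>i. good (inverse (real (Suc (snd i))))
      (if finite (fst i) \<and> fst i \<subseteq> carrier B then fst i else {}) (r i)"
    by metis
  have small: "asymp_eq B (rokhlin_filter (carrier B)) S T"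
    if "\<And>i. S i \<in> carrier B" "\<And>i. T i \<in> carrier B" "a \<in> carrier B"
      and lt: "\<And>i. a \<in> fst i \<Longrightarrow> finite (fst i) \<and> fst i \<subseteq> carrier B
          \<Longrightarrow> cnorm B (S i \<ominus>\<^bsub>B\<^esub> T i) < inverse (real (Suc (snd i)))" for S T a
  proof -
    have "\<forall>\<^sub>F i in rokhlin_filter (carrier B).
        norm (cnorm B (S i \<ominus>\<^bsub>B\<^esub> T i)) \<le> inverse (real (Suc (snd i)))"
      using rokhlin_filter_mem[OF that(3)]
    proof eventually_elim
      case (elim i)
      then show ?case using lt[of i] that(1,2) by (simp add: less_imp_le)
    qed
    then have "((\<lambda>i. cnorm B (S i \<ominus>\<^bsub>B\<^esub> T i)) \<longlongrightarrow> 0) (rokhlin_filter (carrier B))"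
      using rokhlin_filter_inverse_Suc by (rule Lim_null_comparison)
    then show ?thesis using that by (simp add: asymp_eq_def)
  qed
  have basic: "r i g \<in> carrier B" "positive B (r i g)" "cnorm B (r i g) \<le> 1" if "g \<in> carrier G" for i g
    using r[of i] that by (simp_all add: good_def)
  have sum_closed: "(\<Oplus>\<^bsub>B\<^esub>g\<in>carrier G. r i g) \<in> carrier B" for i
    using basic by (intro B.M.finsum_closed) auto
  have "rokhlin_family G B \<beta> (rokhlin_filter (carrier B)) r"
  proof (intro rokhlin_family.intro rokhlin_family_axioms.intro cstar_action_axioms
      rokhlin_filter_proper)
    show "r i g \<otimes>\<^bsub>B\<^esub> r i h = \<zero>\<^bsub>B\<^esub>" if "g \<in> carrier G" "h \<in> carrier G" "g \<noteq> h" for i g h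
      using r[of i] that by (simp add: good_def)
    show "asymp_eq B (rokhlin_filter (carrier B)) (\<lambda>i. \<beta> g (r i h)) (\<lambda>i. r i (g \<otimes>\<^bsub>G\<^esub> h))"
      if "g \<in> carrier G" "h \<in> carrier G" for g h
      using r that by (intro small[of _ _ "\<zero>\<^bsub>B\<^esub>"]) (auto simp: basic good_def)
    show "asymp_eq B (rokhlin_filter (carrier B)) (\<lambda>i. r i g \<otimes>\<^bsub>B\<^esub> a) (\<lambda>i. a \<otimes>\<^bsub>B\<^esub> r i g)"
      if "g \<in> carrier G" "a \<in> carrier B" for g a
    proof (rule small[OF _ _ that(2)])
      fix i :: "'b set \<times> nat" assume "a \<in> fst i" "finite (fst i) \<and> fst i \<subseteq> carrier B"
      then show "cnorm B (r i g \<otimes>\<^bsub>B\<^esub> a \<ominus>\<^bsub>B\<^esub> a \<otimes>\<^bsub>B\<^esub> r i g) < inverse (real (Suc (snd i)))"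
        using r[of i] that by (simp add: good_def)
    qed (use basic that in auto)
    show "asymp_eq B (rokhlin_filter (carrier B)) (\<lambda>i. (\<Oplus>\<^bsub>B\<^esub>g\<in>carrier G. r i g) \<otimes>\<^bsub>B\<^esub> a) (\<lambda>_. a)"
      if "a \<in> carrier B" for a
    proof (rule small[OF _ _ that])
      fix i :: "'b set \<times> nat" assume "a \<in> fst i" "finite (fst i) \<and> fst i \<subseteq> carrier B"
      then show "cnorm B ((\<Oplus>\<^bsub>B\<^esub>g\<in>carrier G. r i g) \<otimes>\<^bsub>B\<^esub> a \<ominus>\<^bsub>B\<^esub> a) < inverse (real (Suc (snd i)))"
        using r[of i] by (simp add: good_def)
    qed (use sum_closed that in auto)
  qed (use basic B.positive_adj in auto)
  then show thesis by (rule that)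
qed

text \<open>In the limit the \<open>r\<^sub>g\<close> behave like central orthogonal projections with sum \<open>1\<close> that the action
  permutes, so \<open>x \<mapsto> \<Sum>\<^sub>g r\<^sub>g x\<^sub>g\<close> is a *-homomorphism in the limit.\<close>

lemma (in rokhlin_family) averaging:
  "rokhlin_averaging G B \<beta> \<F> (\<lambda>i x. \<Oplus>\<^bsub>B\<^esub>g\<in>carrier G. r i g \<otimes>\<^bsub>B\<^esub> x g)"
proof -
  let ?eq = "asymp_eq B \<F>"
  let ?G = "carrier G"
  define P where "P i x = (\<Oplus>\<^bsub>B\<^esub>g\<in>?G. r i g \<otimes>\<^bsub>B\<^esub> x g)" for i x
  have ldist: "(\<Oplus>\<^bsub>B\<^esub>g\<in>?G. x g) \<otimes>\<^bsub>B\<^esub> a = (\<Oplus>\<^bsub>B\<^esub>g\<in>?G. x g \<otimes>\<^bsub>B\<^esub> a)"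
    if "x \<in> ?G \<rightarrow> carrier B" "a \<in> carrier B" for x a
    using B.finsum_additive_map[OF finite_group that(1), of "\<lambda>b. b \<otimes>\<^bsub>B\<^esub> a"] that(2)
    by (simp add: B.mult_l_distr)
  have rdist: "a \<otimes>\<^bsub>B\<^esub> (\<Oplus>\<^bsub>B\<^esub>g\<in>?G. x g) = (\<Oplus>\<^bsub>B\<^esub>g\<in>?G. a \<otimes>\<^bsub>B\<^esub> x g)"
    if "x \<in> ?G \<rightarrow> carrier B" "a \<in> carrier B" for x a
    using B.finsum_additive_map[OF finite_group that(1), of "\<lambda>b. a \<otimes>\<^bsub>B\<^esub> b"] that(2)
    by (simp add: B.mult_r_distr)
  have terms: "(\<lambda>g. r i g \<otimes>\<^bsub>B\<^esub> x g) \<in> ?G \<rightarrow> carrier B" if "x \<in> ?G \<rightarrow> carrier B" for i x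
    using that rc by auto
  have Pc: "P i x \<in> carrier B" if "x \<in> ?G \<rightarrow> carrier B" for i x
    unfolding P_def using terms[OF that] by (rule B.M.finsum_closed)
  \<comment> \<open>Multiplying the approximate unit \<open>\<Sum>\<^sub>h r\<^sub>h\<close> by \<open>r\<^sub>g\<close> leaves \<open>r\<^sub>g\<^sup>2\<close>: the contractions \<open>r\<^sub>g\<close>
    are asymptotically projections.\<close>
  have idem: "?eq (\<lambda>i. r i g \<otimes>\<^bsub>B\<^esub> (r i g \<otimes>\<^bsub>B\<^esub> a)) (\<lambda>i. r i g \<otimes>\<^bsub>B\<^esub> a)"
    if g: "g \<in> ?G" and a: "a \<in> carrier B" for g a
  proof -
    have "r i g \<otimes>\<^bsub>B\<^esub> ((\<Oplus>\<^bsub>B\<^esub>h\<in>?G. r i h) \<otimes>\<^bsub>B\<^esub> a) = r i g \<otimes>\<^bsub>B\<^esub> (r i g \<otimes>\<^bsub>B\<^esub> a)" for i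
    proof -
      have "r i g \<otimes>\<^bsub>B\<^esub> ((\<Oplus>\<^bsub>B\<^esub>h\<in>?G. r i h) \<otimes>\<^bsub>B\<^esub> a) = (\<Oplus>\<^bsub>B\<^esub>h\<in>?G. r i g \<otimes>\<^bsub>B\<^esub> (r i h \<otimes>\<^bsub>B\<^esub> a))"
        using g a rc by (simp add: ldist rdist Pi_iff)
      also have "\<dots> = (\<Oplus>\<^bsub>B\<^esub>h\<in>?G. if g = h then r i h \<otimes>\<^bsub>B\<^esub> (r i h \<otimes>\<^bsub>B\<^esub> a) else \<zero>\<^bsub>B\<^esub>)"
        using g a rc orth by (intro B.M.finsum_cong') (auto simp flip: B.mult_assoc)
      also have "\<dots> = r i g \<otimes>\<^bsub>B\<^esub> (r i g \<otimes>\<^bsub>B\<^esub> a)"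
        using g a rc finite_group by (intro B.M.finsum_singleton) auto
      finally show ?thesis .
    qed
    moreover have "?eq (\<lambda>i. r i g \<otimes>\<^bsub>B\<^esub> ((\<Oplus>\<^bsub>B\<^esub>h\<in>?G. r i h) \<otimes>\<^bsub>B\<^esub> a)) (\<lambda>i. r i g \<otimes>\<^bsub>B\<^esub> a)"
      using unit[OF a] rc[OF g] rnorm[OF g] by (rule B.asymp_eq_mult_left)
    ultimately show ?thesis by simp
  qed
  have "rokhlin_averaging G B \<beta> \<F> P"
  proof (intro rokhlin_averaging.intro rokhlin_averaging_axioms.intro)
    show "cstar_action G B \<beta>" by (rule cstar_action_axioms)
    show "\<F> \<noteq> bot" by (rule proper)
    show "P i x \<in> carrier B" if "x \<in> ?G \<rightarrow> carrier B" for i x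
      using Pc[OF that] .
    show "cnorm B (P i x) \<le> (\<Sum>g\<in>?G. cnorm B (x g))" if x: "x \<in> ?G \<rightarrow> carrier B" for i x
    proof -
      have "cnorm B (P i x) \<le> (\<Sum>g\<in>?G. cnorm B (r i g \<otimes>\<^bsub>B\<^esub> x g))"
        unfolding P_def using finite_group terms[OF x] by (rule B.cnorm_finsum)
      also have "\<dots> \<le> (\<Sum>g\<in>?G. cnorm B (x g))"
      proof (rule sum_mono)
        fix g assume g: "g \<in> ?G"
        have "x g \<in> carrier B" using g x by auto
        then show "cnorm B (r i g \<otimes>\<^bsub>B\<^esub> x g) \<le> cnorm B (x g)"
          using B.cnorm_mult_le[of "r i g" "x g" 1 "cnorm B (x g)"] g rc rnorm by simp
      qed
      finally show ?thesis .
    qed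
    show "P i (\<lambda>g. x g \<oplus>\<^bsub>B\<^esub> y g) = P i x \<oplus>\<^bsub>B\<^esub> P i y"
      if x: "x \<in> ?G \<rightarrow> carrier B" and y: "y \<in> ?G \<rightarrow> carrier B" for i x y
    proof -
      have "P i x \<oplus>\<^bsub>B\<^esub> P i y = (\<Oplus>\<^bsub>B\<^esub>g\<in>?G. r i g \<otimes>\<^bsub>B\<^esub> x g \<oplus>\<^bsub>B\<^esub> r i g \<otimes>\<^bsub>B\<^esub> y g)"
        unfolding P_def using terms[OF x] terms[OF y] by (simp add: B.M.finsum_addf)
      also have "\<dots> = P i (\<lambda>g. x g \<oplus>\<^bsub>B\<^esub> y g)"
        unfolding P_def using x y rc by (intro B.M.finsum_cong') (auto simp: B.mult_r_distr Pi_iff)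
      finally show ?thesis ..
    qed
    show "?eq (\<lambda>i. P i x \<otimes>\<^bsub>B\<^esub> P i y) (\<lambda>i. P i (\<lambda>g. x g \<otimes>\<^bsub>B\<^esub> y g))"
      if x: "x \<in> ?G \<rightarrow> carrier B" and y: "y \<in> ?G \<rightarrow> carrier B" for x y
    proof -
      have xc: "x g \<in> carrier B" and yc: "y g \<in> carrier B" if "g \<in> ?G" for g
        using x y that by auto
      have entry: "?eq (\<lambda>i. r i g \<otimes>\<^bsub>B\<^esub> x g \<otimes>\<^bsub>B\<^esub> (r i h \<otimes>\<^bsub>B\<^esub> y h))
          (\<lambda>i. if g = h then r i h \<otimes>\<^bsub>B\<^esub> (x h \<otimes>\<^bsub>B\<^esub> y h) else \<zero>\<^bsub>B\<^esub>)"
        if g: "g \<in> ?G" and h: "h \<in> ?G" for g h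
      proof -
        have "?eq (\<lambda>i. x g \<otimes>\<^bsub>B\<^esub> r i h \<otimes>\<^bsub>B\<^esub> y h) (\<lambda>i. r i h \<otimes>\<^bsub>B\<^esub> x g \<otimes>\<^bsub>B\<^esub> y h)"
          by (rule B.asymp_eq_mult_right[OF B.asymp_eq_sym[OF comm[OF h xc[OF g]]]])
            (use yc[OF h] in auto)
        then have "?eq (\<lambda>i. r i g \<otimes>\<^bsub>B\<^esub> (x g \<otimes>\<^bsub>B\<^esub> r i h \<otimes>\<^bsub>B\<^esub> y h))
            (\<lambda>i. r i g \<otimes>\<^bsub>B\<^esub> (r i h \<otimes>\<^bsub>B\<^esub> x g \<otimes>\<^bsub>B\<^esub> y h))"
          using rc[OF g] rnorm[OF g] by (rule B.asymp_eq_mult_left)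
        moreover have "r i g \<otimes>\<^bsub>B\<^esub> (x g \<otimes>\<^bsub>B\<^esub> r i h \<otimes>\<^bsub>B\<^esub> y h) = r i g \<otimes>\<^bsub>B\<^esub> x g \<otimes>\<^bsub>B\<^esub> (r i h \<otimes>\<^bsub>B\<^esub> y h)"
          "r i g \<otimes>\<^bsub>B\<^esub> (r i h \<otimes>\<^bsub>B\<^esub> x g \<otimes>\<^bsub>B\<^esub> y h) = r i g \<otimes>\<^bsub>B\<^esub> r i h \<otimes>\<^bsub>B\<^esub> (x g \<otimes>\<^bsub>B\<^esub> y h)" for i
          using g h rc xc yc by (simp_all add: B.mult_assoc)
        ultimately have swap: "?eq (\<lambda>i. r i g \<otimes>\<^bsub>B\<^esub> x g \<otimes>\<^bsub>B\<^esub> (r i h \<otimes>\<^bsub>B\<^esub> y h))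
            (\<lambda>i. r i g \<otimes>\<^bsub>B\<^esub> r i h \<otimes>\<^bsub>B\<^esub> (x g \<otimes>\<^bsub>B\<^esub> y h))" by simp
        show ?thesis
        proof (cases "g = h")
          case True
          have "?eq (\<lambda>i. r i g \<otimes>\<^bsub>B\<^esub> r i h \<otimes>\<^bsub>B\<^esub> (x g \<otimes>\<^bsub>B\<^esub> y h)) (\<lambda>i. r i h \<otimes>\<^bsub>B\<^esub> (x h \<otimes>\<^bsub>B\<^esub> y h))"
            using idem[OF h, of "x h \<otimes>\<^bsub>B\<^esub> y h"] True h rc xc yc by (simp add: B.mult_assoc)
          then show ?thesis using B.asymp_eq_trans[OF swap] True by simp
        next
          case False
          then have "r i g \<otimes>\<^bsub>B\<^esub> r i h \<otimes>\<^bsub>B\<^esub> (x g \<otimes>\<^bsub>B\<^esub> y h) = \<zero>\<^bsub>B\<^esub>" for i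
            using orth[OF g h] xc[OF g] yc[OF h] by simp
          then show ?thesis using swap False by simp
        qed
      qed
      have "?eq (\<lambda>i. \<Oplus>\<^bsub>B\<^esub>g\<in>?G. \<Oplus>\<^bsub>B\<^esub>h\<in>?G. r i g \<otimes>\<^bsub>B\<^esub> x g \<otimes>\<^bsub>B\<^esub> (r i h \<otimes>\<^bsub>B\<^esub> y h))
        (\<lambda>i. \<Oplus>\<^bsub>B\<^esub>g\<in>?G. \<Oplus>\<^bsub>B\<^esub>h\<in>?G. if g = h then r i h \<otimes>\<^bsub>B\<^esub> (x h \<otimes>\<^bsub>B\<^esub> y h) else \<zero>\<^bsub>B\<^esub>)"
        using entry by (intro B.asymp_eq_finsum finite_group)
      moreover have "(\<Oplus>\<^bsub>B\<^esub>g\<in>?G. \<Oplus>\<^bsub>B\<^esub>h\<in>?G. r i g \<otimes>\<^bsub>B\<^esub> x g \<otimes>\<^bsub>B\<^esub> (r i h \<otimes>\<^bsub>B\<^esub> y h)) = P i x \<otimes>\<^bsub>B\<^esub> P i y" for i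
      proof -
        have "P i x \<otimes>\<^bsub>B\<^esub> P i y = (\<Oplus>\<^bsub>B\<^esub>g\<in>?G. r i g \<otimes>\<^bsub>B\<^esub> x g \<otimes>\<^bsub>B\<^esub> P i y)"
          using ldist[OF terms[OF x] Pc[OF y]] by (simp add: P_def)
        also have "\<dots> = (\<Oplus>\<^bsub>B\<^esub>g\<in>?G. \<Oplus>\<^bsub>B\<^esub>h\<in>?G. r i g \<otimes>\<^bsub>B\<^esub> x g \<otimes>\<^bsub>B\<^esub> (r i h \<otimes>\<^bsub>B\<^esub> y h))"
          using rdist[OF terms[OF y]] rc xc yc
          by (intro B.M.finsum_cong') (auto simp: P_def intro!: B.M.finsum_closed)
        finally show ?thesis ..
      qed
      moreover have "(\<Oplus>\<^bsub>B\<^esub>g\<in>?G. \<Oplus>\<^bsub>B\<^esub>h\<in>?G. if g = h then r i h \<otimes>\<^bsub>B\<^esub> (x h \<otimes>\<^bsub>B\<^esub> y h) else \<zero>\<^bsub>B\<^esub>)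
          = P i (\<lambda>g. x g \<otimes>\<^bsub>B\<^esub> y g)" for i
      proof -
        have "(\<Oplus>\<^bsub>B\<^esub>h\<in>?G. if g = h then r i h \<otimes>\<^bsub>B\<^esub> (x h \<otimes>\<^bsub>B\<^esub> y h) else \<zero>\<^bsub>B\<^esub>)
            = r i g \<otimes>\<^bsub>B\<^esub> (x g \<otimes>\<^bsub>B\<^esub> y g)" if "g \<in> ?G" for g
          using that rc xc yc finite_group by (intro B.M.finsum_singleton) auto
        then show ?thesis
          unfolding P_def using rc xc yc by (intro B.M.finsum_cong') auto
      qed
      ultimately show ?thesis by simp
    qed
    show "?eq (\<lambda>i. adj B (P i x)) (\<lambda>i. P i (\<lambda>g. adj B (x g)))" if x: "x \<in> ?G \<rightarrow> carrier B" for x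
    proof -
      have "adj B (P i x) = (\<Oplus>\<^bsub>B\<^esub>g\<in>?G. adj B (x g) \<otimes>\<^bsub>B\<^esub> r i g)" for i
      proof -
        have "adj B (P i x) = (\<Oplus>\<^bsub>B\<^esub>g\<in>?G. adj B (r i g \<otimes>\<^bsub>B\<^esub> x g))"
          unfolding P_def using terms[OF x]
          by (intro B.finsum_additive_map finite_group) (auto simp: B.adj_add)
        also have "\<dots> = (\<Oplus>\<^bsub>B\<^esub>g\<in>?G. adj B (x g) \<otimes>\<^bsub>B\<^esub> r i g)"
          using x rc radj by (intro B.M.finsum_cong') (auto simp: B.adj_mult Pi_iff)
        finally show ?thesis .
      qed
      moreover have "?eq (\<lambda>i. \<Oplus>\<^bsub>B\<^esub>g\<in>?G. adj B (x g) \<otimes>\<^bsub>B\<^esub> r i g) (\<lambda>i. \<Oplus>\<^bsub>B\<^esub>g\<in>?G. r i g \<otimes>\<^bsub>B\<^esub> adj B (x g))"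
        using x by (intro B.asymp_eq_finsum finite_group B.asymp_eq_sym[OF comm]) auto
      ultimately show ?thesis unfolding P_def by simp
    qed
    show "?eq (\<lambda>i. P i (\<lambda>_. a)) (\<lambda>_. a)" if a: "a \<in> carrier B" for a
      using unit[OF a] ldist[of "r _", OF _ a] rc a by (simp add: P_def Pi_iff)
    show "?eq (\<lambda>i. \<beta> h (P i x)) (\<lambda>i. P i (\<lambda>g. \<beta> h (x (inv\<^bsub>G\<^esub> h \<otimes>\<^bsub>G\<^esub> g))))"
      if h: "h \<in> ?G" and x: "x \<in> ?G \<rightarrow> carrier B" for h x
    proof -
      have xc: "x g \<in> carrier B" if "g \<in> ?G" for g using x that by auto
      have "\<beta> h (P i x) = (\<Oplus>\<^bsub>B\<^esub>g\<in>?G. \<beta> h (r i g) \<otimes>\<^bsub>B\<^esub> \<beta> h (x g))" for i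
      proof -
        have "\<beta> h (P i x) = (\<Oplus>\<^bsub>B\<^esub>g\<in>?G. \<beta> h (r i g \<otimes>\<^bsub>B\<^esub> x g))"
          unfolding P_def using h terms[OF x] by (rule act_finsum)
        also have "\<dots> = (\<Oplus>\<^bsub>B\<^esub>g\<in>?G. \<beta> h (r i g) \<otimes>\<^bsub>B\<^esub> \<beta> h (x g))"
          using h xc rc by (intro B.M.finsum_cong') (auto simp: star_homD(4)[OF act_hom])
        finally show ?thesis .
      qed
      moreover have "?eq (\<lambda>i. \<Oplus>\<^bsub>B\<^esub>g\<in>?G. \<beta> h (r i g) \<otimes>\<^bsub>B\<^esub> \<beta> h (x g))
          (\<lambda>i. \<Oplus>\<^bsub>B\<^esub>g\<in>?G. r i (h \<otimes>\<^bsub>G\<^esub> g) \<otimes>\<^bsub>B\<^esub> \<beta> h (x g))"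
        using h xc by (intro B.asymp_eq_finsum finite_group B.asymp_eq_mult_right[OF ract]) auto
      moreover have "(\<Oplus>\<^bsub>B\<^esub>g\<in>?G. r i (h \<otimes>\<^bsub>G\<^esub> g) \<otimes>\<^bsub>B\<^esub> \<beta> h (x g))
          = P i (\<lambda>g. \<beta> h (x (inv\<^bsub>G\<^esub> h \<otimes>\<^bsub>G\<^esub> g)))" for i
      proof -
        have cancel: "inv\<^bsub>G\<^esub> h \<otimes>\<^bsub>G\<^esub> (h \<otimes>\<^bsub>G\<^esub> g) = g" if "g \<in> ?G" for g
          using h that by (simp flip: G.m_assoc)
        have "P i (\<lambda>g. \<beta> h (x (inv\<^bsub>G\<^esub> h \<otimes>\<^bsub>G\<^esub> g)))
            = (\<Oplus>\<^bsub>B\<^esub>g\<in>?G. r i (h \<otimes>\<^bsub>G\<^esub> g) \<otimes>\<^bsub>B\<^esub> \<beta> h (x (inv\<^bsub>G\<^esub> h \<otimes>\<^bsub>G\<^esub> (h \<otimes>\<^bsub>G\<^esub> g))))"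
          unfolding P_def using h xc rc
          by (intro finsum_translate[symmetric, of h "\<lambda>g. r i g \<otimes>\<^bsub>B\<^esub> \<beta> h (x (inv\<^bsub>G\<^esub> h \<otimes>\<^bsub>G\<^esub> g))"]) auto
        also have "\<dots> = (\<Oplus>\<^bsub>B\<^esub>g\<in>?G. r i (h \<otimes>\<^bsub>G\<^esub> g) \<otimes>\<^bsub>B\<^esub> \<beta> h (x g))"
          using h xc rc cancel by (intro B.M.finsum_cong') auto
        finally show ?thesis ..
      qed
      ultimately show ?thesis by simp
    qed
    show "P i x = P i y" if "\<And>g. g \<in> ?G \<Longrightarrow> x g = y g" "y \<in> ?G \<rightarrow> carrier B" for i x y
      unfolding P_def using that terms by (intro B.M.finsum_cong') auto
  qed
  then show ?thesis unfolding P_def .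
qed

lemma (in cstar_action) rokhlin_averaging_exists:
  assumes "rokhlin_property G B \<beta>"
  obtains P where "rokhlin_averaging G B \<beta> (rokhlin_filter (carrier B)) P"
proof -
  obtain r where "rokhlin_family G B \<beta> (rokhlin_filter (carrier B)) r"
    using rokhlin_family_exists[OF assms] .
  then show thesis using rokhlin_family.averaging that by blast
qed

section \<open>Conjugation by unitaries of the unitization\<close>

definition conj_by :: "('a, 'z) cstar_scheme \<Rightarrow> 'a \<Rightarrow> 'a \<Rightarrow> 'a" where
  "conj_by A b y = (y \<oplus>\<^bsub>A\<^esub> adj A b \<otimes>\<^bsub>A\<^esub> y) \<oplus>\<^bsub>A\<^esub> (y \<oplus>\<^bsub>A\<^esub> adj A b \<otimes>\<^bsub>A\<^esub> y) \<otimes>\<^bsub>A\<^esub> b"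

context cstar_algebra begin

lemma quasi_unitary_closed: "quasi_unitary A b \<Longrightarrow> b \<in> carrier A"
  by (simp add: quasi_unitary_def)

lemma conj_by_closed [simp, intro]:
  "b \<in> carrier A \<Longrightarrow> y \<in> carrier A \<Longrightarrow> conj_by A b y \<in> carrier A"
  by (simp add: conj_by_def)

text \<open>Multiplying by the unitary \<open>1 + b\<close> turns closeness to a conjugate into approximate
  intertwining, which is linear in \<open>b\<close>.\<close>

lemma cnorm_diff_conj_by:
  assumes b: "quasi_unitary A b" and p: "p \<in> carrier A" and y: "y \<in> carrier A"
  shows "cnorm A (p \<ominus> conj_by A b y) = cnorm A ((p \<oplus> b \<otimes> p) \<ominus> (y \<oplus> y \<otimes> b))"
proof -
  note bc = quasi_unitary_closed[OF b]
  let ?d = "p \<ominus> conj_by A b y"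
  define q where "q = y \<oplus> y \<otimes> b"
  have q: "q \<in> carrier A" using y bc by (simp add: q_def)
  have conj: "conj_by A b y = q \<oplus> adj A b \<otimes> q"
    unfolding conj_by_def q_def using y bc by algebra
  have "?d \<oplus> b \<otimes> ?d = (p \<oplus> b \<otimes> p) \<ominus> q \<ominus> circ A b (adj A b) \<otimes> q"
    unfolding conj circ_def using p q bc by algebra
  then have "?d \<oplus> b \<otimes> ?d = (p \<oplus> b \<otimes> p) \<ominus> (y \<oplus> y \<otimes> b) \<ominus> circ A b (adj A b) \<otimes> (y \<oplus> y \<otimes> b)"
    unfolding q_def .
  also have "\<dots> = (p \<oplus> b \<otimes> p) \<ominus> (y \<oplus> y \<otimes> b)"
    using b p y bc by (simp add: quasi_unitary_def M.minus_eq minus_zero_eq)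
  finally show ?thesis
    using quasi_unitary_isometry[OF b, of ?d] p y bc by simp
qed

text \<open>In \<open>(1 + b\<^sup>*) y (1 + b) (1 + b\<^sup>*) z (1 + b)\<close> the two middle factors cancel.\<close>

lemma conj_by_mult:
  assumes b: "quasi_unitary A b" and y: "y \<in> carrier A" and z: "z \<in> carrier A"
  shows "conj_by A b (y \<otimes> z) = conj_by A b y \<otimes> conj_by A b z"
proof -
  note bc = quasi_unitary_closed[OF b]
  define p q where "p = y \<oplus> adj A b \<otimes> y" and "q = z \<oplus> z \<otimes> b"
  have pq: "p \<in> carrier A" "q \<in> carrier A" using y z bc by (simp_all add: p_def q_def)
  have conj: "conj_by A b y = p \<oplus> p \<otimes> b" "conj_by A b z = q \<oplus> adj A b \<otimes> q"
    unfolding conj_by_def p_def q_def using y z bc by algebra+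
  have "conj_by A b y \<otimes> conj_by A b z = p \<otimes> q \<oplus> p \<otimes> circ A b (adj A b) \<otimes> q"
    unfolding conj circ_def using pq bc by algebra
  also have "\<dots> = p \<otimes> q" using b pq by (simp add: quasi_unitary_def)
  also have "\<dots> = conj_by A b (y \<otimes> z)"
    unfolding conj_by_def p_def q_def using y z bc by algebra
  finally show ?thesis ..
qed

lemma conj_by_hom:
  assumes "cstar_algebra C" and \<phi>: "\<phi> \<in> star_hom C A" and b: "quasi_unitary A b"
  shows "(\<lambda>a\<in>carrier C. conj_by A b (\<phi> a)) \<in> star_hom C A"
proof -
  interpret C: cstar_algebra C by fact
  note bc = quasi_unitary_closed[OF b] and hom = star_homD[OF \<phi>]
  have add: "conj_by A b (y \<oplus> z) = conj_by A b y \<oplus> conj_by A b z"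
    if "y \<in> carrier A" "z \<in> carrier A" for y z
    unfolding conj_by_def using that bc by algebra
  have scale: "conj_by A b (c \<odot> y) = c \<odot> conj_by A b y" if "y \<in> carrier A" for c y
    using that bc
    by (simp add: conj_by_def mult_l_distr scale_add_right smult_mult_left smult_mult_right)
  have star: "conj_by A b (adj A y) = adj A (conj_by A b y)" if "y \<in> carrier A" for y
    unfolding conj_by_def using that bc by algebra
  show ?thesis
    unfolding star_hom_def
    using bc by (auto simp: hom add scale star conj_by_mult[OF b])
qed

lemma unitization_abelian_group: "abelian_group (unitization A)"
proof (rule abelian_groupI)
  fix x assume "x \<in> carrier (unitization A)"
  then obtain c a where x: "x = (c, a)" "a \<in> carrier A" by (auto simp: unitization_def)
  then show "\<exists>y\<in>carrier (unitization A). y \<oplus>\<^bsub>unitization A\<^esub> x = \<zero>\<^bsub>unitization A\<^esub>"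
    by (intro bexI[of _ "(- c, \<ominus> a)"]) (auto simp: unitization_def M.l_neg)
qed (auto simp: unitization_def M.a_assoc intro: M.a_comm)

lemma unitization_diff_emb:
  assumes "x \<in> carrier A" "y \<in> carrier A"
  shows "unitization_emb x \<ominus>\<^bsub>unitization A\<^esub> unitization_emb y = unitization_emb (x \<ominus> y)"
proof -
  have "\<ominus>\<^bsub>unitization A\<^esub> unitization_emb y = unitization_emb (\<ominus> y)"
    using assms
    by (intro abelian_group.minus_equality[OF unitization_abelian_group])
      (auto simp: unitization_def unitization_emb_def M.l_neg)
  then show ?thesis
    by (simp add: a_minus_def) (simp add: unitization_def unitization_emb_def)
qed

text \<open>The supremum that defines the norm of the unitization is attained at \<open>x\<^sup>*/\<parallel>x\<parallel>\<close>.\<close>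

lemma cnorm_unitization_emb:
  assumes x: "x \<in> carrier A" shows "cnorm (unitization A) (unitization_emb x) = cnorm A x"
proof -
  let ?S = "{b \<in> carrier A. cnorm A b \<le> 1}"
  have le: "cnorm A (x \<otimes> b) \<le> cnorm A x" if "b \<in> ?S" for b
    using cnorm_mult_le[OF x, of b "cnorm A x" 1] that by simp
  have "(SUP b\<in>?S. cnorm A (x \<otimes> b)) = cnorm A x"
  proof (cases "cnorm A x = 0")
    case True
    then have "x = \<zero>" using x cnorm_eq_zero by simp
    moreover have "?S \<noteq> {}" by (auto intro!: exI[of _ \<zero>])
    ultimately show ?thesis by (simp cong: SUP_cong_simp)
  next
    case False
    then have n: "cnorm A x > 0" using cnorm_nonneg[OF x] by linarith
    let ?b = "of_real (1 / cnorm A x) \<odot> adj A x"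
    have b: "?b \<in> ?S" using x n by (simp add: cnorm_smult norm_divide)
    have "x \<otimes> ?b = of_real (1 / cnorm A x) \<odot> (x \<otimes> adj A x)"
      using x by (simp add: smult_mult_right)
    moreover have "cnorm A (x \<otimes> adj A x) = (cnorm A x)\<^sup>2"
      using cstar_identity[of "adj A x"] x by simp
    ultimately have "cnorm A (x \<otimes> ?b) = cnorm A x"
      using x n by (simp add: cnorm_smult norm_divide power2_eq_square)
    then show ?thesis
      using b le by (intro cSup_eq_maximum) (auto intro: rev_image_eqI)
  qed
  moreover have "(SUP b\<in>?S. cnorm A (0 \<odot> b \<oplus> x \<otimes> b)) = (SUP b\<in>?S. cnorm A (x \<otimes> b))"
    using x by (intro SUP_cong) auto
  ultimately show ?thesis
    using x by (simp add: unitization_def unitization_emb_def)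
qed

end

text \<open>A unitary of the unitization is a scalar of modulus one times some \<open>1 + b\<close>, and the scalar
  does not affect conjugation.\<close>

lemma approx_equiv_by_iff:
  assumes S: "S \<subseteq> carrier B" and D: "D = B\<lparr>carrier := S\<rparr>" "cstar_algebra D" and "cstar_algebra B"
    and \<phi>: "\<phi> \<in> carrier C \<rightarrow> carrier B" and \<psi>: "\<psi> \<in> carrier C \<rightarrow> carrier B"
  shows "approx_equiv_by D C B \<phi> \<psi> \<longleftrightarrow> (\<forall>M \<epsilon>. \<epsilon> > 0 \<and> finite M \<and> M \<subseteq> carrier C \<longrightarrow>
    (\<exists>b. quasi_unitary D b \<and> (\<forall>a\<in>M. cnorm B (\<phi> a \<ominus>\<^bsub>B\<^esub> conj_by B b (\<psi> a)) < \<epsilon>)))"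
proof -
  interpret D: cstar_algebra D by fact
  interpret B: cstar_algebra B by fact
  let ?U = "unitization B"
  let ?V = "unitization D"
  have S_B: "x \<in> carrier B" if "x \<in> S" for x using that S by blast
  have qu_D: "quasi_unitary D b \<longleftrightarrow> b \<in> S \<and> quasi_unitary B b" for b
    using S by (auto simp: quasi_unitary_def circ_def D)
  have conj: "adj ?U (c, x) \<otimes>\<^bsub>?U\<^esub> unitization_emb y \<otimes>\<^bsub>?U\<^esub> (c, x)
      = unitization_emb (conj_by B (cnj c \<odot>\<^bsub>B\<^esub> x) y)"
    if "cnj c * c = 1" "x \<in> carrier B" "y \<in> carrier B" for c x y
    using that B.M.a_comm[of "c \<odot>\<^bsub>B\<^esub> (adj B x \<otimes>\<^bsub>B\<^esub> y)"]
    by (simp add: unitization_def unitization_emb_def conj_by_def B.adj_smult B.smult_mult_left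
        B.smult_mult_right B.scale_add_right B.scale_scale B.mult_l_distr mult.commute)
  have emb: "cnorm ?U (unitization_emb (\<phi> a) \<ominus>\<^bsub>?U\<^esub> adj ?U (c, x) \<otimes>\<^bsub>?U\<^esub> unitization_emb (\<psi> a) \<otimes>\<^bsub>?U\<^esub> (c, x))
      = cnorm B (\<phi> a \<ominus>\<^bsub>B\<^esub> conj_by B (cnj c \<odot>\<^bsub>B\<^esub> x) (\<psi> a))"
    if "cnj c * c = 1" "x \<in> S" "a \<in> carrier C" for c x a
  proof -
    have "\<phi> a \<in> carrier B" "\<psi> a \<in> carrier B" "x \<in> carrier B" using that \<phi> \<psi> S by auto
    then show ?thesis
      using that(1) by (simp add: conj B.unitization_diff_emb B.cnorm_unitization_emb)
  qed
  have to_quasi: "cnj c * c = 1 \<and> x \<in> S \<and> quasi_unitary D (cnj c \<odot>\<^bsub>B\<^esub> x)"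
    if "(c, x) \<in> unitaries ?V" for c x
  proof -
    have x: "x \<in> S" and c: "cnj c * c = 1"
      and l: "cnj c \<odot>\<^bsub>B\<^esub> x \<oplus>\<^bsub>B\<^esub> c \<odot>\<^bsub>B\<^esub> adj B x \<oplus>\<^bsub>B\<^esub> adj B x \<otimes>\<^bsub>B\<^esub> x = \<zero>\<^bsub>B\<^esub>"
      and r: "c \<odot>\<^bsub>B\<^esub> adj B x \<oplus>\<^bsub>B\<^esub> cnj c \<odot>\<^bsub>B\<^esub> x \<oplus>\<^bsub>B\<^esub> x \<otimes>\<^bsub>B\<^esub> adj B x = \<zero>\<^bsub>B\<^esub>"
      using that by (simp_all add: unitaries_def unitization_def D)
    have "cnj c \<odot>\<^bsub>B\<^esub> x \<in> S" using x D.scale_closed[of x "cnj c"] by (simp add: D)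
    moreover have "circ B (adj B (cnj c \<odot>\<^bsub>B\<^esub> x)) (cnj c \<odot>\<^bsub>B\<^esub> x) = \<zero>\<^bsub>B\<^esub>"
      "circ B (cnj c \<odot>\<^bsub>B\<^esub> x) (adj B (cnj c \<odot>\<^bsub>B\<^esub> x)) = \<zero>\<^bsub>B\<^esub>"
      using l r c S_B[OF x] B.M.a_comm[of "c \<odot>\<^bsub>B\<^esub> adj B x" "cnj c \<odot>\<^bsub>B\<^esub> x"]
      by (simp_all add: circ_def B.adj_smult B.smult_mult_left B.smult_mult_right B.scale_scale
          mult.commute)
    ultimately show ?thesis using x c S_B unfolding qu_D unfolding quasi_unitary_def by simp
  qed
  have from_quasi: "(1, b) \<in> unitaries ?V \<and> b \<in> S" if "quasi_unitary D b" for b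
  proof -
    have b: "b \<in> S" "b \<in> carrier B" "circ B (adj B b) b = \<zero>\<^bsub>B\<^esub>" "circ B b (adj B b) = \<zero>\<^bsub>B\<^esub>"
      using that unfolding qu_D unfolding quasi_unitary_def by simp_all
    have "adj B b \<in> S" using D.adj_closed[of b] b by (simp add: D)
    then show ?thesis
      using b B.M.a_comm[of "adj B b" b] by (simp add: unitaries_def unitization_def D circ_def)
  qed
  have "(\<exists>u\<in>unitaries ?V. \<forall>a\<in>M. cnorm ?U (unitization_emb (\<phi> a) \<ominus>\<^bsub>?U\<^esub>
            adj ?U u \<otimes>\<^bsub>?U\<^esub> unitization_emb (\<psi> a) \<otimes>\<^bsub>?U\<^esub> u) < \<epsilon>)
    \<longleftrightarrow> (\<exists>b. quasi_unitary D b \<and> (\<forall>a\<in>M. cnorm B (\<phi> a \<ominus>\<^bsub>B\<^esub> conj_by B b (\<psi> a)) < \<epsilon>))"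
    (is "?L \<longleftrightarrow> ?R") if M: "M \<subseteq> carrier C" for M \<epsilon>
  proof
    assume ?L
    then obtain c x where u: "(c, x) \<in> unitaries ?V"
      and close: "\<forall>a\<in>M. cnorm ?U (unitization_emb (\<phi> a) \<ominus>\<^bsub>?U\<^esub>
            adj ?U (c, x) \<otimes>\<^bsub>?U\<^esub> unitization_emb (\<psi> a) \<otimes>\<^bsub>?U\<^esub> (c, x)) < \<epsilon>" by auto
    then show ?R
      using to_quasi[OF u] M by (intro exI[of _ "cnj c \<odot>\<^bsub>B\<^esub> x"]) (auto simp: emb subset_iff)
  next
    assume ?R
    then obtain b where b: "quasi_unitary D b"
      and close: "\<forall>a\<in>M. cnorm B (\<phi> a \<ominus>\<^bsub>B\<^esub> conj_by B b (\<psi> a)) < \<epsilon>" by blast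
    then show ?L
      using from_quasi[OF b] M S_B
      by (intro bexI[of _ "(1, b)"]) (auto simp: emb subset_iff)
  qed
  then show ?thesis
    unfolding approx_equiv_by_def by (smt (verit, best))
qed

section \<open>Patching unitaries along the group\<close>

context rokhlin_averaging begin

lemma P_zero: "P i (\<lambda>_. \<zero>\<^bsub>B\<^esub>) = \<zero>\<^bsub>B\<^esub>"
proof -
  have closed: "P i (\<lambda>_. \<zero>\<^bsub>B\<^esub>) \<in> carrier B" by (rule P_closed) simp
  have "cnorm B (P i (\<lambda>_. \<zero>\<^bsub>B\<^esub>)) \<le> 0" using P_norm[of "\<lambda>_. \<zero>\<^bsub>B\<^esub>" i] by simp
  then have "cnorm B (P i (\<lambda>_. \<zero>\<^bsub>B\<^esub>)) = 0" using B.cnorm_nonneg[OF closed] by (rule order_antisym)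
  then show ?thesis using B.cnorm_eq_zero[OF closed] by blast
qed

lemma P_diff:
  assumes x: "x \<in> carrier G \<rightarrow> carrier B" and y: "y \<in> carrier G \<rightarrow> carrier B"
  shows "P i (\<lambda>g. x g \<ominus>\<^bsub>B\<^esub> y g) = P i x \<ominus>\<^bsub>B\<^esub> P i y"
proof -
  have xy: "(\<lambda>g. x g \<ominus>\<^bsub>B\<^esub> y g) \<in> carrier G \<rightarrow> carrier B" using x y by auto
  have "P i (\<lambda>g. (x g \<ominus>\<^bsub>B\<^esub> y g) \<oplus>\<^bsub>B\<^esub> y g) = P i x"
  proof (rule P_cong[OF _ x])
    fix g assume "g \<in> carrier G"
    then have "x g \<in> carrier B" "y g \<in> carrier B" using x y by auto
    then show "(x g \<ominus>\<^bsub>B\<^esub> y g) \<oplus>\<^bsub>B\<^esub> y g = x g" by algebra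
  qed
  then have sum: "P i x = P i (\<lambda>g. x g \<ominus>\<^bsub>B\<^esub> y g) \<oplus>\<^bsub>B\<^esub> P i y" using P_add[OF xy y] by simp
  show ?thesis
    unfolding sum using P_closed[OF xy, of i] P_closed[OF y, of i] by (simp add: B.add_diff_cancel)
qed

lemma P_bounded:
  assumes "x \<in> carrier G \<rightarrow> carrier B" "asymp_eq B \<F> T (\<lambda>i. P i x)"
    and "(\<Sum>g\<in>carrier G. cnorm B (x g)) < \<eta>"
  shows "\<forall>\<^sub>F i in \<F>. cnorm B (T i) < \<eta>"
  using assms(2) P_norm[OF assms(1)] assms(3) by (rule B.asymp_eq_norm_less)

lemma P_circ:
  assumes x: "x \<in> carrier G \<rightarrow> carrier B" and y: "y \<in> carrier G \<rightarrow> carrier B"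
  shows "asymp_eq B \<F> (\<lambda>i. circ B (P i x) (P i y)) (\<lambda>i. P i (\<lambda>g. circ B (x g) (y g)))"
proof -
  have xy: "(\<lambda>g. x g \<oplus>\<^bsub>B\<^esub> y g) \<in> carrier G \<rightarrow> carrier B"
    "(\<lambda>g. x g \<otimes>\<^bsub>B\<^esub> y g) \<in> carrier G \<rightarrow> carrier B" using x y by auto
  have "asymp_eq B \<F> (\<lambda>i. P i x \<oplus>\<^bsub>B\<^esub> P i y \<oplus>\<^bsub>B\<^esub> P i x \<otimes>\<^bsub>B\<^esub> P i y)
      (\<lambda>i. P i x \<oplus>\<^bsub>B\<^esub> P i y \<oplus>\<^bsub>B\<^esub> P i (\<lambda>g. x g \<otimes>\<^bsub>B\<^esub> y g))"
    by (intro B.asymp_eq_add B.asymp_eq_refl P_mult B.M.a_closed P_closed x y)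
  moreover have "P i x \<oplus>\<^bsub>B\<^esub> P i y \<oplus>\<^bsub>B\<^esub> P i (\<lambda>g. x g \<otimes>\<^bsub>B\<^esub> y g)
      = P i (\<lambda>g. circ B (x g) (y g))" for i
    using P_add[OF xy, of i] P_add[OF x y, of i] by (simp add: circ_def)
  ultimately show ?thesis by (simp add: circ_def)
qed

text \<open>Since \<open>P\<close> is asymptotically a *-homomorphism, it maps a family of unitaries to an
  asymptotic unitary.\<close>

lemma P_quasi_unitary:
  assumes b: "\<And>g. g \<in> carrier G \<Longrightarrow> quasi_unitary B (b g)"
  shows "asymp_eq B \<F> (\<lambda>i. circ B (adj B (P i b)) (P i b)) (\<lambda>_. \<zero>\<^bsub>B\<^esub>)"
    and "asymp_eq B \<F> (\<lambda>i. circ B (P i b) (adj B (P i b))) (\<lambda>_. \<zero>\<^bsub>B\<^esub>)"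
proof -
  have bc: "b \<in> carrier G \<rightarrow> carrier B" and b': "(\<lambda>g. adj B (b g)) \<in> carrier G \<rightarrow> carrier B"
    using b by (auto simp: quasi_unitary_def)
  have bound: "cnorm B (P i x) \<le> (\<Sum>g\<in>carrier G. cnorm B (x g))"
    if "x \<in> carrier G \<rightarrow> carrier B" for i x using P_norm[OF that] .
  have abound: "cnorm B (adj B (P i b)) \<le> (\<Sum>g\<in>carrier G. cnorm B (b g))" for i
    using P_norm[OF bc] P_closed[OF bc] by simp
  have "asymp_eq B \<F> (\<lambda>i. circ B (adj B (P i b)) (P i b))
      (\<lambda>i. circ B (P i (\<lambda>g. adj B (b g))) (P i b))"
    by (rule B.asymp_eq_circ[OF P_adj[OF bc] B.asymp_eq_refl abound bound[OF bc]])
      (rule P_closed[OF bc])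
  also have "asymp_eq B \<F> \<dots> (\<lambda>i. P i (\<lambda>g. circ B (adj B (b g)) (b g)))"
    by (rule P_circ[OF b' bc])
  also have "(\<lambda>i. P i (\<lambda>g. circ B (adj B (b g)) (b g))) = (\<lambda>_. \<zero>\<^bsub>B\<^esub>)"
    using P_cong[of "\<lambda>g. circ B (adj B (b g)) (b g)" "\<lambda>_. \<zero>\<^bsub>B\<^esub>"] P_zero b
    by (simp add: quasi_unitary_def fun_eq_iff)
  finally show "asymp_eq B \<F> (\<lambda>i. circ B (adj B (P i b)) (P i b)) (\<lambda>_. \<zero>\<^bsub>B\<^esub>)" .
  have "asymp_eq B \<F> (\<lambda>i. circ B (P i b) (adj B (P i b)))
      (\<lambda>i. circ B (P i b) (P i (\<lambda>g. adj B (b g))))"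
    by (rule B.asymp_eq_circ[OF B.asymp_eq_refl P_adj[OF bc] bound[OF bc] bound[OF b']])
      (rule P_closed[OF bc])
  also have "asymp_eq B \<F> \<dots> (\<lambda>i. P i (\<lambda>g. circ B (b g) (adj B (b g))))"
    by (rule P_circ[OF bc b'])
  also have "(\<lambda>i. P i (\<lambda>g. circ B (b g) (adj B (b g)))) = (\<lambda>_. \<zero>\<^bsub>B\<^esub>)"
    using P_cong[of "\<lambda>g. circ B (b g) (adj B (b g))" "\<lambda>_. \<zero>\<^bsub>B\<^esub>"] P_zero b
    by (simp add: quasi_unitary_def fun_eq_iff)
  finally show "asymp_eq B \<F> (\<lambda>i. circ B (P i b) (adj B (P i b))) (\<lambda>_. \<zero>\<^bsub>B\<^esub>)" .
qed

text \<open>Likewise \<open>P\<close> carries an approximate intertwining by \<open>1 + b\<^sub>g\<close> of a constant \<open>x\<close> with \<open>y\<^sub>g\<close>, given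
  for each \<open>g\<close>, to one by a single unitary.\<close>

lemma P_intertwines:
  assumes x: "x \<in> carrier B" and y: "y \<in> carrier G \<rightarrow> carrier B"
    and b: "b \<in> carrier G \<rightarrow> carrier B" and u: "asymp_eq B \<F> u (\<lambda>i. P i b)"
    and qu: "\<And>i. quasi_unitary B (u i)"
    and small: "\<And>g. g \<in> carrier G \<Longrightarrow>
      cnorm B ((y g \<oplus>\<^bsub>B\<^esub> b g \<otimes>\<^bsub>B\<^esub> y g) \<ominus>\<^bsub>B\<^esub> (x \<oplus>\<^bsub>B\<^esub> x \<otimes>\<^bsub>B\<^esub> b g)) < \<eta> / card (carrier G)"
  shows "\<forall>\<^sub>F i in \<F>. cnorm B (P i y \<ominus>\<^bsub>B\<^esub> conj_by B (u i) x) < \<eta>"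
proof -
  have uc: "u i \<in> carrier B" and un: "cnorm B (u i) \<le> 2" for i
    using B.quasi_unitary_closed[OF qu] B.quasi_unitary_norm[OF qu] .
  have xP: "(\<lambda>_. x) \<in> carrier G \<rightarrow> carrier B" using x by simp
  have prods: "(\<lambda>g. b g \<otimes>\<^bsub>B\<^esub> y g) \<in> carrier G \<rightarrow> carrier B" "(\<lambda>g. x \<otimes>\<^bsub>B\<^esub> b g) \<in> carrier G \<rightarrow> carrier B"
    using x y b by auto
  have "asymp_eq B \<F> (\<lambda>i. u i \<otimes>\<^bsub>B\<^esub> P i y) (\<lambda>i. P i b \<otimes>\<^bsub>B\<^esub> P i y)"
    using u P_closed[OF y] P_norm[OF y] by (rule B.asymp_eq_mult_right)
  then have uy: "asymp_eq B \<F> (\<lambda>i. u i \<otimes>\<^bsub>B\<^esub> P i y) (\<lambda>i. P i (\<lambda>g. b g \<otimes>\<^bsub>B\<^esub> y g))"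
    using P_mult[OF b y] by (rule B.asymp_eq_trans)
  have "asymp_eq B \<F> (\<lambda>i. x \<otimes>\<^bsub>B\<^esub> u i) (\<lambda>i. P i (\<lambda>_. x) \<otimes>\<^bsub>B\<^esub> P i b)"
    by (rule B.asymp_eq_mult[OF B.asymp_eq_sym[OF P_const[OF x]] u order_refl P_norm[OF b]])
  then have xu: "asymp_eq B \<F> (\<lambda>i. x \<otimes>\<^bsub>B\<^esub> u i) (\<lambda>i. P i (\<lambda>g. x \<otimes>\<^bsub>B\<^esub> b g))"
    using P_mult[OF xP b] by (rule B.asymp_eq_trans)
  have "asymp_eq B \<F>
      (\<lambda>i. (P i y \<oplus>\<^bsub>B\<^esub> u i \<otimes>\<^bsub>B\<^esub> P i y) \<ominus>\<^bsub>B\<^esub> (x \<oplus>\<^bsub>B\<^esub> x \<otimes>\<^bsub>B\<^esub> u i))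
      (\<lambda>i. (P i y \<oplus>\<^bsub>B\<^esub> P i (\<lambda>g. b g \<otimes>\<^bsub>B\<^esub> y g)) \<ominus>\<^bsub>B\<^esub> (P i (\<lambda>_. x) \<oplus>\<^bsub>B\<^esub> P i (\<lambda>g. x \<otimes>\<^bsub>B\<^esub> b g)))"
    by (intro B.asymp_eq_diff B.asymp_eq_add uy xu B.asymp_eq_sym[OF P_const[OF x]]
        B.asymp_eq_refl P_closed[OF y])
  moreover have "P i (\<lambda>g. (y g \<oplus>\<^bsub>B\<^esub> b g \<otimes>\<^bsub>B\<^esub> y g) \<ominus>\<^bsub>B\<^esub> (x \<oplus>\<^bsub>B\<^esub> x \<otimes>\<^bsub>B\<^esub> b g))
     = (P i y \<oplus>\<^bsub>B\<^esub> P i (\<lambda>g. b g \<otimes>\<^bsub>B\<^esub> y g)) \<ominus>\<^bsub>B\<^esub> (P i (\<lambda>_. x) \<oplus>\<^bsub>B\<^esub> P i (\<lambda>g. x \<otimes>\<^bsub>B\<^esub> b g))" for i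
    using P_diff[of "\<lambda>g. y g \<oplus>\<^bsub>B\<^esub> b g \<otimes>\<^bsub>B\<^esub> y g" "\<lambda>g. x \<oplus>\<^bsub>B\<^esub> x \<otimes>\<^bsub>B\<^esub> b g" i]
      P_add[OF y prods(1), of i] P_add[OF xP prods(2), of i] prods y x by (simp add: Pi_iff)
  ultimately have eq: "asymp_eq B \<F>
      (\<lambda>i. (P i y \<oplus>\<^bsub>B\<^esub> u i \<otimes>\<^bsub>B\<^esub> P i y) \<ominus>\<^bsub>B\<^esub> (x \<oplus>\<^bsub>B\<^esub> x \<otimes>\<^bsub>B\<^esub> u i))
      (\<lambda>i. P i (\<lambda>g. (y g \<oplus>\<^bsub>B\<^esub> b g \<otimes>\<^bsub>B\<^esub> y g) \<ominus>\<^bsub>B\<^esub> (x \<oplus>\<^bsub>B\<^esub> x \<otimes>\<^bsub>B\<^esub> b g)))"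
    by simp
  have "(\<Sum>g\<in>carrier G. cnorm B ((y g \<oplus>\<^bsub>B\<^esub> b g \<otimes>\<^bsub>B\<^esub> y g) \<ominus>\<^bsub>B\<^esub> (x \<oplus>\<^bsub>B\<^esub> x \<otimes>\<^bsub>B\<^esub> b g)))
      < (\<Sum>g\<in>carrier G. \<eta> / card (carrier G))"
    using small finite_group G.one_closed by (intro sum_strict_mono) auto
  then have "\<forall>\<^sub>F i in \<F>. cnorm B ((P i y \<oplus>\<^bsub>B\<^esub> u i \<otimes>\<^bsub>B\<^esub> P i y) \<ominus>\<^bsub>B\<^esub> (x \<oplus>\<^bsub>B\<^esub> x \<otimes>\<^bsub>B\<^esub> u i)) < \<eta>"
    using card_pos x y b by (intro P_bounded[OF _ eq]) (auto simp: Pi_iff)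
  then show ?thesis
    using B.cnorm_diff_conj_by[OF qu P_closed[OF y] x] by simp
qed

end

text \<open>The action of \<open>g\<close> on maps from \<open>A\<close> to \<open>B\<close>; equivariant maps are its fixed points.\<close>

definition twist ::
  "('g, 'z) monoid_scheme \<Rightarrow> ('g \<Rightarrow> 'a \<Rightarrow> 'a) \<Rightarrow> ('g \<Rightarrow> 'b \<Rightarrow> 'b) \<Rightarrow> 'g \<Rightarrow> ('a \<Rightarrow> 'b) \<Rightarrow> 'a \<Rightarrow> 'b" where
  "twist G \<alpha> \<beta> g \<phi> a = \<beta> g (\<phi> (\<alpha> (inv\<^bsub>G\<^esub> g) a))"

locale cstar_actions = A: cstar_action G A \<alpha> + B: cstar_action G B \<beta>
  for G :: "('g, 'z) monoid_scheme" and A :: "('a, 'x) cstar_scheme" and \<alpha>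
    and B :: "('b, 'y) cstar_scheme" and \<beta>
begin

lemma twist_closed [simp, intro]:
  assumes "\<phi> \<in> carrier A \<rightarrow> carrier B" "g \<in> carrier G" "a \<in> carrier A"
  shows "twist G \<alpha> \<beta> g \<phi> a \<in> carrier B"
  using assms by (auto simp: twist_def)

text \<open>Approximately unitarily equivalent equivariant maps are equivalent by invariant unitaries:
  the translates \<open>\<beta>\<^sub>g(b)\<close> of one unitary are patched together.\<close>

theorem equivariant_uniqueness:
  assumes rokhlin: "rokhlin_property G B \<beta>"
    and \<phi>: "\<phi> \<in> carrier A \<rightarrow> carrier B" and \<psi>: "\<psi> \<in> carrier A \<rightarrow> carrier B"
    and \<phi>eq: "\<And>g a. g \<in> carrier G \<Longrightarrow> a \<in> carrier A \<Longrightarrow> \<phi> (\<alpha> g a) = \<beta> g (\<phi> a)"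
    and \<psi>eq: "\<And>g a. g \<in> carrier G \<Longrightarrow> a \<in> carrier A \<Longrightarrow> \<psi> (\<alpha> g a) = \<beta> g (\<psi> a)"
    and au: "\<And>M \<epsilon>. \<epsilon> > 0 \<Longrightarrow> finite M \<Longrightarrow> M \<subseteq> carrier A \<Longrightarrow>
      \<exists>b. quasi_unitary B b \<and> (\<forall>a\<in>M. cnorm B (\<phi> a \<ominus>\<^bsub>B\<^esub> conj_by B b (\<psi> a)) < \<epsilon>)"
    and M: "finite M" "M \<subseteq> carrier A" and "\<epsilon> > 0"
  shows "\<exists>u. quasi_unitary B.Fix u \<and> (\<forall>a\<in>M. cnorm B (\<phi> a \<ominus>\<^bsub>B\<^esub> conj_by B u (\<psi> a)) < \<epsilon>)"
proof -
  define n where "n = card (carrier G)"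
  have n: "n > 0" using B.card_pos by (simp add: n_def)
  define M' where "M' = (\<Union>g\<in>carrier G. \<alpha> g ` M)"
  have M': "finite M'" "M' \<subseteq> carrier A" using M A.finite_group by (auto simp: M'_def)
  define \<eta> where "\<eta> = \<epsilon> / 2"
  \<comment> \<open>The defect is summed over the \<open>n\<close> group elements, after the action has at most doubled it.\<close>
  have "\<eta> / real n / 2 > 0" using n \<open>\<epsilon> > 0\<close> by (simp add: \<eta>_def)
  then obtain b\<^sub>0 where b\<^sub>0: "quasi_unitary B b\<^sub>0"
    and close: "\<And>a. a \<in> M' \<Longrightarrow> cnorm B (\<phi> a \<ominus>\<^bsub>B\<^esub> conj_by B b\<^sub>0 (\<psi> a)) < \<eta> / real n / 2"
    using au[OF _ M'] by blast
  define b where "b g = \<beta> g b\<^sub>0" for g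
  have b\<^sub>0c: "b\<^sub>0 \<in> carrier B" using B.B.quasi_unitary_closed[OF b\<^sub>0] .
  have bc: "b \<in> carrier G \<rightarrow> carrier B" using b\<^sub>0c by (auto simp: b_def)
  have bqu: "quasi_unitary B (b g)" if "g \<in> carrier G" for g
    unfolding b_def using B.act_cstar_hom[OF that] b\<^sub>0 by (rule cstar_hom.hom_quasi_unitary)
  obtain P where "rokhlin_averaging G B \<beta> (rokhlin_filter (carrier B)) P"
    using B.rokhlin_averaging_exists[OF rokhlin] .
  then interpret P: rokhlin_averaging G B \<beta> "rokhlin_filter (carrier B)" P .
  let ?F = "rokhlin_filter (carrier B)"
  have inv: "asymp_eq B ?F (\<lambda>i. \<beta> h (P i b)) (\<lambda>i. P i b)" if h: "h \<in> carrier G" for h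
  proof -
    have "\<beta> h (b (inv\<^bsub>G\<^esub> h \<otimes>\<^bsub>G\<^esub> g)) = b g" if "g \<in> carrier G" for g
      using h that b\<^sub>0c by (simp add: b_def flip: B.act_mult A.G.m_assoc)
    then have "P i (\<lambda>g. \<beta> h (b (inv\<^bsub>G\<^esub> h \<otimes>\<^bsub>G\<^esub> g))) = P i b" for i
      using bc by (intro P.P_cong) auto
    then show ?thesis using P.P_act[OF h bc] by simp
  qed
  obtain u where u: "\<And>i. quasi_unitary B.Fix (u i)" "asymp_eq B ?F u (\<lambda>i. P i b)"
    using B.lift_invariant_asymptotic_unitary[OF P.P_closed[OF bc] P.P_norm[OF bc]
        P.P_quasi_unitary[OF bqu] inv] by blast
  have uqu: "quasi_unitary B (u i)" for i using u(1) B.Fix_quasi_unitary by blast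
  have "\<forall>\<^sub>F i in ?F. cnorm B (\<phi> a \<ominus>\<^bsub>B\<^esub> conj_by B (u i) (\<psi> a)) < \<epsilon>" if a: "a \<in> M" for a
  proof -
    have aA: "a \<in> carrier A" using a M by blast
    then have ab: "\<phi> a \<in> carrier B" "\<psi> a \<in> carrier B" using \<phi> \<psi> by auto
    have ev: "\<forall>\<^sub>F i in ?F. cnorm B (P i (\<lambda>_. \<phi> a) \<ominus>\<^bsub>B\<^esub> conj_by B (u i) (\<psi> a)) < \<eta>"
    proof (rule P.P_intertwines[OF ab(2) _ bc u(2) uqu])
      fix g assume g: "g \<in> carrier G"
      define a' where "a' = \<alpha> (inv\<^bsub>G\<^esub> g) a"
      have a': "a' \<in> M'" "a' \<in> carrier A" "\<alpha> g a' = a"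
        using g a aA by (auto simp: a'_def M'_def)
      then have ab': "\<phi> a' \<in> carrier B" "\<psi> a' \<in> carrier B" using \<phi> \<psi> by auto
      interpret h: cstar_hom B B "\<beta> g" by (rule B.act_cstar_hom[OF g])
      let ?d = "(\<phi> a' \<oplus>\<^bsub>B\<^esub> b\<^sub>0 \<otimes>\<^bsub>B\<^esub> \<phi> a') \<ominus>\<^bsub>B\<^esub> (\<psi> a' \<oplus>\<^bsub>B\<^esub> \<psi> a' \<otimes>\<^bsub>B\<^esub> b\<^sub>0)"
      have "(\<phi> a \<oplus>\<^bsub>B\<^esub> b g \<otimes>\<^bsub>B\<^esub> \<phi> a) \<ominus>\<^bsub>B\<^esub> (\<psi> a \<oplus>\<^bsub>B\<^esub> \<psi> a \<otimes>\<^bsub>B\<^esub> b g) = \<beta> g ?d"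
        using \<phi>eq[OF g a'(2)] \<psi>eq[OF g a'(2)] a'(3) ab' b\<^sub>0c
        by (simp add: h.hom_diff h.hom_add h.hom_mult b_def)
      moreover have "cnorm B (\<beta> g ?d) \<le> 2 * cnorm B ?d"
        using ab' b\<^sub>0c by (intro h.hom_bounded) auto
      moreover have "cnorm B ?d < \<eta> / real n / 2"
        using close[OF a'(1)] B.B.cnorm_diff_conj_by[OF b\<^sub>0 ab'] by simp
      ultimately show "cnorm B ((\<phi> a \<oplus>\<^bsub>B\<^esub> b g \<otimes>\<^bsub>B\<^esub> \<phi> a) \<ominus>\<^bsub>B\<^esub> (\<psi> a \<oplus>\<^bsub>B\<^esub> \<psi> a \<otimes>\<^bsub>B\<^esub> b g))
          < \<eta> / card (carrier G)" by (simp add: n_def)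
    qed (use ab in auto)
    have "\<forall>\<^sub>F i in ?F. cnorm B (P i (\<lambda>_. \<phi> a) \<ominus>\<^bsub>B\<^esub> \<phi> a) < \<eta>"
      using order_tendstoD(2)[OF B.B.asymp_eqD(3)[OF P.P_const[OF ab(1)]], of \<eta>] \<open>\<epsilon> > 0\<close>
      by (simp add: \<eta>_def)
    with ev show ?thesis
    proof eventually_elim
      case (elim i)
      have "P i (\<lambda>_. \<phi> a) \<in> carrier B" using P.P_closed ab by simp
      then show ?case
        using elim B.B.cnorm_diff_trans[of "\<phi> a" "P i (\<lambda>_. \<phi> a)" "conj_by B (u i) (\<psi> a)"]
          B.B.cnorm_diff_commute[of "\<phi> a" "P i (\<lambda>_. \<phi> a)"] ab B.B.quasi_unitary_closed[OF uqu]
        by (simp add: \<eta>_def)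
    qed
  qed
  then have "\<forall>\<^sub>F i in ?F. \<forall>a\<in>M. cnorm B (\<phi> a \<ominus>\<^bsub>B\<^esub> conj_by B (u i) (\<psi> a)) < \<epsilon>"
    using M(1) by (simp add: eventually_ball_finite_distrib)
  then obtain i where "\<forall>a\<in>M. cnorm B (\<phi> a \<ominus>\<^bsub>B\<^esub> conj_by B (u i) (\<psi> a)) < \<epsilon>"
    using eventually_happens'[OF rokhlin_filter_proper] by blast
  then show ?thesis using u(1) by blast
qed

text \<open>Unitaries \<open>u\<^sub>g\<close> that conjugate \<open>\<phi>\<close> close to its twists are patched to one unitary conjugating \<open>\<phi>\<close>
  close to the average \<open>P\<close> of the twists, which is asymptotically equivariant. The last
  inequality keeps the new map as close to \<open>\<phi>\<close> as \<open>\<phi>\<close> is to being equivariant.\<close>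

theorem almost_equivariant_conjugate:
  assumes rokhlin: "rokhlin_property G B \<beta>" and \<phi>: "\<phi> \<in> carrier A \<rightarrow> carrier B"
    and au: "\<And>g M \<epsilon>. g \<in> carrier G \<Longrightarrow> \<epsilon> > 0 \<Longrightarrow> finite M \<Longrightarrow> M \<subseteq> carrier A \<Longrightarrow>
      \<exists>b. quasi_unitary B b \<and> (\<forall>a\<in>M. cnorm B (twist G \<alpha> \<beta> g \<phi> a \<ominus>\<^bsub>B\<^esub> conj_by B b (\<phi> a)) < \<epsilon>)"
    and M: "finite M" "M \<subseteq> carrier A" and "\<epsilon> > 0"
  obtains u where "quasi_unitary B u"
    "\<And>a g. \<lbrakk>a \<in> M; g \<in> carrier G\<rbrakk> \<Longrightarrow> cnorm B (twist G \<alpha> \<beta> g (\<lambda>a. conj_by B u (\<phi> a)) a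
      \<ominus>\<^bsub>B\<^esub> conj_by B u (\<phi> a)) < \<epsilon>"
    "\<And>a. a \<in> M \<Longrightarrow> cnorm B (conj_by B u (\<phi> a) \<ominus>\<^bsub>B\<^esub> \<phi> a)
      < \<epsilon> + (\<Sum>g\<in>carrier G. cnorm B (twist G \<alpha> \<beta> g \<phi> a \<ominus>\<^bsub>B\<^esub> \<phi> a))"
proof -
  define n where "n = card (carrier G)"
  have n: "n > 0" using B.card_pos by (simp add: n_def)
  define M' where "M' = (\<Union>g\<in>carrier G. \<alpha> g ` M)"
  have M': "finite M'" "M' \<subseteq> carrier A" using M A.finite_group by (auto simp: M'_def)
  have MM': "a \<in> M'" if "a \<in> M" for a
    using that M A.act_one[of a] A.G.one_closed unfolding M'_def by force
  \<comment> \<open>Equivariance of the conjugate is compared through \<open>P\<close>: twice \<open>\<eta>\<close> under the action, \<open>\<eta>\<close> for the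
    equivariance of \<open>P\<close>, and \<open>\<eta>\<close> for the return.\<close>
  define \<eta> where "\<eta> = \<epsilon> / 4"
  have \<eta>: "\<eta> > 0" "\<eta> / real n > 0" using n \<open>\<epsilon> > 0\<close> by (simp_all add: \<eta>_def)
  have "\<forall>g. \<exists>b. g \<in> carrier G \<longrightarrow> quasi_unitary B b \<and>
      (\<forall>a\<in>M'. cnorm B (twist G \<alpha> \<beta> g \<phi> a \<ominus>\<^bsub>B\<^esub> conj_by B b (\<phi> a)) < \<eta> / real n)"
    using au[OF _ \<eta>(2) M'] by blast
  then obtain b where bqu: "\<And>g. g \<in> carrier G \<Longrightarrow> quasi_unitary B (b g)"
    and close: "\<And>g a. \<lbrakk>g \<in> carrier G; a \<in> M'\<rbrakk> \<Longrightarrow>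
      cnorm B (twist G \<alpha> \<beta> g \<phi> a \<ominus>\<^bsub>B\<^esub> conj_by B (b g) (\<phi> a)) < \<eta> / real n"
    by metis
  have bc: "b \<in> carrier G \<rightarrow> carrier B" using B.B.quasi_unitary_closed[OF bqu] by auto
  obtain P where "rokhlin_averaging G B \<beta> (rokhlin_filter (carrier B)) P"
    using B.rokhlin_averaging_exists[OF rokhlin] .
  then interpret P: rokhlin_averaging G B \<beta> "rokhlin_filter (carrier B)" P .
  let ?F = "rokhlin_filter (carrier B)"
  obtain u where uqu: "\<And>i. quasi_unitary B (u i)" and u: "asymp_eq B ?F u (\<lambda>i. P i b)"
    using B.B.lift_asymptotic_unitary[OF P.P_closed[OF bc] P.P_norm[OF bc]
        P.P_quasi_unitary[OF bqu]] by blast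
  have uc: "u i \<in> carrier B" for i using B.B.quasi_unitary_closed[OF uqu] .
  define y where "y a g = twist G \<alpha> \<beta> g \<phi> a" for a g
  have \<phi>c: "\<phi> a \<in> carrier B" and yc: "y a \<in> carrier G \<rightarrow> carrier B" if "a \<in> carrier A" for a
    using \<phi> that by (auto simp: y_def)
  have Pc: "P i (y a) \<in> carrier B" if "a \<in> carrier A" for i a
    using P.P_closed[OF yc[OF that]] .
  have near: "\<forall>\<^sub>F i in ?F. cnorm B (P i (y a) \<ominus>\<^bsub>B\<^esub> conj_by B (u i) (\<phi> a)) < \<eta>" if a: "a \<in> M'" for a
  proof (rule P.P_intertwines[OF \<phi>c yc bc u uqu])
    fix g assume g: "g \<in> carrier G"
    have aA: "a \<in> carrier A" using a M' by blast
    show "cnorm B ((y a g \<oplus>\<^bsub>B\<^esub> b g \<otimes>\<^bsub>B\<^esub> y a g) \<ominus>\<^bsub>B\<^esub> (\<phi> a \<oplus>\<^bsub>B\<^esub> \<phi> a \<otimes>\<^bsub>B\<^esub> b g)) < \<eta> / card (carrier G)"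
      using close[OF g a] B.B.cnorm_diff_conj_by[OF bqu[OF g] _ \<phi>c[OF aA], of "y a g"] \<phi> g aA
      by (auto simp: y_def n_def)
  qed (use a M' in auto)
  have equivariant: "\<forall>\<^sub>F i in ?F. cnorm B (\<beta> g (P i (y (\<alpha> (inv\<^bsub>G\<^esub> g) a))) \<ominus>\<^bsub>B\<^esub> P i (y a)) < \<eta>"
    if g: "g \<in> carrier G" and a: "a \<in> carrier A" for g a
  proof -
    have "\<beta> g (y (\<alpha> (inv\<^bsub>G\<^esub> g) a) (inv\<^bsub>G\<^esub> g \<otimes>\<^bsub>G\<^esub> k)) = y a k" if k: "k \<in> carrier G" for k
    proof -
      have "inv\<^bsub>G\<^esub> (inv\<^bsub>G\<^esub> g \<otimes>\<^bsub>G\<^esub> k) \<otimes>\<^bsub>G\<^esub> inv\<^bsub>G\<^esub> g = inv\<^bsub>G\<^esub> k"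
        "g \<otimes>\<^bsub>G\<^esub> (inv\<^bsub>G\<^esub> g \<otimes>\<^bsub>G\<^esub> k) = k"
        using g k by (simp_all add: A.G.inv_mult_group A.G.m_assoc flip: A.G.m_assoc[of g])
      then show ?thesis
        using g k a \<phi>c by (simp add: y_def twist_def flip: A.act_mult B.act_mult)
    qed
    then have "P i (\<lambda>k. \<beta> g (y (\<alpha> (inv\<^bsub>G\<^esub> g) a) (inv\<^bsub>G\<^esub> g \<otimes>\<^bsub>G\<^esub> k))) = P i (y a)" for i
      using yc[OF a] by (intro P.P_cong) auto
    then have "asymp_eq B ?F (\<lambda>i. \<beta> g (P i (y (\<alpha> (inv\<^bsub>G\<^esub> g) a)))) (\<lambda>i. P i (y a))"
      using P.P_act[OF g yc, of "\<alpha> (inv\<^bsub>G\<^esub> g) a"] g a by simp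
    then show ?thesis using order_tendstoD(2)[OF B.B.asymp_eqD(3) \<eta>(1)] by blast
  qed
  have displacement: "\<forall>\<^sub>F i in ?F. cnorm B (P i (y a) \<ominus>\<^bsub>B\<^esub> \<phi> a)
      < \<eta> + (\<Sum>g\<in>carrier G. cnorm B (y a g \<ominus>\<^bsub>B\<^esub> \<phi> a))" if a: "a \<in> carrier A" for a
  proof (rule P.P_bounded)
    show "asymp_eq B ?F (\<lambda>i. P i (y a) \<ominus>\<^bsub>B\<^esub> \<phi> a) (\<lambda>i. P i (\<lambda>g. y a g \<ominus>\<^bsub>B\<^esub> \<phi> a))"
      using B.B.asymp_eq_diff[OF B.B.asymp_eq_refl B.B.asymp_eq_sym[OF P.P_const[OF \<phi>c[OF a]]]]
        P.P_diff[OF yc[OF a], of "\<lambda>_. \<phi> a"] Pc[OF a] \<phi>c[OF a] by simp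
  qed (use yc[OF a] \<phi>c[OF a] \<eta> in \<open>auto simp: Pi_iff\<close>)
  have "\<forall>\<^sub>F i in ?F. (\<forall>a\<in>M'. cnorm B (P i (y a) \<ominus>\<^bsub>B\<^esub> conj_by B (u i) (\<phi> a)) < \<eta>) \<and>
      (\<forall>a\<in>M. \<forall>g\<in>carrier G. cnorm B (\<beta> g (P i (y (\<alpha> (inv\<^bsub>G\<^esub> g) a))) \<ominus>\<^bsub>B\<^esub> P i (y a)) < \<eta>) \<and>
      (\<forall>a\<in>M. cnorm B (P i (y a) \<ominus>\<^bsub>B\<^esub> \<phi> a) < \<eta> + (\<Sum>g\<in>carrier G. cnorm B (y a g \<ominus>\<^bsub>B\<^esub> \<phi> a)))"
    using near equivariant displacement M M' A.finite_group
    by (intro eventually_conj eventually_ball_finite ballI) auto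
  then obtain i where near: "\<And>a. a \<in> M' \<Longrightarrow> cnorm B (P i (y a) \<ominus>\<^bsub>B\<^esub> conj_by B (u i) (\<phi> a)) < \<eta>"
    and equivariant: "\<And>a g. \<lbrakk>a \<in> M; g \<in> carrier G\<rbrakk>
      \<Longrightarrow> cnorm B (\<beta> g (P i (y (\<alpha> (inv\<^bsub>G\<^esub> g) a))) \<ominus>\<^bsub>B\<^esub> P i (y a)) < \<eta>"
    and displacement: "\<And>a. a \<in> M
      \<Longrightarrow> cnorm B (P i (y a) \<ominus>\<^bsub>B\<^esub> \<phi> a) < \<eta> + (\<Sum>g\<in>carrier G. cnorm B (y a g \<ominus>\<^bsub>B\<^esub> \<phi> a))"
    using eventually_happens'[OF rokhlin_filter_proper] by blast
  show thesis
  proof (rule that[OF uqu[of i]])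
    fix a assume a: "a \<in> M"
    then have aA: "a \<in> carrier A" and aM: "a \<in> M'" using M MM' by auto
    note [simp] = Pc[OF aA] \<phi>c[OF aA] uc
    show "cnorm B (conj_by B (u i) (\<phi> a) \<ominus>\<^bsub>B\<^esub> \<phi> a)
      < \<epsilon> + (\<Sum>g\<in>carrier G. cnorm B (twist G \<alpha> \<beta> g \<phi> a \<ominus>\<^bsub>B\<^esub> \<phi> a))"
      using near[OF aM] displacement[OF a] \<eta>(1)
        B.B.cnorm_diff_trans[of "conj_by B (u i) (\<phi> a)" "P i (y a)" "\<phi> a"]
        B.B.cnorm_diff_commute[of "conj_by B (u i) (\<phi> a)" "P i (y a)"]
      by (simp add: y_def \<eta>_def)
    fix g assume g: "g \<in> carrier G"
    define a' where "a' = \<alpha> (inv\<^bsub>G\<^esub> g) a"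
    have a': "a' \<in> M'" "a' \<in> carrier A" using a aA g by (auto simp: a'_def M'_def)
    note [simp] = Pc[OF a'(2)] \<phi>c[OF a'(2)]
    interpret h: cstar_hom B B "\<beta> g" by (rule B.act_cstar_hom[OF g])
    have "cnorm B (\<beta> g (conj_by B (u i) (\<phi> a')) \<ominus>\<^bsub>B\<^esub> \<beta> g (P i (y a'))) < 2 * \<eta>"
      using near[OF a'(1)] h.hom_bounded[of "conj_by B (u i) (\<phi> a') \<ominus>\<^bsub>B\<^esub> P i (y a')"]
        B.B.cnorm_diff_commute[of "conj_by B (u i) (\<phi> a')" "P i (y a')"]
      by (simp add: h.hom_diff)
    moreover have "cnorm B (\<beta> g (P i (y a')) \<ominus>\<^bsub>B\<^esub> P i (y a)) < \<eta>"
      using equivariant[OF a g] by (simp add: a'_def)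
    ultimately have "cnorm B (\<beta> g (conj_by B (u i) (\<phi> a')) \<ominus>\<^bsub>B\<^esub> conj_by B (u i) (\<phi> a)) < \<epsilon>"
      using near[OF aM] g
        B.B.cnorm_diff_trans[of "\<beta> g (conj_by B (u i) (\<phi> a'))" "\<beta> g (P i (y a'))" "P i (y a)"]
        B.B.cnorm_diff_trans[of "\<beta> g (conj_by B (u i) (\<phi> a'))" "P i (y a)" "conj_by B (u i) (\<phi> a)"]
      by (simp add: \<eta>_def)
    then show "cnorm B (twist G \<alpha> \<beta> g (\<lambda>a. conj_by B (u i) (\<phi> a)) a
        \<ominus>\<^bsub>B\<^esub> conj_by B (u i) (\<phi> a)) < \<epsilon>"
      by (simp add: twist_def a'_def)
  qed
qed

end

section \<open>Equivariant homomorphisms as limits\<close>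

lemma separable_dense_sequence:
  assumes "separable_cstar A"
  obtains d :: "nat \<Rightarrow> 'a" where "\<forall>k. d k \<in> carrier A"
    "\<forall>a\<in>carrier A. \<forall>e>0. \<exists>k. cnorm A (a \<ominus>\<^bsub>A\<^esub> d k) < e"
proof -
  interpret cstar_algebra A using assms by (simp add: separable_cstar_def)
  interpret M: Metric_space "carrier A" "cdist A" by (rule metric)
  obtain C where C: "countable C" "C \<subseteq> carrier A" "M.mtopology closure_of C = carrier A"
    using assms unfolding separable_cstar_def separable_space_def by auto
  have ne: "C \<noteq> {}"
    using C(3) M.zero_closed by auto
  define d where "d = from_nat_into C"
  have d: "d k \<in> C" for k unfolding d_def using ne by (rule from_nat_into)
  have dA: "d k \<in> carrier A" for k using d C by blast
  have "\<exists>k. cnorm A (a \<ominus>\<^bsub>A\<^esub> d k) < e" if a: "a \<in> carrier A" and e: "e > 0" for a e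
  proof -
    have "\<exists>y\<in>C. y \<in> M.mball a e"
      using C(3) a e by (auto simp: M.metric_closure_of)
    then obtain y where "y \<in> C" "cdist A a y < e" by auto
    moreover obtain k where "d k = y"
      using from_nat_into_surj[OF C(1) \<open>y \<in> C\<close>] by (auto simp: d_def)
    ultimately show ?thesis
      using a dA by (auto simp: cdist_def)
  qed
  then show thesis using that dA by blast
qed

text \<open>For products, the uniform bound on *-homomorphisms keeps the factors bounded.\<close>

lemma pointwise_limit_star_hom:
  assumes "cstar_algebra A" "cstar_algebra B" and \<phi>: "\<And>n. \<phi> n \<in> star_hom A B"
    and lim: "\<And>a. a \<in> carrier A \<Longrightarrow> asymp_eq B sequentially (\<lambda>n. \<phi> n a) (\<lambda>_. \<psi> a)"
    and ext: "\<psi> \<in> extensional (carrier A)"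
  shows "\<psi> \<in> star_hom A B"
proof -
  interpret A: cstar_algebra A by fact
  interpret B: cstar_algebra B by fact
  have \<phi>n: "cstar_hom A B (\<phi> n)" for n
    by (intro cstar_hom.intro cstar_hom_axioms.intro assms \<phi>)
  have lim_eq: "\<psi> a = b" if "a \<in> carrier A" "asymp_eq B sequentially (\<lambda>n. \<phi> n a) (\<lambda>_. b)" for a b
    using B.limit_unique[OF lim[OF that(1)] that(2)] by simp
  note hom = star_homD[OF \<phi>]
  show ?thesis
    unfolding star_hom_def
  proof (intro CollectI conjI ballI allI)
    show "\<psi> \<in> carrier A \<rightarrow>\<^sub>E carrier B"
      using ext B.asymp_eqD(2)[OF lim] by (auto simp: PiE_def)
    fix x assume x: "x \<in> carrier A"
    show "\<psi> (c \<odot>\<^bsub>A\<^esub> x) = c \<odot>\<^bsub>B\<^esub> \<psi> x" for c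
      using x B.asymp_eq_scale[OF lim[OF x], of c] by (intro lim_eq) (simp_all add: hom)
    show "\<psi> (adj A x) = adj B (\<psi> x)"
      using x B.asymp_eq_adj[OF lim[OF x]] by (intro lim_eq) (simp_all add: hom)
    fix y assume y: "y \<in> carrier A"
    show "\<psi> (x \<oplus>\<^bsub>A\<^esub> y) = \<psi> x \<oplus>\<^bsub>B\<^esub> \<psi> y"
      using x y B.asymp_eq_add[OF lim[OF x] lim[OF y]] by (intro lim_eq) (simp_all add: hom)
    have "asymp_eq B sequentially (\<lambda>n. \<phi> n x \<otimes>\<^bsub>B\<^esub> \<phi> n y) (\<lambda>_. \<psi> x \<otimes>\<^bsub>B\<^esub> \<psi> y)"
      using cstar_hom.hom_bounded[OF \<phi>n x]
      by (intro B.asymp_eq_mult[OF lim[OF x] lim[OF y], of "2 * cnorm A x" "cnorm B (\<psi> y)"]) auto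
    then show "\<psi> (x \<otimes>\<^bsub>A\<^esub> y) = \<psi> x \<otimes>\<^bsub>B\<^esub> \<psi> y"
      using x y by (intro lim_eq) (simp_all add: hom)
  qed
qed

context cstar_actions begin

text \<open>Averaging the twists improves equivariance at will while moving the map by no more than its
  present defect, so that iteration produces a convergent sequence. The limit may leave
  the class \<open>\<Phi>\<close>, but stays pointwise approximable by it.\<close>

theorem equivariant_limit:
  fixes \<Phi> :: "('a \<Rightarrow> 'b) set"
  assumes rokhlin: "rokhlin_property G B \<beta>" and separable: "separable_cstar A"
    and \<Phi>: "\<Phi> \<subseteq> star_hom A B" "\<phi>\<^sub>0 \<in> \<Phi>"
    and au: "\<And>\<phi> g M \<epsilon>. \<phi> \<in> \<Phi> \<Longrightarrow> g \<in> carrier G \<Longrightarrow> \<epsilon> > 0 \<Longrightarrow> finite M \<Longrightarrow> M \<subseteq> carrier A \<Longrightarrow>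
      \<exists>b. quasi_unitary B b \<and> (\<forall>a\<in>M. cnorm B (twist G \<alpha> \<beta> g \<phi> a \<ominus>\<^bsub>B\<^esub> conj_by B b (\<phi> a)) < \<epsilon>)"
    and conj: "\<And>\<phi> u. \<phi> \<in> \<Phi> \<Longrightarrow> quasi_unitary B u \<Longrightarrow> (\<lambda>a\<in>carrier A. conj_by B u (\<phi> a)) \<in> \<Phi>"
  obtains \<psi> where "\<psi> \<in> star_hom A B"
    "\<And>g a. g \<in> carrier G \<Longrightarrow> a \<in> carrier A \<Longrightarrow> \<psi> (\<alpha> g a) = \<beta> g (\<psi> a)"
    "\<And>M \<epsilon>. \<epsilon> > 0 \<Longrightarrow> finite M \<Longrightarrow> M \<subseteq> carrier A \<Longrightarrow> \<exists>\<phi>\<in>\<Phi>. \<forall>a\<in>M. cnorm B (\<psi> a \<ominus>\<^bsub>B\<^esub> \<phi> a) < \<epsilon>"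
proof -
  obtain d :: "nat \<Rightarrow> 'a" where d_all: "\<forall>k. d k \<in> carrier A"
    and dense_all: "\<forall>a\<in>carrier A. \<forall>e>0. \<exists>k. cnorm A (a \<ominus>\<^bsub>A\<^esub> d k) < e"
    using separable_dense_sequence[OF separable] .
  note d = d_all[rule_format] and dense = dense_all[rule_format]
  have \<Phi>_hom: "cstar_hom A B \<phi>" if "\<phi> \<in> \<Phi>" for \<phi>
    using \<Phi> that by (intro cstar_hom.intro cstar_hom_axioms.intro A.B.cstar_algebra_axioms
        B.B.cstar_algebra_axioms) auto
  \<comment> \<open>At stage \<open>n\<close> only the first \<open>n + 1\<close> points of the dense sequence are controlled. The defect there is at
    most \<open>(1/2)\<^sup>n\<close> for each group element, which makes the displacements of the next stages summable.\<close>
  define almost where "almost n \<phi> \<longleftrightarrow> \<phi> \<in> \<Phi> \<and> (\<forall>k\<le>n. \<forall>g\<in>carrier G.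
      cnorm B (twist G \<alpha> \<beta> g \<phi> (d k) \<ominus>\<^bsub>B\<^esub> \<phi> (d k)) < (1/2) ^ n)" for n :: nat and \<phi>
  define N where "N = real (card (carrier G))"
  have improve: "\<exists>\<phi>'. almost n \<phi>' \<and> (\<forall>k\<le>n. cnorm B (\<phi>' (d k) \<ominus>\<^bsub>B\<^esub> \<phi> (d k))
      < (1/2) ^ n + (\<Sum>g\<in>carrier G. cnorm B (twist G \<alpha> \<beta> g \<phi> (d k) \<ominus>\<^bsub>B\<^esub> \<phi> (d k))))"
    if "\<phi> \<in> \<Phi>" for n \<phi>
  proof (rule almost_equivariant_conjugate[OF rokhlin _ au[OF that], of "d ` {..n}" "(1/2) ^ n"])
    show "\<phi> \<in> carrier A \<rightarrow> carrier B" using cstar_hom.hom_closed[OF \<Phi>_hom[OF that]] by auto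
    fix u assume u: "quasi_unitary B u"
      and eq: "\<And>a g. a \<in> d ` {..n} \<Longrightarrow> g \<in> carrier G \<Longrightarrow> cnorm B
          (twist G \<alpha> \<beta> g (\<lambda>a. conj_by B u (\<phi> a)) a \<ominus>\<^bsub>B\<^esub> conj_by B u (\<phi> a)) < (1/2) ^ n"
      and near: "\<And>a. a \<in> d ` {..n} \<Longrightarrow> cnorm B (conj_by B u (\<phi> a) \<ominus>\<^bsub>B\<^esub> \<phi> a)
          < (1/2) ^ n + (\<Sum>g\<in>carrier G. cnorm B (twist G \<alpha> \<beta> g \<phi> a \<ominus>\<^bsub>B\<^esub> \<phi> a))"
    let ?\<phi>' = "\<lambda>a\<in>carrier A. conj_by B u (\<phi> a)"
    have "twist G \<alpha> \<beta> g ?\<phi>' (d k) = twist G \<alpha> \<beta> g (\<lambda>a. conj_by B u (\<phi> a)) (d k)"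
      if "g \<in> carrier G" for g k
      using that d by (simp add: twist_def)
    then have "almost n ?\<phi>'"
      using conj[OF \<open>\<phi> \<in> \<Phi>\<close> u] eq d by (simp add: almost_def)
    then show ?thesis using near d by (intro exI[of _ ?\<phi>']) simp
  qed (use d in auto)
  have "\<exists>\<phi>. \<forall>n. almost n (\<phi> n) \<and>
      (\<forall>k\<le>n. cnorm B (\<phi> (Suc n) (d k) \<ominus>\<^bsub>B\<^esub> \<phi> n (d k)) \<le> (1 + N) * (1/2) ^ n)"
  proof (rule dependent_nat_choice)
    show "\<exists>\<phi>. almost 0 \<phi>" using improve[OF \<Phi>(2), of 0] by blast
    fix \<phi> n assume \<phi>: "almost n \<phi>"
    then obtain \<phi>' where \<phi>': "almost (Suc n) \<phi>'"
      and near: "\<And>k. k \<le> Suc n \<Longrightarrow> cnorm B (\<phi>' (d k) \<ominus>\<^bsub>B\<^esub> \<phi> (d k)) < (1/2) ^ Suc n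
          + (\<Sum>g\<in>carrier G. cnorm B (twist G \<alpha> \<beta> g \<phi> (d k) \<ominus>\<^bsub>B\<^esub> \<phi> (d k)))"
      using improve[of \<phi> "Suc n"] unfolding almost_def by blast
    have "cnorm B (\<phi>' (d k) \<ominus>\<^bsub>B\<^esub> \<phi> (d k)) \<le> (1 + N) * (1/2) ^ n" if k: "k \<le> n" for k
    proof -
      have "(\<Sum>g\<in>carrier G. cnorm B (twist G \<alpha> \<beta> g \<phi> (d k) \<ominus>\<^bsub>B\<^esub> \<phi> (d k)))
          \<le> (\<Sum>g\<in>carrier G. (1/2) ^ n)"
        using \<phi> k by (intro sum_mono) (auto simp: almost_def intro: less_imp_le)
      also have "\<dots> = N * (1/2) ^ n" by (simp add: N_def)
      finally have "cnorm B (\<phi>' (d k) \<ominus>\<^bsub>B\<^esub> \<phi> (d k)) \<le> (1/2) ^ Suc n + N * (1/2) ^ n"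
        using near[of k] k by simp
      also have "\<dots> \<le> (1 + N) * (1/2) ^ n" by (simp add: algebra_simps)
      finally show ?thesis .
    qed
    then show "\<exists>\<phi>'. almost (Suc n) \<phi>' \<and>
        (\<forall>k\<le>n. cnorm B (\<phi>' (d k) \<ominus>\<^bsub>B\<^esub> \<phi> (d k)) \<le> (1 + N) * (1/2) ^ n)"
      using \<phi>' by blast
  qed
  then obtain \<phi> where almost: "\<And>n. almost n (\<phi> n)"
    and step: "\<And>n k. k \<le> n \<Longrightarrow> cnorm B (\<phi> (Suc n) (d k) \<ominus>\<^bsub>B\<^esub> \<phi> n (d k)) \<le> (1 + N) * (1/2) ^ n"
    by blast
  have \<phi>\<Phi>: "\<phi> n \<in> \<Phi>" for n using almost by (simp add: almost_def)
  note \<phi>hom = \<Phi>_hom[OF \<phi>\<Phi>]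
  have \<phi>c [simp]: "\<phi> n a \<in> carrier B" if "a \<in> carrier A" for n a
    using cstar_hom.hom_closed[OF \<phi>hom that] .
  have \<phi>lip: "cnorm B (\<phi> n x \<ominus>\<^bsub>B\<^esub> \<phi> n y) \<le> 2 * cnorm A (x \<ominus>\<^bsub>A\<^esub> y)"
    if "x \<in> carrier A" "y \<in> carrier A" for n x y
    using cstar_hom.hom_bounded[OF \<phi>hom, of "x \<ominus>\<^bsub>A\<^esub> y" n] that
    by (simp add: cstar_hom.hom_diff[OF \<phi>hom])
  have "\<exists>b. asymp_eq B sequentially (\<lambda>n. \<phi> n a) (\<lambda>_. b)" if a: "a \<in> carrier A" for a
  proof -
    have "\<exists>K. \<forall>m\<ge>K. \<forall>n\<ge>K. cnorm B (\<phi> m a \<ominus>\<^bsub>B\<^esub> \<phi> n a) < e" if e: "e > 0" for e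
    proof -
      \<comment> \<open>Moving from \<open>a\<close> to \<open>d k\<close> and back costs twice \<open>2e/6\<close>, and the Cauchy estimate at \<open>d k\<close> costs \<open>e/3\<close>.\<close>
      obtain k where k: "cnorm A (a \<ominus>\<^bsub>A\<^esub> d k) < e / 6" using dense[OF a, of "e / 6"] e by auto
      have summable: "summable (\<lambda>n. (1 + N) * (1/2) ^ n)"
        by (intro summable_mult summable_geometric) simp
      have "\<exists>K. \<forall>m\<ge>K. \<forall>n\<ge>K. cnorm B (\<phi> m (d k) \<ominus>\<^bsub>B\<^esub> \<phi> n (d k)) < e / 3"
        by (rule B.B.Cauchy_of_summable_steps[OF _ summable step]) (use d e in auto)
      then obtain K where K: "\<And>m n. m \<ge> K \<Longrightarrow> n \<ge> K \<Longrightarrow> cnorm B (\<phi> m (d k) \<ominus>\<^bsub>B\<^esub> \<phi> n (d k)) < e / 3"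
        by blast
      have "cnorm B (\<phi> m a \<ominus>\<^bsub>B\<^esub> \<phi> n a) < e" if "m \<ge> K" "n \<ge> K" for m n
        using K[OF that] k \<phi>lip[OF a d, of m k] \<phi>lip[OF a d, of n k]
          B.B.cnorm_diff_trans[of "\<phi> m a" "\<phi> m (d k)" "\<phi> n a"]
          B.B.cnorm_diff_trans[of "\<phi> m (d k)" "\<phi> n (d k)" "\<phi> n a"]
          B.B.cnorm_diff_commute[of "\<phi> n (d k)" "\<phi> n a"] a d by simp
      then show ?thesis by blast
    qed
    then show ?thesis using B.B.Cauchy_limit[of "\<lambda>n. \<phi> n a"] a by (metis \<phi>c)
  qed
  then obtain \<psi>\<^sub>0 where \<psi>\<^sub>0: "\<And>a. a \<in> carrier A \<Longrightarrow> asymp_eq B sequentially (\<lambda>n. \<phi> n a) (\<lambda>_. \<psi>\<^sub>0 a)"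
    by metis
  define \<psi> where "\<psi> = restrict \<psi>\<^sub>0 (carrier A)"
  have lim: "asymp_eq B sequentially (\<lambda>n. \<phi> n a) (\<lambda>_. \<psi> a)" if "a \<in> carrier A" for a
    using \<psi>\<^sub>0[OF that] that by (simp add: \<psi>_def)
  have \<psi>: "\<psi> \<in> star_hom A B"
    by (rule pointwise_limit_star_hom[OF A.B.cstar_algebra_axioms B.B.cstar_algebra_axioms _ lim])
      (use \<phi>\<Phi> \<Phi> in \<open>auto simp: \<psi>_def extensional_def\<close>)
  interpret \<psi>: cstar_hom A B \<psi>
    by (intro cstar_hom.intro cstar_hom_axioms.intro A.B.cstar_algebra_axioms
        B.B.cstar_algebra_axioms \<psi>)
  have twist_dense: "twist G \<alpha> \<beta> g \<psi> (d k) = \<psi> (d k)" if g: "g \<in> carrier G" for g k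
  proof (rule B.B.limit_unique[OF _ lim[OF d]])
    have tw: "asymp_eq B sequentially (\<lambda>n. twist G \<alpha> \<beta> g (\<phi> n) (d k)) (\<lambda>_. twist G \<alpha> \<beta> g \<psi> (d k))"
      unfolding twist_def using g d
      by (intro cstar_hom.hom_asymp_eq[OF B.act_cstar_hom] lim) auto
    have "asymp_eq B sequentially (\<lambda>n. \<phi> n (d k)) (\<lambda>n. twist G \<alpha> \<beta> g (\<phi> n) (d k))"
    proof -
      have "\<forall>\<^sub>F n in sequentially. norm (cnorm B (twist G \<alpha> \<beta> g (\<phi> n) (d k) \<ominus>\<^bsub>B\<^esub> \<phi> n (d k))) \<le> (1/2) ^ n"
        using eventually_ge_at_top[of k]
      proof eventually_elim
        case (elim n)
        then show ?case
          using almost[of n] g d B.B.asymp_eqD(1)[OF tw, of n]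
          by (auto simp: almost_def intro: less_imp_le)
      qed
      then have "((\<lambda>n. cnorm B (twist G \<alpha> \<beta> g (\<phi> n) (d k) \<ominus>\<^bsub>B\<^esub> \<phi> n (d k))) \<longlongrightarrow> 0) sequentially"
        by (rule Lim_null_comparison) (simp add: LIMSEQ_realpow_zero)
      then have "asymp_eq B sequentially (\<lambda>n. twist G \<alpha> \<beta> g (\<phi> n) (d k)) (\<lambda>n. \<phi> n (d k))"
        using B.B.asymp_eqD(1)[OF tw] d by (simp add: asymp_eq_def)
      then show ?thesis by (rule B.B.asymp_eq_sym)
    qed
    then show "asymp_eq B sequentially (\<lambda>n. \<phi> n (d k)) (\<lambda>_. twist G \<alpha> \<beta> g \<psi> (d k))"
      using tw by (rule B.B.asymp_eq_trans)
  qed simp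
  have twist: "twist G \<alpha> \<beta> g \<psi> a = \<psi> a" if g: "g \<in> carrier G" and a: "a \<in> carrier A" for g a
  proof -
    let ?t = "twist G \<alpha> \<beta> g \<psi>"
    interpret h: cstar_hom B B "\<beta> g" by (rule B.act_cstar_hom[OF g])
    interpret l: cstar_hom A A "\<alpha> (inv\<^bsub>G\<^esub> g)" using g by (intro A.act_cstar_hom) simp
    have tc: "?t x \<in> carrier B" if "x \<in> carrier A" for x
      using that by (auto simp: twist_def)
    have tlip: "cnorm B (?t x \<ominus>\<^bsub>B\<^esub> ?t y) \<le> 8 * cnorm A (x \<ominus>\<^bsub>A\<^esub> y)"
      if x: "x \<in> carrier A" and y: "y \<in> carrier A" for x y
    proof -
      let ?z = "x \<ominus>\<^bsub>A\<^esub> y"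
      have "cnorm B (\<beta> g (\<psi> (\<alpha> (inv\<^bsub>G\<^esub> g) ?z))) \<le> 8 * cnorm A ?z"
        using h.hom_bounded[of "\<psi> (\<alpha> (inv\<^bsub>G\<^esub> g) ?z)"] \<psi>.hom_bounded[of "\<alpha> (inv\<^bsub>G\<^esub> g) ?z"]
          l.hom_bounded[of ?z] x y by simp
      then show ?thesis using x y by (simp add: twist_def h.hom_diff \<psi>.hom_diff l.hom_diff)
    qed
    have "cnorm B (?t a \<ominus>\<^bsub>B\<^esub> \<psi> a) < e" if e: "e > 0" for e
    proof -
      \<comment> \<open>The factor \<open>10 = 8 + 2\<close> adds the bounds of the twist (three homomorphisms) and of \<open>\<psi>\<close>.\<close>
      obtain k where k: "cnorm A (a \<ominus>\<^bsub>A\<^esub> d k) < e / 10" using dense[OF a, of "e / 10"] e by auto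
      have "cnorm B (\<psi> (a \<ominus>\<^bsub>A\<^esub> d k)) \<le> 2 * cnorm A (a \<ominus>\<^bsub>A\<^esub> d k)"
        using a d by (intro \<psi>.hom_bounded) auto
      then have "cnorm B (\<psi> a \<ominus>\<^bsub>B\<^esub> \<psi> (d k)) \<le> 2 * cnorm A (a \<ominus>\<^bsub>A\<^esub> d k)"
        using a d by (simp add: \<psi>.hom_diff)
      then show ?thesis
        using k tlip[OF a d, of k] twist_dense[OF g, of k]
          B.B.cnorm_diff_trans[of "?t a" "?t (d k)" "\<psi> a"]
          B.B.cnorm_diff_commute[of "\<psi> a" "\<psi> (d k)"] tc[OF a] a d by simp
    qed
    then have "cnorm B (?t a \<ominus>\<^bsub>B\<^esub> \<psi> a) = 0"
      using tc[OF a] a by (meson B.B.M.minus_closed B.B.cnorm_nonneg \<psi>.hom_closed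
          dual_order.antisym field_le_epsilon less_eq_real_def linorder_not_le)
    then show ?thesis using tc[OF a] a by (simp add: B.B.cnorm_diff_eq_zero)
  qed
  have equivariant: "\<psi> (\<alpha> g a) = \<beta> g (\<psi> a)" if g: "g \<in> carrier G" and a: "a \<in> carrier A" for g a
    using twist[OF g, of "\<alpha> g a"] g a by (simp add: twist_def)
  have approx: "\<exists>\<phi>\<in>\<Phi>. \<forall>a\<in>M. cnorm B (\<psi> a \<ominus>\<^bsub>B\<^esub> \<phi> a) < \<epsilon>"
    if "\<epsilon> > 0" "finite M" "M \<subseteq> carrier A" for M \<epsilon>
  proof -
    have "\<forall>\<^sub>F n in sequentially. \<forall>a\<in>M. cnorm B (\<phi> n a \<ominus>\<^bsub>B\<^esub> \<psi> a) < \<epsilon>"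
      using that order_tendstoD(2)[OF B.B.asymp_eqD(3)[OF lim], of _ \<epsilon>]
      by (intro eventually_ball_finite ballI) auto
    then obtain n where n: "\<forall>a\<in>M. cnorm B (\<phi> n a \<ominus>\<^bsub>B\<^esub> \<psi> a) < \<epsilon>"
      using eventually_happens'[OF sequentially_bot] by blast
    have "cnorm B (\<psi> a \<ominus>\<^bsub>B\<^esub> \<phi> n a) < \<epsilon>" if "a \<in> M" for a
      using n that \<open>M \<subseteq> carrier A\<close> B.B.cnorm_diff_commute[of "\<psi> a" "\<phi> n a"] by auto
    then show ?thesis using \<phi>\<Phi> by blast
  qed
  show thesis by (rule that[OF \<psi> equivariant approx])
qed

end

section \<open>Equivariant categories\<close>

lemma category_full_subcategory:
  assumes "category C" "S \<subseteq> Obj C" shows "category (full_subcategory C S)"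
proof -
  interpret category C by fact
  show ?thesis
    by unfold_locales (use assms(2) in
        \<open>auto simp: full_subcategory_def subset_iff Id_in_Hom Comp_in_Hom Id_left Id_right Comp_assoc\<close>)
qed

lemma functor_full_subcategory:
  assumes "is_functor C D F" "S \<subseteq> Obj C" shows "is_functor (full_subcategory C S) D F"
proof -
  interpret is_functor C D F by fact
  interpret sub: category "full_subcategory C S"
    using S.category_axioms assms(2) by (rule category_full_subcategory)
  show ?thesis
    by unfold_locales (use assms(2) in
        \<open>auto simp: full_subcategory_def subset_iff fobj_in_Obj fmor_in_Hom fmor_Id fmor_Comp\<close>)
qed

lemma equivariant_category_simps:
  "(x, \<alpha>) \<in> Obj (equivariant_category G C) \<longleftrightarrow>
    x \<in> Obj C \<and> \<alpha> \<in> hom G (Aut_group C x) \<inter> extensional (carrier G)"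
  "f \<in> Hom (equivariant_category G C) (x, \<alpha>) (y, \<beta>) \<longleftrightarrow>
    f \<in> Hom C x y \<and> (\<forall>g\<in>carrier G. Comp C x x y f (\<alpha> g) = Comp C x y y (\<beta> g) f)"
  "Comp (equivariant_category G C) (x, \<alpha>) (y, \<beta>) (z, \<gamma>) = Comp C x y z"
  "Id (equivariant_category G C) (x, \<alpha>) = Id C x"
  by (simp_all add: equivariant_category_def)

lemma Aut_group_simps:
  "f \<in> carrier (Aut_group C x) \<longleftrightarrow>
    f \<in> Hom C x x \<and> (\<exists>k\<in>Hom C x x. Comp C x x x k f = Id C x \<and> Comp C x x x f k = Id C x)"
  "f \<otimes>\<^bsub>Aut_group C x\<^esub> k = Comp C x x x f k"
  by (simp_all add: Aut_group_def)

lemma action_in_Hom: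
  assumes "(x, \<alpha>) \<in> Obj (equivariant_category G C)" "g \<in> carrier G"
  shows "\<alpha> g \<in> Hom C x x" "\<alpha> g \<in> carrier (Aut_group C x)"
proof -
  show "\<alpha> g \<in> carrier (Aut_group C x)"
    using assms by (auto simp: equivariant_category_simps hom_def)
  then show "\<alpha> g \<in> Hom C x x" by (simp add: Aut_group_simps)
qed

lemma category_equivariant:
  assumes "category C" shows "category (equivariant_category G C)"
proof -
  interpret category C by fact
  have Obj: "fst x \<in> Obj C" "\<And>g. g \<in> carrier G \<Longrightarrow> snd x g \<in> Hom C (fst x) (fst x)"
    if "x \<in> Obj (equivariant_category G C)" for x
    using that action_in_Hom(1)[of "fst x" "snd x" G C]
    by (cases x; simp add: equivariant_category_simps)+
  show ?thesis
  proof
    fix x assume "x \<in> Obj (equivariant_category G C)"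
    then show "Id (equivariant_category G C) x \<in> Hom (equivariant_category G C) x x"
      using Obj[of x] by (cases x) (simp add: equivariant_category_simps Id_in_Hom Id_left Id_right)
  next
    fix x y z f g
    assume xyz: "x \<in> Obj (equivariant_category G C)" "y \<in> Obj (equivariant_category G C)"
        "z \<in> Obj (equivariant_category G C)"
      and f: "f \<in> Hom (equivariant_category G C) x y" and g: "g \<in> Hom (equivariant_category G C) y z"
    obtain x' \<alpha> y' \<beta> z' \<gamma> where [simp]: "x = (x', \<alpha>)" "y = (y', \<beta>)" "z = (z', \<gamma>)"
      by (metis surj_pair)
    note fg = f[simplified equivariant_category_simps \<open>x = _\<close> \<open>y = _\<close>]
      g[simplified equivariant_category_simps \<open>y = _\<close> \<open>z = _\<close>]
    have O: "x' \<in> Obj C" "y' \<in> Obj C" "z' \<in> Obj C" using Obj(1) xyz by fastforce+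
    have "Comp C x' x' z' (Comp C x' y' z' g f) (\<alpha> h) = Comp C x' z' z' (\<gamma> h) (Comp C x' y' z' g f)"
      if h: "h \<in> carrier G" for h
    proof -
      have H: "\<alpha> h \<in> Hom C x' x'" "\<beta> h \<in> Hom C y' y'" "\<gamma> h \<in> Hom C z' z'"
        using Obj(2) xyz h by fastforce+
      have "Comp C x' x' z' (Comp C x' y' z' g f) (\<alpha> h) = Comp C x' y' z' g (Comp C x' x' y' f (\<alpha> h))"
        using O H fg by (simp add: Comp_assoc)
      also have "\<dots> = Comp C x' y' z' (Comp C y' y' z' g (\<beta> h)) f"
        using O H fg h by (simp add: Comp_assoc)
      also have "\<dots> = Comp C x' z' z' (\<gamma> h) (Comp C x' y' z' g f)"
        using O H fg h by (simp add: Comp_assoc)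
      finally show ?thesis .
    qed
    then show "Comp (equivariant_category G C) x y z g f \<in> Hom (equivariant_category G C) x z"
      using fg O by (simp add: equivariant_category_simps Comp_in_Hom)
  next
    fix x y f
    assume xy: "x \<in> Obj (equivariant_category G C)" "y \<in> Obj (equivariant_category G C)"
      and f: "f \<in> Hom (equivariant_category G C) x y"
    show "Comp (equivariant_category G C) x y y (Id (equivariant_category G C) y) f = f"
      "Comp (equivariant_category G C) x x y f (Id (equivariant_category G C) x) = f"
      using Obj(1) xy f
      by (cases x, cases y, fastforce simp: equivariant_category_simps Id_left Id_right)+
  next
    fix w x y z f g h
    assume "w \<in> Obj (equivariant_category G C)" "x \<in> Obj (equivariant_category G C)"
      "y \<in> Obj (equivariant_category G C)" "z \<in> Obj (equivariant_category G C)"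
      "f \<in> Hom (equivariant_category G C) w x" "g \<in> Hom (equivariant_category G C) x y"
      "h \<in> Hom (equivariant_category G C) y z"
    then show "Comp (equivariant_category G C) w y z h (Comp (equivariant_category G C) w x y g f)
      = Comp (equivariant_category G C) w x z (Comp (equivariant_category G C) x y z h g) f"
      using Obj(1)
      by (cases w, cases x, cases y, cases z) (fastforce simp: equivariant_category_simps Comp_assoc)
  qed
qed

lemma functor_equivariant:
  assumes "group G" "is_functor C D F"
  shows "is_functor (equivariant_category G C) (equivariant_category G D) (equivariant_functor G F)"
proof -
  interpret group G by fact
  interpret is_functor C D F by fact
  interpret CG: category "equivariant_category G C"
    by (rule category_equivariant[OF S.category_axioms])
  interpret DG: category "equivariant_category G D"
    by (rule category_equivariant[OF T.category_axioms])
  let ?C = "equivariant_category G C" and ?D = "equivariant_category G D"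
  let ?F = "equivariant_functor G F"
  have fobj: "fobj ?F (x, \<alpha>) = (fobj F x, \<lambda>g\<in>carrier G. fmor F x x (\<alpha> g))"
    and fmor: "fmor ?F (x, \<alpha>) (y, \<beta>) = fmor F x y" for x \<alpha> y \<beta>
    by (simp_all add: equivariant_functor_def)
  show ?thesis
  proof
    fix x assume "x \<in> Obj ?C"
    then obtain a \<alpha> where x: "x = (a, \<alpha>)" "(a, \<alpha>) \<in> Obj ?C" by (cases x) auto
    then have a: "a \<in> Obj C" and \<alpha>: "\<alpha> \<in> hom G (Aut_group C a)"
      by (simp_all add: equivariant_category_simps)
    have "(\<lambda>g\<in>carrier G. fmor F a a (\<alpha> g)) \<in> hom G (Aut_group D (fobj F a))"
    proof (rule homI)
      fix g assume g: "g \<in> carrier G"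
      obtain k where k: "k \<in> Hom C a a" "Comp C a a a k (\<alpha> g) = Id C a" "Comp C a a a (\<alpha> g) k = Id C a"
        using action_in_Hom(2)[OF x(2) g] by (auto simp: Aut_group_simps)
      note \<alpha>g = action_in_Hom(1)[OF x(2) g]
      show "(\<lambda>g\<in>carrier G. fmor F a a (\<alpha> g)) g \<in> carrier (Aut_group D (fobj F a))"
        using g a \<alpha>g k fmor_Comp[OF a a a \<alpha>g k(1)] fmor_Comp[OF a a a k(1) \<alpha>g]
        by (auto simp: Aut_group_simps fmor_in_Hom fmor_Id intro!: bexI[of _ "fmor F a a k"])
      fix h assume h: "h \<in> carrier G"
      have "\<alpha> (g \<otimes>\<^bsub>G\<^esub> h) = Comp C a a a (\<alpha> g) (\<alpha> h)"
        using \<alpha> g h by (simp add: hom_def Aut_group_simps)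
      then show "(\<lambda>g\<in>carrier G. fmor F a a (\<alpha> g)) (g \<otimes>\<^bsub>G\<^esub> h)
        = (\<lambda>g\<in>carrier G. fmor F a a (\<alpha> g)) g \<otimes>\<^bsub>Aut_group D (fobj F a)\<^esub> (\<lambda>g\<in>carrier G. fmor F a a (\<alpha> g)) h"
        using g h fmor_Comp[OF a a a action_in_Hom(1)[OF x(2) h] \<alpha>g] by (simp add: Aut_group_simps)
    qed
    then show "fobj ?F x \<in> Obj ?D"
      using a by (simp add: x(1) fobj equivariant_category_simps fobj_in_Obj)
    show "fmor ?F x x (Id ?C x) = Id ?D (fobj ?F x)"
      using a by (simp add: x(1) fobj fmor equivariant_category_simps fmor_Id)
  next
    fix x y f assume xy: "x \<in> Obj ?C" "y \<in> Obj ?C" and f: "f \<in> Hom ?C x y"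
    obtain a \<alpha> b \<beta> where [simp]: "x = (a, \<alpha>)" "y = (b, \<beta>)" by (metis surj_pair)
    have ab: "a \<in> Obj C" "b \<in> Obj C" using xy by (simp_all add: equivariant_category_simps)
    have f': "f \<in> Hom C a b" using f by (simp add: equivariant_category_simps)
    have "Comp D (fobj F a) (fobj F a) (fobj F b) (fmor F a b f) (fmor F a a (\<alpha> g))
        = Comp D (fobj F a) (fobj F b) (fobj F b) (fmor F b b (\<beta> g)) (fmor F a b f)"
      if g: "g \<in> carrier G" for g
    proof -
      have "\<alpha> g \<in> Hom C a a" "\<beta> g \<in> Hom C b b" using action_in_Hom(1) xy g by fastforce+
      then show ?thesis
        using f f' g ab fmor_Comp[of a a b "\<alpha> g" f] fmor_Comp[of a b b f "\<beta> g"]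
        by (simp add: equivariant_category_simps)
    qed
    then show "fmor ?F x y f \<in> Hom ?D (fobj ?F x) (fobj ?F y)"
      using ab f' by (simp add: fobj fmor equivariant_category_simps fmor_in_Hom)
  next
    fix x y z f g
    assume "x \<in> Obj ?C" "y \<in> Obj ?C" "z \<in> Obj ?C" "f \<in> Hom ?C x y" "g \<in> Hom ?C y z"
    then show "fmor ?F x z (Comp ?C x y z g f)
      = Comp ?D (fobj ?F x) (fobj ?F y) (fobj ?F z) (fmor ?F y z g) (fmor ?F x y f)"
      by (cases x, cases y, cases z)
        (simp add: fobj fmor equivariant_category_simps fmor_Comp)
  qed
qed

section \<open>Classification of equivariant homomorphisms\<close>

locale cstar_subcategory =
  fixes G :: "('g, 'z) monoid_scheme" and S :: "'a cstar set" and \<B> :: "('a cstar, 'a \<Rightarrow> 'a) cat"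
  assumes group: "group G" and finite_group: "finite (carrier G)"
    and objects: "S \<subseteq> Obj separable_cstar_category"
    and \<B>: "\<B> = full_subcategory separable_cstar_category S"
begin

lemma \<B>_simps [simp]:
  "Obj \<B> = S" "Hom \<B> = star_hom" "Comp \<B> A B C g f = compose (carrier A) g f"
  "Id \<B> A = (\<lambda>x\<in>carrier A. x)"
  by (simp_all add: \<B> full_subcategory_def separable_cstar_category_def)

lemma separable: "A \<in> S \<Longrightarrow> separable_cstar A"
  using objects by (auto simp: separable_cstar_category_def)

lemma cstar: "A \<in> S \<Longrightarrow> cstar_algebra A"
  using separable by (simp add: separable_cstar_def)

lemma object_cstar_action:
  assumes "(A, \<alpha>) \<in> Obj (equivariant_category G \<B>)" shows "cstar_action G A \<alpha>"
proof -
  interpret G: group G by (rule group)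
  have A: "A \<in> S" and hom: "\<alpha> \<in> hom G (Aut_group \<B> A)"
    using assms by (simp_all add: equivariant_category_simps)
  have \<alpha>: "\<alpha> g \<in> star_hom A A" if "g \<in> carrier G" for g
    using action_in_Hom(1)[OF assms that] by simp
  have mult: "\<alpha> (g \<otimes>\<^bsub>G\<^esub> h) x = \<alpha> g (\<alpha> h x)"
    if "g \<in> carrier G" "h \<in> carrier G" "x \<in> carrier A" for g h x
    using hom that by (simp add: hom_def Aut_group_simps compose_eq)
  have one: "\<alpha> \<one>\<^bsub>G\<^esub> x = x" if x: "x \<in> carrier A" for x
  proof -
    \<comment> \<open>An idempotent with a left inverse is the identity.\<close>
    obtain k where k: "compose (carrier A) k (\<alpha> \<one>\<^bsub>G\<^esub>) = (\<lambda>x\<in>carrier A. x)"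
      using action_in_Hom(2)[OF assms G.one_closed] by (auto simp: Aut_group_simps)
    have inv: "k (\<alpha> \<one>\<^bsub>G\<^esub> y) = y" if "y \<in> carrier A" for y
      using fun_cong[OF k, of y] that by (simp add: compose_eq)
    have \<alpha>x: "\<alpha> \<one>\<^bsub>G\<^esub> x \<in> carrier A" using star_homD(1)[OF \<alpha>[OF G.one_closed] x] .
    have "\<alpha> \<one>\<^bsub>G\<^esub> (\<alpha> \<one>\<^bsub>G\<^esub> x) = \<alpha> \<one>\<^bsub>G\<^esub> x" using mult[OF G.one_closed G.one_closed x] by simp
    then show ?thesis using inv[OF \<alpha>x] inv[OF x] by simp
  qed
  show ?thesis
    using \<alpha> mult one
    by (intro cstar_action.intro cstar_action_axioms.intro group cstar[OF A] finite_group)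
qed

lemma morphism_equivariant:
  assumes "\<phi> \<in> Hom (equivariant_category G \<B>) (A, \<alpha>) (B, \<beta>)" "g \<in> carrier G" "a \<in> carrier A"
  shows "\<phi> (\<alpha> g a) = \<beta> g (\<phi> a)"
proof -
  have "compose (carrier A) \<phi> (\<alpha> g) = compose (carrier A) (\<beta> g) \<phi>"
    using assms by (simp add: equivariant_category_simps)
  from fun_cong[OF this, of a] show ?thesis using assms(3) by (simp add: compose_eq)
qed

lemma approx_unitary_equiv_iff:
  assumes "B \<in> S" "\<phi> \<in> star_hom A B" "\<psi> \<in> star_hom A B"
  shows "approx_unitary_equiv A B \<phi> \<psi> \<longleftrightarrow> (\<forall>M \<epsilon>. \<epsilon> > 0 \<and> finite M \<and> M \<subseteq> carrier A \<longrightarrow>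
    (\<exists>b. quasi_unitary B b \<and> (\<forall>a\<in>M. cnorm B (\<phi> a \<ominus>\<^bsub>B\<^esub> conj_by B b (\<psi> a)) < \<epsilon>)))"
  unfolding approx_unitary_equiv_def
  using approx_equiv_by_iff[OF subset_refl _ cstar[OF assms(1)] cstar[OF assms(1)], of \<phi> A \<psi>]
    star_homD(1)[OF assms(2)] star_homD(1)[OF assms(3)] by auto

lemma G_approx_unitary_equiv_iff:
  assumes "(B, \<beta>) \<in> Obj (equivariant_category G \<B>)" "\<phi> \<in> star_hom A B" "\<psi> \<in> star_hom A B"
  shows "G_approx_unitary_equiv G (A, \<alpha>) (B, \<beta>) \<phi> \<psi> \<longleftrightarrow>
    (\<forall>M \<epsilon>. \<epsilon> > 0 \<and> finite M \<and> M \<subseteq> carrier A \<longrightarrow> (\<exists>b. quasi_unitary (fixed_point_algebra G B \<beta>) b \<and>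
      (\<forall>a\<in>M. cnorm B (\<phi> a \<ominus>\<^bsub>B\<^esub> conj_by B b (\<psi> a)) < \<epsilon>)))"
proof -
  interpret cstar_action G B \<beta> using assms(1) by (rule object_cstar_action)
  show ?thesis
    unfolding G_approx_unitary_equiv_def split
    using star_homD(1)[OF assms(2)] star_homD(1)[OF assms(3)]
    by (intro approx_equiv_by_iff[OF _ fixed_point_algebra_def Fix_cstar_algebra
          B.cstar_algebra_axioms]) auto
qed

lemma G_approx_unitary_equiv_imp:
  assumes "(B, \<beta>) \<in> Obj (equivariant_category G \<B>)" "\<phi> \<in> star_hom A B" "\<psi> \<in> star_hom A B"
    and "G_approx_unitary_equiv G (A, \<alpha>) (B, \<beta>) \<phi> \<psi>"
  shows "approx_unitary_equiv A B \<phi> \<psi>"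
proof -
  interpret cstar_action G B \<beta> using assms(1) by (rule object_cstar_action)
  have "B \<in> S" using assms(1) by (simp add: equivariant_category_simps)
  then show ?thesis
    using assms(4) unfolding G_approx_unitary_equiv_iff[OF assms(1-3)]
      approx_unitary_equiv_iff[OF \<open>B \<in> S\<close> assms(2,3)] Fix_quasi_unitary by blast
qed

end

locale classifying_functor = cstar_subcategory G S \<B>
  for G :: "('g, 'z) monoid_scheme" and S :: "'a cstar set" and \<B> :: "('a cstar, 'a \<Rightarrow> 'a) cat" +
  fixes \<C> :: "('o, 'm) cat" and F :: "('a cstar, 'a \<Rightarrow> 'a, 'o, 'm) funct"
  assumes classifies: "classifies_homs \<B> \<C> F approx_unitary_equiv"
begin

sublocale F: is_functor \<B> \<C> F
  using classifies by (simp add: classifies_homs_def)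

lemma classify_existence:
  assumes "A \<in> S" "B \<in> S" "\<gamma> \<in> Hom \<C> (fobj F A) (fobj F B)"
  obtains \<phi> where "\<phi> \<in> star_hom A B" "fmor F A B \<phi> = \<gamma>"
proof -
  have "\<exists>\<phi>\<in>star_hom A B. fmor F A B \<phi> = \<gamma>"
    using classifies assms unfolding classifies_homs_def by simp
  then show thesis using that by blast
qed

lemma classify_uniqueness:
  assumes "A \<in> S" "B \<in> S" "\<phi> \<in> star_hom A B" "\<psi> \<in> star_hom A B"
  shows "fmor F A B \<phi> = fmor F A B \<psi> \<longleftrightarrow> approx_unitary_equiv A B \<phi> \<psi>"
  using classifies assms unfolding classifies_homs_def by simp

text \<open>Lift \<open>\<gamma>\<close> to some \<open>\<phi>\<close>. As \<open>\<gamma>\<close> is equivariant, \<open>F\<close> cannot distinguish \<open>\<phi>\<close> from its twists, so that these are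
  approximately unitarily equivalent to \<open>\<phi>\<close>. The maps that lift \<open>\<gamma>\<close> form a class to which the
  limit theorem applies, and a pointwise limit of such maps is again approximately unitarily
  equivalent to them.\<close>

theorem equivariant_lift:
  assumes Ao: "(A, \<alpha>) \<in> Obj (equivariant_category G \<B>)"
    and Bo: "(B, \<beta>) \<in> Obj (equivariant_category G \<B>)" and rokhlin: "rokhlin_property G B \<beta>"
    and \<gamma>: "\<gamma> \<in> Hom \<C> (fobj F A) (fobj F B)"
    and eq: "\<And>g. g \<in> carrier G \<Longrightarrow> Comp \<C> (fobj F A) (fobj F A) (fobj F B) \<gamma> (fmor F A A (\<alpha> g))
      = Comp \<C> (fobj F A) (fobj F B) (fobj F B) (fmor F B B (\<beta> g)) \<gamma>"
  obtains \<psi> where "\<psi> \<in> Hom (equivariant_category G \<B>) (A, \<alpha>) (B, \<beta>)" "fmor F A B \<psi> = \<gamma>"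
proof -
  interpret A: cstar_action G A \<alpha> using Ao by (rule object_cstar_action)
  interpret B: cstar_action G B \<beta> using Bo by (rule object_cstar_action)
  interpret cstar_actions G A \<alpha> B \<beta> ..
  have AS: "A \<in> S" and BS: "B \<in> S" using Ao Bo by (simp_all add: equivariant_category_simps)
  define \<Phi> where "\<Phi> = {\<phi> \<in> star_hom A B. fmor F A B \<phi> = \<gamma>}"
  obtain \<phi>\<^sub>0 where \<phi>\<^sub>0: "\<phi>\<^sub>0 \<in> \<Phi>" using classify_existence[OF AS BS \<gamma>] unfolding \<Phi>_def by blast
  have au: "\<exists>b. quasi_unitary B b \<and>
      (\<forall>a\<in>M. cnorm B (twist G \<alpha> \<beta> g \<phi> a \<ominus>\<^bsub>B\<^esub> conj_by B b (\<phi> a)) < \<epsilon>)"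
    if \<phi>: "\<phi> \<in> \<Phi>" and g: "g \<in> carrier G" and "\<epsilon> > 0" "finite M" "M \<subseteq> carrier A" for \<phi> g M \<epsilon>
  proof -
    have g': "inv\<^bsub>G\<^esub> g \<in> carrier G" using g by simp
    have homs: "\<phi> \<in> Hom \<B> A B" "\<alpha> (inv\<^bsub>G\<^esub> g) \<in> Hom \<B> A A" "\<beta> g \<in> Hom \<B> B B"
        "\<beta> (inv\<^bsub>G\<^esub> g) \<in> Hom \<B> B B"
      using \<phi> A.act_hom[OF g'] B.act_hom[OF g] B.act_hom[OF g'] by (simp_all add: \<Phi>_def)
    have AO: "A \<in> Obj \<B>" and BO: "B \<in> Obj \<B>" using AS BS by simp_all
    let ?FA = "fobj F A" and ?FB = "fobj F B"
    let ?inner = "Comp \<B> A A B \<phi> (\<alpha> (inv\<^bsub>G\<^esub> g))"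
    let ?\<tau> = "Comp \<B> A B B (\<beta> g) ?inner"
    have inner: "?inner \<in> Hom \<B> A B" using F.S.Comp_in_Hom[OF AO AO BO homs(2,1)] .
    have \<tau>: "?\<tau> \<in> Hom \<B> A B" using F.S.Comp_in_Hom[OF AO BO BO inner homs(3)] .
    have "fmor F A B ?\<tau> = Comp \<C> ?FA ?FB ?FB (fmor F B B (\<beta> g))
        (Comp \<C> ?FA ?FA ?FB \<gamma> (fmor F A A (\<alpha> (inv\<^bsub>G\<^esub> g))))"
      using F.fmor_Comp[OF AO BO BO inner homs(3)] F.fmor_Comp[OF AO AO BO homs(2,1)] \<phi>
      by (simp add: \<Phi>_def)
    also have "\<dots> = Comp \<C> ?FA ?FB ?FB (fmor F B B (\<beta> g))
        (Comp \<C> ?FA ?FB ?FB (fmor F B B (\<beta> (inv\<^bsub>G\<^esub> g))) \<gamma>)"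
      using eq[OF g'] by simp
    also have "\<dots> = Comp \<C> ?FA ?FB ?FB
        (Comp \<C> ?FB ?FB ?FB (fmor F B B (\<beta> g)) (fmor F B B (\<beta> (inv\<^bsub>G\<^esub> g)))) \<gamma>"
      using AO BO homs \<gamma> by (intro F.T.Comp_assoc F.fobj_in_Obj F.fmor_in_Hom)
    also have "Comp \<C> ?FB ?FB ?FB (fmor F B B (\<beta> g)) (fmor F B B (\<beta> (inv\<^bsub>G\<^esub> g)))
        = fmor F B B (Comp \<B> B B B (\<beta> g) (\<beta> (inv\<^bsub>G\<^esub> g)))"
      using F.fmor_Comp[OF BO BO BO homs(4,3)] by simp
    also have "Comp \<B> B B B (\<beta> g) (\<beta> (inv\<^bsub>G\<^esub> g)) = Id \<B> B"
      using g by (auto simp: compose_def restrict_def fun_eq_iff)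
    also have "Comp \<C> ?FA ?FB ?FB (fmor F B B (Id \<B> B)) \<gamma> = \<gamma>"
      using AO BO \<gamma> F.fmor_Id[OF BO] by (simp only: F.T.Id_left F.fobj_in_Obj)
    finally have "fmor F A B ?\<tau> = fmor F A B \<phi>" using \<phi> by (simp add: \<Phi>_def)
    moreover have \<tau>h: "?\<tau> \<in> star_hom A B" using \<tau> unfolding \<B>_simps(2) .
    moreover have \<phi>h: "\<phi> \<in> star_hom A B" using \<phi> by (simp add: \<Phi>_def)
    ultimately have "approx_unitary_equiv A B ?\<tau> \<phi>"
      using classify_uniqueness[OF AS BS] by blast
    then have "\<exists>b. quasi_unitary B b \<and> (\<forall>a\<in>M. cnorm B (?\<tau> a \<ominus>\<^bsub>B\<^esub> conj_by B b (\<phi> a)) < \<epsilon>)"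
      using approx_unitary_equiv_iff[OF BS \<tau>h \<phi>h] that(3-5) by blast
    moreover have "?\<tau> a = twist G \<alpha> \<beta> g \<phi> a" if "a \<in> M" for a
      using that \<open>M \<subseteq> carrier A\<close> g by (auto simp: twist_def compose_eq subset_iff)
    ultimately show ?thesis by simp
  qed
  have conj: "(\<lambda>a\<in>carrier A. conj_by B u (\<phi> a)) \<in> \<Phi>" if \<phi>: "\<phi> \<in> \<Phi>" and u: "quasi_unitary B u" for \<phi> u
  proof -
    have \<phi>': "\<phi> \<in> star_hom A B" using \<phi> by (simp add: \<Phi>_def)
    let ?\<phi>' = "\<lambda>a\<in>carrier A. conj_by B u (\<phi> a)"
    have h: "?\<phi>' \<in> star_hom A B" using A.B.cstar_algebra_axioms \<phi>' u by (rule B.B.conj_by_hom)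
    have "approx_unitary_equiv A B ?\<phi>' \<phi>"
      unfolding approx_unitary_equiv_iff[OF BS h \<phi>']
      using u B.B.quasi_unitary_closed[OF u] star_homD(1)[OF \<phi>']
      by (intro allI impI exI[of _ u]) (auto simp: subset_iff)
    then show ?thesis using classify_uniqueness[OF AS BS h \<phi>'] h \<phi> by (simp add: \<Phi>_def)
  qed
  have sub: "\<Phi> \<subseteq> star_hom A B" by (auto simp: \<Phi>_def)
  obtain \<psi> where \<psi>: "\<psi> \<in> star_hom A B"
    and equivariant: "\<And>g a. g \<in> carrier G \<Longrightarrow> a \<in> carrier A \<Longrightarrow> \<psi> (\<alpha> g a) = \<beta> g (\<psi> a)"
    and approx: "\<And>M \<epsilon>. \<epsilon> > 0 \<Longrightarrow> finite M \<Longrightarrow> M \<subseteq> carrier A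
      \<Longrightarrow> \<exists>\<phi>\<in>\<Phi>. \<forall>a\<in>M. cnorm B (\<psi> a \<ominus>\<^bsub>B\<^esub> \<phi> a) < (\<epsilon>::real)"
    using equivariant_limit[OF rokhlin separable[OF AS] sub \<phi>\<^sub>0 au conj] by blast
  have \<phi>\<^sub>0h: "\<phi>\<^sub>0 \<in> star_hom A B" using \<phi>\<^sub>0 sub by blast
  have "approx_unitary_equiv A B \<psi> \<phi>\<^sub>0"
    unfolding approx_unitary_equiv_iff[OF BS \<psi> \<phi>\<^sub>0h]
  proof (intro allI impI, elim conjE)
    fix M and \<epsilon> :: real assume M: "\<epsilon> > 0" "finite M" "M \<subseteq> carrier A"
    then obtain \<phi> where \<phi>: "\<phi> \<in> \<Phi>" and near: "\<forall>a\<in>M. cnorm B (\<psi> a \<ominus>\<^bsub>B\<^esub> \<phi> a) < \<epsilon> / 2"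
      using approx[of "\<epsilon> / 2" M] by auto
    have \<phi>h: "\<phi> \<in> star_hom A B" using \<phi> sub by blast
    have "approx_unitary_equiv A B \<phi> \<phi>\<^sub>0"
      using classify_uniqueness[OF AS BS \<phi>h \<phi>\<^sub>0h] \<phi> \<phi>\<^sub>0 by (simp add: \<Phi>_def)
    then obtain b where b: "quasi_unitary B b"
      and close: "\<forall>a\<in>M. cnorm B (\<phi> a \<ominus>\<^bsub>B\<^esub> conj_by B b (\<phi>\<^sub>0 a)) < \<epsilon> / 2"
      using M half_gt_zero[OF M(1)] unfolding approx_unitary_equiv_iff[OF BS \<phi>h \<phi>\<^sub>0h] by blast
    have "cnorm B (\<psi> a \<ominus>\<^bsub>B\<^esub> conj_by B b (\<phi>\<^sub>0 a)) < \<epsilon>" if a: "a \<in> M" for a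
    proof -
      have "a \<in> carrier A" using a M by blast
      then have "\<psi> a \<in> carrier B" "\<phi> a \<in> carrier B" "\<phi>\<^sub>0 a \<in> carrier B"
        using star_homD(1)[OF \<psi>] star_homD(1)[OF \<phi>h] star_homD(1)[OF \<phi>\<^sub>0h] by auto
      then show ?thesis
        using bspec[OF near a] bspec[OF close a] B.B.quasi_unitary_closed[OF b]
          B.B.cnorm_diff_trans[of "\<psi> a" "\<phi> a" "conj_by B b (\<phi>\<^sub>0 a)"] by simp
    qed
    then show "\<exists>b. quasi_unitary B b \<and> (\<forall>a\<in>M. cnorm B (\<psi> a \<ominus>\<^bsub>B\<^esub> conj_by B b (\<phi>\<^sub>0 a)) < \<epsilon>)"
      using b by blast
  qed
  then have "fmor F A B \<psi> = \<gamma>"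
    using classify_uniqueness[OF AS BS \<psi> \<phi>\<^sub>0h] \<phi>\<^sub>0 by (simp add: \<Phi>_def)
  moreover have "compose (carrier A) \<psi> (\<alpha> g) = compose (carrier A) (\<beta> g) \<psi>" if "g \<in> carrier G" for g
    using equivariant[OF that] by (auto simp: compose_def restrict_def fun_eq_iff)
  then have "\<psi> \<in> Hom (equivariant_category G \<B>) (A, \<alpha>) (B, \<beta>)"
    using \<psi> by (simp add: equivariant_category_simps)
  ultimately show thesis using that by blast
qed

theorem equivariant_equivalence:
  assumes Ao: "(A, \<alpha>) \<in> Obj (equivariant_category G \<B>)"
    and Bo: "(B, \<beta>) \<in> Obj (equivariant_category G \<B>)" and rokhlin: "rokhlin_property G B \<beta>"
    and \<phi>: "\<phi> \<in> Hom (equivariant_category G \<B>) (A, \<alpha>) (B, \<beta>)"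
    and \<psi>: "\<psi> \<in> Hom (equivariant_category G \<B>) (A, \<alpha>) (B, \<beta>)"
    and eq: "fmor F A B \<phi> = fmor F A B \<psi>"
  shows "G_approx_unitary_equiv G (A, \<alpha>) (B, \<beta>) \<phi> \<psi>"
proof -
  interpret A: cstar_action G A \<alpha> using Ao by (rule object_cstar_action)
  interpret B: cstar_action G B \<beta> using Bo by (rule object_cstar_action)
  interpret cstar_actions G A \<alpha> B \<beta> ..
  have AS: "A \<in> S" and BS: "B \<in> S" using Ao Bo by (simp_all add: equivariant_category_simps)
  have h: "\<phi> \<in> star_hom A B" "\<psi> \<in> star_hom A B"
    using \<phi> \<psi> by (simp_all add: equivariant_category_simps)
  have au: "\<exists>b. quasi_unitary B b \<and> (\<forall>a\<in>M. cnorm B (\<phi> a \<ominus>\<^bsub>B\<^esub> conj_by B b (\<psi> a)) < \<epsilon>)"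
    if "\<epsilon> > 0" "finite M" "M \<subseteq> carrier A" for M \<epsilon>
    using that eq classify_uniqueness[OF AS BS h] approx_unitary_equiv_iff[OF BS h] by blast
  show ?thesis
    unfolding G_approx_unitary_equiv_iff[OF Bo h]
  proof (intro allI impI, elim conjE)
    fix M and \<epsilon> :: real assume "\<epsilon> > 0" "finite M" "M \<subseteq> carrier A"
    then show "\<exists>b. quasi_unitary B.Fix b \<and> (\<forall>a\<in>M. cnorm B (\<phi> a \<ominus>\<^bsub>B\<^esub> conj_by B b (\<psi> a)) < \<epsilon>)"
      using star_homD(1)[OF h(1)] star_homD(1)[OF h(2)] morphism_equivariant[OF \<phi>]
        morphism_equivariant[OF \<psi>]
      by (intro equivariant_uniqueness[OF rokhlin _ _ _ _ au]) auto
  qed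
qed

end

theorem theorem3p2:
  fixes G :: "('g, 'z) monoid_scheme"
    and \<S> :: "'a cstar set"
    and \<B> :: "('a cstar, 'a \<Rightarrow> 'a) cat"
    and \<C> :: "('o, 'm) cat"
    and F :: "('a cstar, 'a \<Rightarrow> 'a, 'o, 'm) funct"
  assumes "group G" and "finite (carrier G)"
    and "\<S> \<subseteq> Obj separable_cstar_category"
    and "\<B> = full_subcategory separable_cstar_category \<S>"
    and "category \<C>"
    and "classifies_homs \<B> \<C> F approx_unitary_equiv"
  shows "(\<forall>A \<alpha> B \<beta>. (A, \<alpha>) \<in> Obj (equivariant_category G \<B>) \<longrightarrow>
            (B, \<beta>) \<in> Obj (rokhlin_category G \<B>) \<longrightarrow>
            (\<forall>\<gamma> \<in> Hom (equivariant_category G \<C>)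
                     (fobj (equivariant_functor G F) (A, \<alpha>))
                     (fobj (equivariant_functor G F) (B, \<beta>)).
               \<exists>\<phi> \<in> Hom (equivariant_category G \<B>) (A, \<alpha>) (B, \<beta>).
                 fmor (equivariant_functor G F) (A, \<alpha>) (B, \<beta>) \<phi> = \<gamma>) \<and>
            (\<forall>\<phi> \<in> Hom (equivariant_category G \<B>) (A, \<alpha>) (B, \<beta>).
             \<forall>\<psi> \<in> Hom (equivariant_category G \<B>) (A, \<alpha>) (B, \<beta>).
               fmor (equivariant_functor G F) (A, \<alpha>) (B, \<beta>) \<phi> =
                 fmor (equivariant_functor G F) (A, \<alpha>) (B, \<beta>) \<psi> \<longrightarrow>
               G_approx_unitary_equiv G (A, \<alpha>) (B, \<beta>) \<phi> \<psi>)) \<and>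
         classifies_homs (rokhlin_category G \<B>) (equivariant_category G \<C>)
           (equivariant_functor G F) (G_approx_unitary_equiv G)"
proof -
  interpret classifying_functor G \<S> \<B> \<C> F
    by (intro classifying_functor.intro cstar_subcategory.intro classifying_functor_axioms.intro assms)
  let ?E = "equivariant_category G \<B>" and ?D = "equivariant_category G \<C>"
  let ?R = "rokhlin_category G \<B>" and ?F = "equivariant_functor G F"
  have R: "(B, \<beta>) \<in> Obj ?R \<longleftrightarrow> (B, \<beta>) \<in> Obj ?E \<and> rokhlin_property G B \<beta>"
    and HomR: "Hom ?R = Hom ?E" for B \<beta>
    by (auto simp: rokhlin_category_def full_subcategory_def)
  have fmor: "fmor ?F (A, \<alpha>) (B, \<beta>) = fmor F A B" for A \<alpha> B \<beta>
    by (simp add: equivariant_functor_def)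
  have existence: "\<exists>\<phi> \<in> Hom ?E (A, \<alpha>) (B, \<beta>). fmor ?F (A, \<alpha>) (B, \<beta>) \<phi> = \<gamma>"
    if "(A, \<alpha>) \<in> Obj ?E" "(B, \<beta>) \<in> Obj ?R"
      "\<gamma> \<in> Hom ?D (fobj ?F (A, \<alpha>)) (fobj ?F (B, \<beta>))" for A \<alpha> B \<beta> \<gamma>
  proof -
    have \<gamma>: "\<gamma> \<in> Hom \<C> (fobj F A) (fobj F B)"
      using that(3) by (simp add: equivariant_functor_def equivariant_category_simps)
    have eq: "Comp \<C> (fobj F A) (fobj F A) (fobj F B) \<gamma> (fmor F A A (\<alpha> g))
      = Comp \<C> (fobj F A) (fobj F B) (fobj F B) (fmor F B B (\<beta> g)) \<gamma>" if "g \<in> carrier G" for g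
      using \<open>\<gamma> \<in> Hom ?D _ _\<close> that by (simp add: equivariant_functor_def equivariant_category_simps)
    have B: "(B, \<beta>) \<in> Obj ?E" "rokhlin_property G B \<beta>" using that(2) R by auto
    show ?thesis
      using equivariant_lift[OF that(1) B \<gamma> eq] unfolding fmor by blast
  qed
  have uniqueness: "G_approx_unitary_equiv G (A, \<alpha>) (B, \<beta>) \<phi> \<psi>"
    if "(A, \<alpha>) \<in> Obj ?E" "(B, \<beta>) \<in> Obj ?R" "\<phi> \<in> Hom ?E (A, \<alpha>) (B, \<beta>)" "\<psi> \<in> Hom ?E (A, \<alpha>) (B, \<beta>)"
      "fmor ?F (A, \<alpha>) (B, \<beta>) \<phi> = fmor ?F (A, \<alpha>) (B, \<beta>) \<psi>" for A \<alpha> B \<beta> \<phi> \<psi>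
    using that R equivariant_equivalence[of A \<alpha> B \<beta> \<phi> \<psi>] unfolding fmor by blast
  have converse: "fmor ?F (A, \<alpha>) (B, \<beta>) \<phi> = fmor ?F (A, \<alpha>) (B, \<beta>) \<psi>"
    if "(A, \<alpha>) \<in> Obj ?E" "(B, \<beta>) \<in> Obj ?E" "\<phi> \<in> Hom ?E (A, \<alpha>) (B, \<beta>)" "\<psi> \<in> Hom ?E (A, \<alpha>) (B, \<beta>)"
      "G_approx_unitary_equiv G (A, \<alpha>) (B, \<beta>) \<phi> \<psi>" for A \<alpha> B \<beta> \<phi> \<psi>
    using that G_approx_unitary_equiv_imp[of B \<beta> \<phi> A \<psi> \<alpha>] classify_uniqueness[of A B \<phi> \<psi>]
    unfolding fmor by (simp add: equivariant_category_simps)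
  have "is_functor ?R ?D ?F"
    unfolding rokhlin_category_def
    by (intro functor_full_subcategory functor_equivariant assms F.is_functor_axioms) auto
  then have "classifies_homs ?R ?D ?F (G_approx_unitary_equiv G)"
    unfolding classifies_homs_def HomR
  proof (intro conjI ballI)
    fix x y assume "x \<in> Obj ?R" "y \<in> Obj ?R"
    moreover obtain A \<alpha> B \<beta> where xy: "x = (A, \<alpha>)" "y = (B, \<beta>)" by (metis surj_pair)
    ultimately have A: "(A, \<alpha>) \<in> Obj ?E" and B: "(B, \<beta>) \<in> Obj ?R" "(B, \<beta>) \<in> Obj ?E"
      using R by auto
    show "\<exists>\<phi>\<in>Hom ?E x y. fmor ?F x y \<phi> = \<gamma>" if "\<gamma> \<in> Hom ?D (fobj ?F x) (fobj ?F y)" for \<gamma>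
      using existence[OF A B(1)] that unfolding xy .
    show "fmor ?F x y \<phi> = fmor ?F x y \<psi> \<longleftrightarrow> G_approx_unitary_equiv G x y \<phi> \<psi>"
      if "\<phi> \<in> Hom ?E x y" "\<psi> \<in> Hom ?E x y" for \<phi> \<psi>
      using uniqueness[OF A B(1)] converse[OF A B(2)] that unfolding xy by blast
  qed
  then show ?thesis using existence uniqueness by blast
qed

end
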